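(* Let $n\geqslant 2$ and consider the class of systems $$\ddot{\boldsymbol{x}}=A\dot{\boldsymbol{x}}+B\boldsymbol{x}+\boldsymbol{C}(t),\qquad \boldsymbol{x}(t)=(x^1(t),\dots,x^n(t))^{\rm T},$$ where $A$ and $B$ are commuting constant complex $n\times n$ matrices and $\boldsymbol{C}(t)$ is a smooth $n$-component vector-function of $t$. Let $D$ be a constant complex $n\times n$ matrix. The maximal Lie invariance algebra of the system $\ddot{\boldsymbol{x}}=D\boldsymbol{x}$ is of minimal dimension $3n+1$ among systems of this class (that is, $3n+1$ is the minimum of the dimensions of the maximal Lie invariance algebras of systems of this class, and the system $\ddot{\boldsymbol{x}}=D\boldsymbol{x}$ attains it) if and only if the matrix $D$ is not nilpotent and all the elementary divisors of $D$ are co-prime in pairs.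
   Context: The underlying field is $\mathbb C$ and dimensions are over $\mathbb C$. If $\bigoplus_{l=1}^sJ_{\lambda_l}^{k_l}$ is the Jordan normal form of $D$, where $J_{\lambda}^{k}$ is the $k\times k$ Jordan block with eigenvalue $\lambda$, then the elementary divisors of $D$ are the polynomials $(\lambda-\lambda_1)^{k_1},\dots,(\lambda-\lambda_s)^{k_s}$ (listed with repetition, one for each Jordan block). Maximal Lie invariance algebra. For a system $\ddot{\boldsymbol{x}}=\boldsymbol{F}(t,\boldsymbol{x},\dot{\boldsymbol{x}})$ of $n$ second-order ordinary differential equations, consider vector fields $Q=\xi(t,\boldsymbol{x})\partial_t+\eta^a(t,\boldsymbol{x})\partial_{x^a}$ (summation over $a=1,\dots,n$) with smooth coefficients (holomorphic in the complex setting), $t$ ranging over the connected domain on which the system is considered. Write $v^a=\dot x^a$, $D_t=\partial_t+v^a\partial_{x^a}+\ddot x^a\partial_{v^a}$, $\eta^b_{(1)}=D_t\eta^b-v^bD_t\xi$, $\eta^b_{(2)}=D_t\eta^b_{(1)}-\ddot x^bD_t\xi$. The field $Q$ is a Lie symmetry vector field of the system if, for $b=1,\dots,n$, after the substitution $\ddot{\boldsymbol{x}}=\boldsymbol{F}$ one has $$\eta^b_{(2)}=\xi F^b_t+\eta^aF^b_{x^a}+\eta^a_{(1)}F^b_{v^a}$$ identically in $(t,\boldsymbol{x},\boldsymbol{v})$. The maximal Lie invariance algebra of the system is the Lie algebra of all its Lie symmetry vector fields.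
   Formalization: The domain of t is a nonempty open simply connected subset of the complex plane, not merely connected (C(t) holomorphic there): on other domains, e.g. without 0 and with C(t) having entries 1/t, the dimension can drop to 2n, so 3n+1 is not the minimum. *)

theory Defs
  imports
    "HOL-Analysis.Analysis"
    "HOL-Library.Extended_Nat"
    "HOL-Library.Function_Algebras"
    "Jordan_Normal_Form.Jordan_Normal_Form_Existence"
begin

no_notation vec_index (infixl "$" 100)
hide_const (open) Matrix.mat Matrix.vec
hide_type (open) Matrix.mat Matrix.vec

text \<open>The index type carries no order, so the rows and columns are numbered by an arbitrary
  bijection \<open>e\<close>; other numberings give permutation-similar matrices.\<close>

definition matrix_along :: "(nat \<Rightarrow> 'n::finite) \<Rightarrow> complex^'n^'n \<Rightarrow> complex Matrix.mat" where
  "matrix_along e D = Matrix.mat CARD('n) CARD('n) (\<lambda>(i, j). D $ e i $ e j)"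

definition has_jordan_form :: "complex^'n^'n::finite \<Rightarrow> (nat \<times> complex) list \<Rightarrow> bool" where
  "has_jordan_form D bs \<longleftrightarrow>
     (\<exists>e. bij_betw e {..<CARD('n)} UNIV \<and> jordan_nf (matrix_along e D) bs)"

text \<open>A pair \<open>(k, l)\<close> stands for a Jordan block of size \<open>k\<close> with eigenvalue \<open>l\<close>.\<close>

definition elementary_divisors :: "complex^'n^'n::finite \<Rightarrow> complex poly list" where
  "elementary_divisors D = map (\<lambda>(k, l). [:- l, 1:] ^ k) (SOME bs. has_jordan_form D bs)"

lemma has_jordan_form_exists: "\<exists>bs. has_jordan_form (D :: complex^'n^'n::finite) bs"
proof -
  obtain e :: "nat \<Rightarrow> 'n" where e: "bij_betw e {..<CARD('n)} UNIV"
    using ex_bij_betw_nat_finite[of "UNIV :: 'n set"] by (auto simp: atLeast0LessThan)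
  have A: "matrix_along e D \<in> carrier_mat CARD('n) CARD('n)"
    by (simp add: matrix_along_def)
  from char_poly_factorized[OF A] jordan_nf_exists[OF A] e show ?thesis
    unfolding has_jordan_form_def by blast
qed

definition pairwise_coprime :: "complex poly list \<Rightarrow> bool" where
  "pairwise_coprime ps \<longleftrightarrow> (\<forall>i < length ps. \<forall>j < length ps. i \<noteq> j \<longrightarrow> coprime (ps ! i) (ps ! j))"

definition nilpotent_matrix :: "complex^'n^'n::finite \<Rightarrow> bool" where
  "nilpotent_matrix D \<longleftrightarrow> (\<exists>k. (((**) D) ^^ k) (Finite_Cartesian_Product.mat 1) = 0)"

text \<open>A vector field $\xi\partial_t + \eta^a\partial_{x^a}$ is the map \<open>Q\<close> with
  \<open>Q (t, x) = (\<xi> (t, x), \<eta> (t, x))\<close>.\<close>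

type_synonym 'n vfield = "complex \<times> (complex^'n) \<Rightarrow> complex \<times> (complex^'n)"

definition cscale :: "complex \<Rightarrow> complex \<times> (complex^'n) \<Rightarrow> complex \<times> (complex^'n::finite)" where
  "cscale c p = (c * fst p, c *s snd p)"

definition vf_scale :: "complex \<Rightarrow> 'n vfield \<Rightarrow> ('n::finite) vfield" where
  "vf_scale c Q = (\<lambda>p. cscale c (Q p))"

global_interpretation vf: vector_space "vf_scale :: complex \<Rightarrow> 'n vfield \<Rightarrow> ('n::finite) vfield"
  by unfold_locales
    (auto simp: vf_scale_def cscale_def fun_eq_iff vec_eq_iff algebra_simps prod_eq_iff)

definition vf_dim :: "('n::finite) vfield set \<Rightarrow> enat" where
  "vf_dim V = (if \<exists>B. finite B \<and> V \<subseteq> vf.span B then enat (vf.dim V) else \<infinity>)"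

text \<open>Holomorphy in several variables: existence of a complex-linear Frechet derivative at every
  point.  To identify fields on \<open>U \<times> UNIV\<close> with functions on the whole type, they are
  required to be 0 elsewhere.\<close>

definition holomorphic_vfields :: "complex set \<Rightarrow> ('n::finite) vfield set" where
  "holomorphic_vfields U = {Q.
     (\<forall>p \<in> U \<times> UNIV. \<exists>Q'. (Q has_derivative Q') (at p) \<and>
        (\<forall>c h. Q' (cscale c h) = cscale c (Q' h))) \<and>
     (\<forall>p. p \<notin> U \<times> UNIV \<longrightarrow> Q p = 0)}"

text \<open>Functions of $(t, x, v, w)$, where $v$ and $w$ stand for the first and
  second derivatives of $x$, and their partial derivatives.\<close>

type_synonym 'n jetfun = "complex \<Rightarrow> complex^'n \<Rightarrow> complex^'n \<Rightarrow> complex^'n \<Rightarrow> complex"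

definition pd_t :: "'n jetfun \<Rightarrow> ('n::finite) jetfun" where
  "pd_t f t x v w = deriv (\<lambda>s. f s x v w) t"

definition pd_x :: "'n \<Rightarrow> 'n jetfun \<Rightarrow> ('n::finite) jetfun" where
  "pd_x a f t x v w = deriv (\<lambda>s. f t (x + s *s axis a 1) v w) 0"

definition pd_v :: "'n \<Rightarrow> 'n jetfun \<Rightarrow> ('n::finite) jetfun" where
  "pd_v a f t x v w = deriv (\<lambda>s. f t x (v + s *s axis a 1) w) 0"

definition total_deriv :: "'n jetfun \<Rightarrow> ('n::finite) jetfun" where
  "total_deriv f t x v w =
     pd_t f t x v w + (\<Sum>a\<in>UNIV. v $ a * pd_x a f t x v w) + (\<Sum>a\<in>UNIV. w $ a * pd_v a f t x v w)"

definition xi :: "'n vfield \<Rightarrow> ('n::finite) jetfun" where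
  "xi Q t x v w = fst (Q (t, x))"

definition eta :: "'n vfield \<Rightarrow> 'n \<Rightarrow> ('n::finite) jetfun" where
  "eta Q b t x v w = snd (Q (t, x)) $ b"

definition eta1 :: "'n vfield \<Rightarrow> 'n \<Rightarrow> ('n::finite) jetfun" where
  "eta1 Q b t x v w = total_deriv (eta Q b) t x v w - v $ b * total_deriv (xi Q) t x v w"

definition eta2 :: "'n vfield \<Rightarrow> 'n \<Rightarrow> ('n::finite) jetfun" where
  "eta2 Q b t x v w = total_deriv (eta1 Q b) t x v w - w $ b * total_deriv (xi Q) t x v w"

text \<open>A system is given by its right-hand side \<open>F t x v\<close>, considered for \<open>t\<close> in \<open>U\<close>.\<close>

type_synonym 'n ode2 = "complex \<Rightarrow> complex^'n \<Rightarrow> complex^'n \<Rightarrow> complex^'n"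

definition rhs :: "'n ode2 \<Rightarrow> 'n \<Rightarrow> ('n::finite) jetfun" where
  "rhs F b t x v w = F t x v $ b"

definition lie_symmetry :: "complex set \<Rightarrow> 'n ode2 \<Rightarrow> ('n::finite) vfield \<Rightarrow> bool" where
  "lie_symmetry U F Q \<longleftrightarrow>
     (\<forall>b. \<forall>t\<in>U. \<forall>x v. let w = F t x v in
        eta2 Q b t x v w =
          xi Q t x v w * pd_t (rhs F b) t x v w
          + (\<Sum>a\<in>UNIV. eta Q a t x v w * pd_x a (rhs F b) t x v w)
          + (\<Sum>a\<in>UNIV. eta1 Q a t x v w * pd_v a (rhs F b) t x v w))"

definition max_lie_invariance_algebra :: "complex set \<Rightarrow> 'n ode2 \<Rightarrow> ('n::finite) vfield set" where
  "max_lie_invariance_algebra U F = {Q \<in> holomorphic_vfields U. lie_symmetry U F Q}"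

definition commuting_systems :: "complex set \<Rightarrow> ('n::finite) ode2 set" where
  "commuting_systems U =
     {(\<lambda>t x v. A *v v + B *v x + C t) | A B C.
        A ** B = B ** A \<and> (\<forall>b. (\<lambda>t. C t $ b) holomorphic_on U)}"

end

theory Submission
  imports "HOL-Complex_Analysis.Complex_Analysis" Defs
begin

text \<open>The number $3n+1$ is explained by a description of all symmetries of $\ddot x = Dx$ for a matrix
  \<open>D\<close> that is not scalar. They are the fields $(c + dt)\partial_t + (\Gamma x + h(t))\partial_x$ in which
  \<open>c\<close>, \<open>d\<close> are constants, \<open>h\<close> solves $\ddot h = Dh$ and \<open>\<Gamma>\<close> is a constant matrix with
  $\Gamma D - D\Gamma = 2dD$ (\<open>nonscalar_symmetries\<close>). Hence the dimension of the algebra is $1 + 2n$ plus the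
  dimension of the space of all pairs $(\Gamma, d)$, called weights of \<open>D\<close> below.

  The weights with $d = 0$ form the centralizer of \<open>D\<close>. It has dimension at least \<open>n\<close>, and the Jordan form
  shows that the dimension is \<open>n\<close> exactly if no eigenvalue belongs to two blocks, that is, if the
  elementary divisors are pairwise coprime: within one block a commuting matrix is constant along diagonals,
  and an additional entry can link two blocks only if their eigenvalues agree. A weight with $d \neq 0$ exists
  exactly if \<open>D\<close> is nilpotent: on the one hand $\Gamma D^k - D^k\Gamma = 2kdD^k$ would give infinitely many
  eigenvalues of $X \mapsto \Gamma X - X\Gamma$, on the other hand a nilpotent Jordan matrix has a diagonal
  \<open>\<Gamma>\<close>. So the space of weights has dimension \<open>n\<close> in the case of the theorem and at least $n + 1$
  otherwise (\<open>weight_embeddings\<close>).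

  For a general system of the class, the substitution $x = e^{tA/2}y + p(t)$ with a particular solution \<open>p\<close>
  leads to $\ddot y = (B + \frac14 A^2)y$, because \<open>A\<close> and \<open>B\<close> commute. Therefore the fields that belong
  to the weights of $B + \frac14 A^2$ have counterparts for every system of the class, and the dimension is at
  least $3n + 1$ throughout (\<open>vf_dim_lower_bound\<close>). The simply connected domain is needed for the existence
  of \<open>p\<close>. For $\ddot x = Dx$ the same bound gives $3n+2$ if \<open>D\<close> is nilpotent or has two elementary
  divisors with a common factor; this includes the scalar matrices. In the remaining case the description of the
  symmetries shows that there are no others (\<open>vf_dim_upper_bound\<close>).

  The description is obtained by expanding the symmetry condition in powers of the velocity. This uses second
  partial derivatives of the coefficients, which exist and are symmetric because the coefficients are
  complex differentiable (\<open>mixed_dir_deriv\<close>).\<close>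

(* The sign $ selects components of vectors over a finite index type throughout, and vec_eq_iff refers to these
   vectors; the same names are in use for power series and for vectors indexed by natural numbers. *)
no_notation fps_nth (infixl "$" 75)

lemmas vec_eq_iff = Finite_Cartesian_Product.vec_eq_iff

section \<open>Vectors and matrices\<close>

lemma sum_axis: "(\<Sum>a\<in>UNIV. f a * axis b (1::complex) $ a) = f (b :: 'n::finite)"
proof -
  have "(\<Sum>a\<in>UNIV. f a * axis b (1::complex) $ a) = (\<Sum>a\<in>UNIV. if a = b then f b else 0)"
    by (intro sum.cong) (auto simp: axis_def)
  then show ?thesis by simp
qed

text \<open>The scalar multiplication of the type class \<open>real_vector\<close> is restricted to real factors, and on
  a matrix \<open>*s\<close> would expect a row as its factor.\<close>

definition msmult :: "complex \<Rightarrow> complex^'m^'n \<Rightarrow> complex^'m^'n" where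
  "msmult c M = (\<chi> i j. c * M $ i $ j)"

lemma msmult_nth [simp]: "msmult c M $ i $ j = c * M $ i $ j"
  by (simp add: msmult_def)

lemma matrix_distribs:
  fixes A A' :: "complex^'m^'n" and B B' :: "complex^'k^'m"
  shows "A ** (B + B') = A ** B + A ** B'" "(A + A') ** B = A ** B + A' ** B"
    "A ** (B - B') = A ** B - A ** B'" "(A - A') ** B = A ** B - A' ** B"
    "A ** msmult c B = msmult c (A ** B)" "msmult c A ** B = msmult c (A ** B)"
    "A ** 0 = 0" "0 ** B = 0"
  by (auto simp: vec_eq_iff matrix_matrix_mult_def algebra_simps sum.distrib sum_subtractf sum_distrib_left)

lemma msmult_distribs:
  fixes A B :: "complex^'m^'n"
  shows "msmult c (A + B) = msmult c A + msmult c B" "msmult c (A - B) = msmult c A - msmult c B"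
    "msmult (c + d) A = msmult c A + msmult d A" "msmult c (msmult d A) = msmult (c * d) A"
    "msmult 0 A = 0" "msmult 1 A = A" "msmult c 0 = 0"
  by (auto simp: vec_eq_iff algebra_simps)

lemma matrix_vector_distribs:
  fixes A A' :: "complex^'m^'n"
  shows "msmult c A *v x = c *s (A *v x)" "A *v (c *s x) = c *s (A *v x)"
    "(A + A') *v x = A *v x + A' *v x" "A *v (x + y) = A *v x + A *v y"
    "(A - A') *v x = A *v x - A' *v x" "A *v (x - y) = A *v x - A *v y"
  by (auto simp: vec_eq_iff matrix_vector_mult_def algebra_simps sum.distrib sum_subtractf sum_distrib_left)

section \<open>Holomorphic functions of several variables\<close>

lemma constant_of_zero_derivative:
  fixes f :: "complex \<Rightarrow> complex"
  assumes "connected S" "open S" "\<And>s. s \<in> S \<Longrightarrow> (f has_field_derivative 0) (at s)" "a \<in> S" "b \<in> S"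
  shows "f a = f b"
  using has_field_derivative_0_imp_constant_on[OF assms(3,1,2)] assms(4,5)
  by (auto simp: constant_on_def)

text \<open>The constant depends on \<open>f\<close> only through the bound \<open>M\<close>. Applied to a family of functions with a
  common bound, the estimate shows that the difference quotients converge uniformly in the parameter.\<close>

lemma holomorphic_first_order_remainder:
  assumes holf: "f holomorphic_on ball 0 d" and cont: "continuous_on (cball 0 d) f" and d: "d > 0"
    and M: "\<And>z. z \<in> cball 0 d \<Longrightarrow> cmod (f z) \<le> M" and z: "cmod z \<le> d / 2"
  shows "cmod (f z - f 0 - z * deriv f 0) \<le> 2 * (M + 1) / (d / 2)^2 * (cmod z)^2"
proof -
  have M0: "0 \<le> M" using order_trans[OF norm_ge_zero M[of 0]] d by simp
  have B: "cmod ((deriv ^^ 2) f x) \<le> 2 * (M + 1) / (d / 2)^2" if x: "x \<in> cball 0 (d/2)" for x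
  proof -
    have sub: "cball x (d/2) \<subseteq> cball 0 d"
      using x by (auto simp: dist_norm intro: order_trans[OF norm_triangle_sub])
        (smt (verit, best) norm_minus_commute norm_triangle_sub)
    have sub2: "ball x (d/2) \<subseteq> ball 0 d"
      using x by (auto simp: dist_norm)
        (smt (verit, best) norm_minus_commute norm_triangle_sub field_sum_of_halves)
    have "cmod ((deriv ^^ 2) f x) \<le> fact 2 * (M + 1) / (d/2) ^ 2"
    proof (rule Cauchy_higher_deriv_bound[where y = 0])
      show "f holomorphic_on ball x (d/2)" using holf sub2 by (rule holomorphic_on_subset)
      show "continuous_on (cball x (d/2)) f" using cont sub by (rule continuous_on_subset)
      show "f w \<in> ball 0 (M + 1)" if "w \<in> ball x (d/2)" for w
        using M[of w] sub that by (force simp: less_imp_le)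
    qed (use d in auto)
    then show ?thesis by simp
  qed
  have "cmod ((deriv ^^ 0) f z - (\<Sum>i\<le>1. (deriv ^^ i) f 0 * (z - 0) ^ i / fact i))
     \<le> 2 * (M + 1) / (d / 2)^2 * cmod (z - 0) ^ Suc 1 / fact 1"
  proof (rule complex_Taylor[where S = "cball 0 (d/2)" and f = "\<lambda>i. (deriv ^^ i) f"])
    show "((deriv ^^ i) f has_field_derivative (deriv ^^ Suc i) f x) (at x within cball 0 (d/2))"
      if "x \<in> cball 0 (d/2)" for i x
    proof -
      have "(deriv ^^ i) f holomorphic_on ball 0 d"
        by (rule holomorphic_higher_deriv[OF holf]) auto
      moreover have "x \<in> ball 0 d" using that d by auto
      ultimately have "((deriv ^^ i) f has_field_derivative deriv ((deriv ^^ i) f) x) (at x)"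
        by (intro holomorphic_derivI[of _ "ball 0 d"]) auto
      then show ?thesis by (auto intro: has_field_derivative_at_within)
    qed
  qed (use B z d in \<open>auto simp: numeral_2_eq_2\<close>)
  then show ?thesis by (simp add: algebra_simps power2_eq_square)
qed

text \<open>The partial derivative with respect to \<open>s\<close> at 0 is the limit of the difference quotients with step
  \<open>1/m\<close>. These are holomorphic in the parameter \<open>r\<close> and converge uniformly in it, so by Weierstrass' theorem
  the limit is holomorphic in \<open>r\<close>, and its derivative is the limit of their derivatives. The latter are
  again difference quotients, now of the partial derivative with respect to \<open>r\<close>.\<close>

lemma derivative_of_partial:
  fixes \<phi> :: "complex \<Rightarrow> complex \<Rightarrow> complex"
  assumes d: "d > 0"
    and cont: "continuous_on (cball 0 d \<times> cball 0 d) (\<lambda>(s, r). \<phi> s r)"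
    and hol1: "\<And>r. r \<in> cball 0 d \<Longrightarrow> (\<lambda>s. \<phi> s r) holomorphic_on ball 0 d"
    and hol2: "\<And>s. s \<in> cball 0 d \<Longrightarrow> (\<lambda>r. \<phi> s r) holomorphic_on ball 0 d"
  shows "\<exists>l. ((\<lambda>r. deriv (\<lambda>s. \<phi> s r) 0) has_field_derivative l) (at 0) \<and>
             (\<lambda>m. of_nat m * (deriv (\<lambda>r. \<phi> (1 / of_nat m) r) 0 - deriv (\<lambda>r. \<phi> 0 r) 0)) \<longlonglongrightarrow> l"
proof -
  \<comment> \<open>Steps \<open>1/m\<close> with small \<open>m\<close> may leave the disc, so the index is shifted by \<open>m0\<close>.\<close>
  obtain m0 where m0: "real m0 \<ge> 2 / d" "m0 > 0"
    using d by (metis gr_zeroI le_cases of_nat_0 real_arch_simple zero_less_divide_iff not_le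
         zero_less_numeral)
  define N where "N m = m + m0" for m
  define h where "h m = (1 / of_nat (N m) :: complex)" for m
  have N: "real (N m) \<ge> 2 / d" "N m > 0" for m using m0 by (auto simp: N_def)
  have h: "cmod (h m) \<le> d / 2" for m
    using N[of m] d by (simp add: h_def norm_divide field_simps)
  have hball: "h m \<in> ball 0 d" "h m \<in> cball 0 d" for m using h[of m] d by auto
  have "compact ((\<lambda>(s, r). \<phi> s r) ` (cball 0 d \<times> cball 0 d))"
    by (intro compact_continuous_image cont compact_Times compact_cball)
  then obtain M where M: "\<And>s r. s \<in> cball 0 d \<Longrightarrow> r \<in> cball 0 d \<Longrightarrow> cmod (\<phi> s r) \<le> M"
    by (force dest!: compact_imp_bounded simp: bounded_iff)
  define f where "f m r = of_nat (N m) * (\<phi> (h m) r - \<phi> 0 r)" for m r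
  define g where "g r = deriv (\<lambda>s. \<phi> s r) 0" for r
  define C where "C = 2 * (M + 1) / (d / 2)^2"
  have M0: "0 \<le> M" using order_trans[OF norm_ge_zero M[of 0 0]] d by simp
  have bnd: "cmod (f m r - g r) \<le> C / real (N m)" if r: "r \<in> cball 0 d" for m r
  proof -
    have "cmod (\<phi> (h m) r - \<phi> 0 r - h m * g r) \<le> C * (cmod (h m))^2"
      unfolding C_def g_def
    proof (rule holomorphic_first_order_remainder[OF hol1[OF r] _ d])
      have "continuous_on (cball 0 d) ((\<lambda>(s, r). \<phi> s r) \<circ> (\<lambda>s. (s, r)))"
        using r by (intro continuous_on_compose continuous_intros continuous_on_subset[OF cont]) auto
      then show "continuous_on (cball 0 d) (\<lambda>s. \<phi> s r)" by (simp add: o_def)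
    qed (use M r h in auto)
    moreover have "f m r - g r = of_nat (N m) * (\<phi> (h m) r - \<phi> 0 r - h m * g r)"
      using N[of m] by (simp add: f_def h_def field_simps)
    ultimately have "cmod (f m r - g r) \<le> real (N m) * (C * (cmod (h m))^2)"
      by (simp add: norm_mult mult_left_mono)
    also have "\<dots> = C / real (N m)"
      using N[of m] by (simp add: h_def norm_divide field_simps power2_eq_square)
    finally show ?thesis .
  qed
  have lim0: "(\<lambda>m. C / real (N m)) \<longlonglongrightarrow> 0"
    unfolding N_def using LIMSEQ_ignore_initial_segment[OF lim_const_over_n[of C], of m0] by simp
  have ul: "uniform_limit (cball 0 d) f g sequentially"
  proof (rule uniform_limitI)
    fix e :: real assume "e > 0"
    with lim0 have "\<forall>\<^sub>F m in sequentially. C / real (N m) < e"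
      by (auto intro: order_tendstoD)
    then show "\<forall>\<^sub>F m in sequentially. \<forall>r\<in>cball 0 d. dist (f m r) (g r) < e"
      by eventually_elim (auto simp: dist_norm intro: le_less_trans[OF bnd])
  qed
  define f' where "f' m r = of_nat (N m) * (deriv (\<phi> (h m)) r - deriv (\<phi> 0) r)" for m r
  have "\<exists>g'. \<forall>x\<in>ball 0 d. (g has_field_derivative g' x) (at x) \<and> (\<lambda>m. f' m x) \<longlonglongrightarrow> g' x"
  proof (rule has_complex_derivative_uniform_sequence[of _ f])
    fix r :: complex and k assume r: "r \<in> ball 0 d"
    show "(f k has_field_derivative f' k r) (at r)"
      unfolding f_def f'_def
      using hball[of k] r d
      by (auto intro!: derivative_eq_intros holomorphic_derivI[OF hol2])
  next
    fix r :: complex assume "r \<in> ball 0 d"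
    then obtain e where "e > 0" "cball r e \<subseteq> ball 0 d"
      using open_contains_cball open_ball by blast
    then show "\<exists>e>0. cball r e \<subseteq> ball 0 d \<and> uniform_limit (cball r e) f g sequentially"
      by (intro exI[of _ e]) (auto intro!: uniform_limit_on_subset[OF ul] dest!: subsetD)
  qed auto
  then obtain l where l: "(g has_field_derivative l) (at 0)" "(\<lambda>m. f' m 0) \<longlonglongrightarrow> l"
    using d by force
  have "(\<lambda>m. of_nat m * (deriv (\<lambda>r. \<phi> (1 / of_nat m) r) 0 - deriv (\<lambda>r. \<phi> 0 r) 0)) \<longlonglongrightarrow> l"
    by (rule LIMSEQ_offset[of _ m0]) (use l(2) in \<open>simp add: f'_def h_def N_def\<close>)
  with l(1) show ?thesis unfolding g_def by blast
qed

text \<open>By \<open>derivative_of_partial\<close> the derivative on the left is a limit of difference quotients of the other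
  partial derivative. With the variables exchanged, the same lemma says that this other partial derivative is
  differentiable, so the limit is its derivative.\<close>

proposition mixed_partials:
  fixes \<phi> :: "complex \<Rightarrow> complex \<Rightarrow> complex"
  assumes d: "d > 0"
    and cont: "continuous_on (cball 0 d \<times> cball 0 d) (\<lambda>(s, r). \<phi> s r)"
    and hol1: "\<And>r. r \<in> cball 0 d \<Longrightarrow> (\<lambda>s. \<phi> s r) holomorphic_on ball 0 d"
    and hol2: "\<And>s. s \<in> cball 0 d \<Longrightarrow> (\<lambda>r. \<phi> s r) holomorphic_on ball 0 d"
  shows "((\<lambda>r. deriv (\<lambda>s. \<phi> s r) 0) has_field_derivative deriv (\<lambda>s. deriv (\<lambda>r. \<phi> s r) 0) 0) (at 0)"
proof -
  obtain l where l: "((\<lambda>r. deriv (\<lambda>s. \<phi> s r) 0) has_field_derivative l) (at 0)"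
    "(\<lambda>m. of_nat m * (deriv (\<lambda>r. \<phi> (1 / of_nat m) r) 0 - deriv (\<lambda>r. \<phi> 0 r) 0)) \<longlonglongrightarrow> l"
    using derivative_of_partial[OF assms] by blast
  have cont': "continuous_on (cball 0 d \<times> cball 0 d) (\<lambda>(r, s). \<phi> s r)"
  proof -
    have "continuous_on (cball 0 d \<times> cball 0 d) ((\<lambda>(s, r). \<phi> s r) \<circ> (\<lambda>q. (snd q, fst q)))"
      by (intro continuous_on_compose continuous_intros continuous_on_subset[OF cont]) auto
    then show ?thesis by (simp add: o_def case_prod_unfold)
  qed
  obtain k where k: "((\<lambda>s. deriv (\<lambda>r. \<phi> s r) 0) has_field_derivative k) (at 0)"
    using derivative_of_partial[of d "\<lambda>r s. \<phi> s r", OF d cont' hol2 hol1] by blast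
  have "((\<lambda>s. (deriv (\<lambda>r. \<phi> s r) 0 - deriv (\<lambda>r. \<phi> 0 r) 0) / s) \<longlongrightarrow> k) (at 0)"
    using k by (simp add: has_field_derivative_iff)
  moreover have "filterlim (\<lambda>m. 1 / of_nat (Suc m) :: complex) (at 0) sequentially"
    unfolding filterlim_at
    using LIMSEQ_Suc[OF lim_1_over_n[where 'a = complex]] by (auto simp del: of_nat_Suc)
  ultimately have "((\<lambda>m. (deriv (\<lambda>r. \<phi> (1 / of_nat (Suc m)) r) 0 - deriv (\<lambda>r. \<phi> 0 r) 0)
      / (1 / of_nat (Suc m))) \<longlongrightarrow> k) sequentially"
    by (rule filterlim_compose)
  then have "(\<lambda>m. of_nat (Suc m) * (deriv (\<lambda>r. \<phi> (1 / of_nat (Suc m)) r) 0 - deriv (\<lambda>r. \<phi> 0 r) 0)) \<longlonglongrightarrow> k"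
    by (simp add: mult.commute del: of_nat_Suc)
  with LIMSEQ_Suc[OF l(2)] have "l = k" by (rule LIMSEQ_unique)
  moreover have "k = deriv (\<lambda>s. deriv (\<lambda>r. \<phi> s r) 0) 0" using k by (simp add: DERIV_imp_deriv)
  ultimately show ?thesis using l(1) by simp
qed

definition dir_deriv :: "(complex \<times> (complex^'n) \<Rightarrow> complex) \<Rightarrow> complex \<times> (complex^'n)
    \<Rightarrow> complex \<times> (complex^'n::finite) \<Rightarrow> complex" where
  "dir_deriv f h p = deriv (\<lambda>s. f (p + cscale s h)) 0"

text \<open>The condition that \<open>holomorphic_vfields\<close> imposes on a field, for a single coefficient.\<close>

definition cdifferentiable :: "complex set \<Rightarrow> (complex \<times> (complex^'n::finite) \<Rightarrow> complex) \<Rightarrow> bool" where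
  "cdifferentiable U f \<longleftrightarrow> (\<forall>p \<in> U \<times> UNIV. \<exists>f'. (f has_derivative f') (at p) \<and>
     (\<forall>c h. f' (cscale c h) = c * f' h))"

lemma cscale_simps [simp]:
  "cscale 0 h = 0" "cscale 1 h = h" "cscale c 0 = 0" "fst (cscale c h) = c * fst h"
  "snd (cscale c h) = c *s snd h"
  by (auto simp: cscale_def zero_prod_def)

lemma cscale_add: "cscale (a + b) h = cscale a h + cscale b h" "cscale c (h + k) = cscale c h + cscale c k"
  "cscale a (cscale b h) = cscale (a * b) h"
  by (auto simp: cscale_def vec_eq_iff algebra_simps)

lemma bounded_linear_cscale: "bounded_linear (\<lambda>s. cscale s h)"
proof -
  have "linear (\<lambda>s. cscale s h)"
    by (rule linearI) (simp_all add: cscale_def prod_eq_iff vec_eq_iff distrib_right)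
  then show ?thesis by (simp add: linear_conv_bounded_linear)
qed

lemma continuous_on_cscale [continuous_intros]:
  "continuous_on S g \<Longrightarrow> continuous_on S (\<lambda>x. cscale (g x) h)"
  by (rule bounded_linear.continuous_on[OF bounded_linear_cscale])

lemma dir_deriv_at:
  fixes f :: "complex \<times> (complex^'n::finite) \<Rightarrow> complex"
  assumes "cdifferentiable U f" and p: "p \<in> U \<times> UNIV"
  shows has_derivative_dir_deriv: "(f has_derivative (\<lambda>h. dir_deriv f h p)) (at p)"
    and dir_deriv_cscale: "dir_deriv f (cscale c h) p = c * dir_deriv f h p"
    and dir_deriv_add: "dir_deriv f (h + k) p = dir_deriv f h p + dir_deriv f k p"
    and line_derivative0: "((\<lambda>s. f (p + cscale s h)) has_field_derivative dir_deriv f h p) (at 0)"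
proof -
  obtain f' where f': "(f has_derivative f') (at p)" "\<And>c h. f' (cscale c h) = c * f' h"
    using bspec[OF assms(1)[unfolded cdifferentiable_def] p] by blast
  have line: "((\<lambda>s. f (p + cscale s h)) has_field_derivative f' h) (at 0)" for h
  proof -
    have "((\<lambda>s. p + cscale s h) has_derivative (\<lambda>s. cscale s h)) (at 0)"
      by (auto intro!: derivative_eq_intros bounded_linear_imp_has_derivative bounded_linear_cscale)
    then have "((\<lambda>s. f (p + cscale s h)) has_derivative (\<lambda>s. f' (cscale s h))) (at 0)"
      by (rule has_derivative_compose) (use f'(1) in simp)
    then show ?thesis by (simp add: f'(2) has_field_derivative_def mult_commute_abs)
  qed
  have eq: "f' h = dir_deriv f h p" for h
    using DERIV_imp_deriv[OF line[of h]] by (simp add: dir_deriv_def)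
  then have eq': "f' = (\<lambda>h. dir_deriv f h p)" by auto
  show "(f has_derivative (\<lambda>h. dir_deriv f h p)) (at p)" using f'(1) by (simp add: eq')
  show "dir_deriv f (cscale c h) p = c * dir_deriv f h p" using f'(2) by (simp add: eq')
  show "dir_deriv f (h + k) p = dir_deriv f h p + dir_deriv f k p"
    using linear_add[OF has_derivative_linear[OF f'(1)], of h k] by (simp add: eq')
  show "((\<lambda>s. f (p + cscale s h)) has_field_derivative dir_deriv f h p) (at 0)"
    using line[of h] by (simp add: eq')
qed

lemma line_derivative:
  assumes "cdifferentiable U f" and "p + cscale s h \<in> U \<times> UNIV"
  shows "((\<lambda>s. f (p + cscale s h)) has_field_derivative dir_deriv f h (p + cscale s h)) (at s)"
proof -
  have "((\<lambda>r. f (p + cscale (r + s) h)) has_field_derivative dir_deriv f h (p + cscale s h)) (at 0)"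
    using line_derivative0[OF assms, of h] by (simp add: cscale_add algebra_simps)
  then show ?thesis using DERIV_shift[of "\<lambda>s. f (p + cscale s h)" _ 0 s] by simp
qed

lemma dir_deriv_cong:
  assumes U: "open U" and eq: "\<And>q. q \<in> U \<times> UNIV \<Longrightarrow> f q = g q" and p: "p \<in> U \<times> UNIV"
  shows "dir_deriv f h p = dir_deriv g h p"
  unfolding dir_deriv_def
proof (rule deriv_cong_ev)
  have "open ((\<lambda>s. p + cscale s h) -` (U \<times> UNIV))"
    by (intro open_vimage open_Times U continuous_intros) auto
  then show "\<forall>\<^sub>F s in nhds 0. f (p + cscale s h) = g (p + cscale s h)"
    using p eq by (auto simp: eventually_nhds intro!: exI[of _ "(\<lambda>s. p + cscale s h) -` (U \<times> UNIV)"])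
qed auto

text \<open>The restriction of \<open>f\<close> to the plane \<open>p + s h + r k\<close> satisfies the hypotheses of
  \<open>mixed_partials\<close> on a small bidisc. So a directional derivative of a complex differentiable function can be
  differentiated once more along any line, which is all the regularity that the second prolongation needs.\<close>

proposition mixed_dir_deriv:
  fixes f :: "complex \<times> (complex^'n::finite) \<Rightarrow> complex"
  assumes U: "open U" and f: "cdifferentiable U f" and p: "p \<in> U \<times> UNIV"
  shows "((\<lambda>r. dir_deriv f h (p + cscale r k)) has_field_derivative dir_deriv (dir_deriv f k) h p) (at 0)"
proof -
  define W :: "(complex \<times> (complex^'n)) set" where "W = U \<times> UNIV"
  have W: "open W" "p \<in> W" unfolding W_def using U p by (auto intro: open_Times)
  define L where "L = (\<lambda>(s, r). p + cscale s h + cscale r k)"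
  have contL: "continuous_on S L" for S
    unfolding L_def case_prod_unfold by (intro continuous_intros)
  have "open (L -` W)" by (intro open_vimage W contL)
  moreover have "(0, 0) \<in> L -` W" using W by (simp add: L_def)
  ultimately obtain A B where AB: "open A" "open B" "(0, 0) \<in> A \<times> B" "A \<times> B \<subseteq> L -` W"
    by (rule open_prod_elim)
  then have "0 \<in> A \<inter> B" "open (A \<inter> B)" by auto
  then obtain d where d: "d > 0" "cball 0 d \<subseteq> A \<inter> B"
    using open_contains_cball by blast
  have LW: "p + cscale s h + cscale r k \<in> W" if "s \<in> cball 0 d" "r \<in> cball 0 d" for s r
    using AB(4) d that by (force simp: L_def)
  have cont: "continuous_on W f"
    unfolding W_def
    by (intro continuous_at_imp_continuous_on ballI)
      (rule has_derivative_continuous[OF has_derivative_dir_deriv[OF f]])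
  have "((\<lambda>r. deriv (\<lambda>s. f (p + cscale s h + cscale r k)) 0) has_field_derivative
      deriv (\<lambda>s. deriv (\<lambda>r. f (p + cscale s h + cscale r k)) 0) 0) (at 0)"
  proof (rule mixed_partials[OF d(1)])
    have "continuous_on (cball 0 d \<times> cball 0 d) (f \<circ> L)"
      by (intro continuous_on_compose contL continuous_on_subset[OF cont])
        (use LW in \<open>auto simp: L_def\<close>)
    then show "continuous_on (cball 0 d \<times> cball 0 d) (\<lambda>(s, r). f (p + cscale s h + cscale r k))"
      by (simp add: o_def L_def case_prod_unfold)
  next
    fix r :: complex assume r: "r \<in> cball 0 d"
    show "(\<lambda>s. f (p + cscale s h + cscale r k)) holomorphic_on ball 0 d"
    proof (rule holomorphic_onI)
      fix s :: complex assume "s \<in> ball 0 d"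
      then have "(p + cscale r k) + cscale s h \<in> U \<times> UNIV"
        using LW[of s r] r by (simp add: W_def algebra_simps)
      from line_derivative[OF f this]
      show "(\<lambda>s. f (p + cscale s h + cscale r k)) field_differentiable at s within ball 0 d"
        by (auto simp: algebra_simps field_differentiable_def intro!: has_field_derivative_at_within)
    qed
  next
    fix s :: complex assume s: "s \<in> cball 0 d"
    show "(\<lambda>r. f (p + cscale s h + cscale r k)) holomorphic_on ball 0 d"
    proof (rule holomorphic_onI)
      fix r :: complex assume "r \<in> ball 0 d"
      then have "(p + cscale s h) + cscale r k \<in> U \<times> UNIV"
        using LW[of s r] s by (simp add: W_def)
      from line_derivative[OF f this]
      show "(\<lambda>r. f (p + cscale s h + cscale r k)) field_differentiable at r within ball 0 d"
        by (auto simp: field_differentiable_def intro!: has_field_derivative_at_within)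
    qed
  qed
  then show ?thesis
    unfolding dir_deriv_def by (simp add: algebra_simps)
qed

lemma dir_deriv_commute:
  fixes f :: "complex \<times> (complex^'n::finite) \<Rightarrow> complex"
  assumes U: "open U" and f: "cdifferentiable U f" and p: "p \<in> U \<times> UNIV"
  shows "dir_deriv (dir_deriv f h) k p = dir_deriv (dir_deriv f k) h p"
  using DERIV_imp_deriv[OF mixed_dir_deriv[OF assms, of h k]] by (simp add: dir_deriv_def)

lemma line_derivative2:
  fixes f :: "complex \<times> (complex^'n::finite) \<Rightarrow> complex"
  assumes U: "open U" and f: "cdifferentiable U f" and p: "p + cscale s k \<in> U \<times> UNIV"
  shows "((\<lambda>s. dir_deriv f h (p + cscale s k)) has_field_derivative
      dir_deriv (dir_deriv f h) k (p + cscale s k)) (at s)"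
proof -
  have "((\<lambda>r. dir_deriv f h (p + cscale (r + s) k)) has_field_derivative
      dir_deriv (dir_deriv f h) k (p + cscale s k)) (at 0)"
    using mixed_dir_deriv[OF U f p, of h k] dir_deriv_commute[OF U f p, of h k]
    by (simp add: cscale_add algebra_simps)
  then show ?thesis using DERIV_shift[of "\<lambda>s. dir_deriv f h (p + cscale s k)" _ 0 s] by simp
qed

lemma dir_deriv2_linear:
  fixes f :: "complex \<times> (complex^'n::finite) \<Rightarrow> complex"
  assumes U: "open U" and f: "cdifferentiable U f" and p: "p \<in> U \<times> UNIV"
  shows dir_deriv2_cscale2: "dir_deriv (dir_deriv f h) (cscale c k) p = c * dir_deriv (dir_deriv f h) k p"
    and dir_deriv2_add2: "dir_deriv (dir_deriv f h) (k + l) p = dir_deriv (dir_deriv f h) k p + dir_deriv (dir_deriv f h) l p"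
    and dir_deriv2_cscale1: "dir_deriv (dir_deriv f (cscale c h)) k p = c * dir_deriv (dir_deriv f h) k p"
    and dir_deriv2_add1: "dir_deriv (dir_deriv f (h + l)) k p = dir_deriv (dir_deriv f h) k p + dir_deriv (dir_deriv f l) k p"
proof -
  have diff: "((\<lambda>s. dir_deriv f h (p + cscale s k)) has_field_derivative dir_deriv (dir_deriv f h) k p) (at 0)"
    for h k using line_derivative2[OF U f, of p 0 k h] p by simp
  have s: "dir_deriv (dir_deriv f (cscale c h)) k p = c * dir_deriv (dir_deriv f h) k p" for c h k
  proof -
    have "dir_deriv (dir_deriv f (cscale c h)) k p = dir_deriv (\<lambda>q. c * dir_deriv f h q) k p"
      by (rule dir_deriv_cong[OF U _ p]) (rule dir_deriv_cscale[OF f])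
    also have "\<dots> = c * dir_deriv (dir_deriv f h) k p"
      unfolding dir_deriv_def[of "\<lambda>q. c * dir_deriv f h q"]
      by (rule DERIV_imp_deriv) (auto intro!: derivative_eq_intros diff)
    finally show ?thesis .
  qed
  have a: "dir_deriv (dir_deriv f (h + l)) k p = dir_deriv (dir_deriv f h) k p + dir_deriv (dir_deriv f l) k p" for h k l
  proof -
    have "dir_deriv (dir_deriv f (h + l)) k p = dir_deriv (\<lambda>q. dir_deriv f h q + dir_deriv f l q) k p"
      by (rule dir_deriv_cong[OF U _ p]) (rule dir_deriv_add[OF f])
    also have "\<dots> = dir_deriv (dir_deriv f h) k p + dir_deriv (dir_deriv f l) k p"
      unfolding dir_deriv_def[of "\<lambda>q. dir_deriv f h q + dir_deriv f l q"]
      by (rule DERIV_imp_deriv) (auto intro!: derivative_eq_intros diff)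
    finally show ?thesis .
  qed
  show "dir_deriv (dir_deriv f (cscale c h)) k p = c * dir_deriv (dir_deriv f h) k p"
    and "dir_deriv (dir_deriv f (h + l)) k p = dir_deriv (dir_deriv f h) k p + dir_deriv (dir_deriv f l) k p"
    by (rule s, rule a)
  show "dir_deriv (dir_deriv f h) (cscale c k) p = c * dir_deriv (dir_deriv f h) k p"
    using s[of c k h] by (simp add: dir_deriv_commute[OF U f p, of h])
  show "dir_deriv (dir_deriv f h) (k + l) p = dir_deriv (dir_deriv f h) k p + dir_deriv (dir_deriv f h) l p"
    using a[of k l h] by (simp add: dir_deriv_commute[OF U f p, of h])
qed

section \<open>The second prolongation in terms of directional derivatives\<close>

text \<open>The total derivative is a sum over coordinates; this lemma turns such sums into directional
  derivatives.\<close>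

lemma complex_linear_expand:
  fixes \<phi> :: "complex \<times> (complex^'n::finite) \<Rightarrow> complex"
  assumes add: "\<And>h k. \<phi> (h + k) = \<phi> h + \<phi> k" and sc: "\<And>c h. \<phi> (cscale c h) = c * \<phi> h"
  shows "\<phi> (0, v) = (\<Sum>a\<in>UNIV. v $ a * \<phi> (0, axis a 1))"
    and "\<phi> (\<tau>, v) = \<tau> * \<phi> (1, 0) + \<phi> (0, v)"
proof -
  have z: "\<phi> 0 = 0" using sc[of 0 0] by simp
  have fin: "(\<Sum>a\<in>S. v $ a * \<phi> (0, axis a 1)) = \<phi> (0, \<Sum>a\<in>S. v $ a *s axis a 1)" if "finite S" for S
    using that
  proof induction
    case (insert a S)
    have "(0, v $ a *s axis a 1 + (\<Sum>a\<in>S. v $ a *s axis a 1))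
        = cscale (v $ a) (0, axis a 1) + (0 :: complex, \<Sum>a\<in>S. v $ a *s axis a 1)"
      by (simp add: cscale_def)
    with insert show ?case by (simp add: add sc)
  qed (use z in \<open>simp add: zero_prod_def\<close>)
  have "(\<Sum>a\<in>UNIV. v $ a *s axis a 1) = v"
    by (simp add: basis_expansion)
  with fin[of UNIV] show "\<phi> (0, v) = (\<Sum>a\<in>UNIV. v $ a * \<phi> (0, axis a 1))" by simp
  have "(\<tau>, v) = cscale \<tau> (1, 0) + (0, v)" by (simp add: cscale_def)
  then show "\<phi> (\<tau>, v) = \<tau> * \<phi> (1, 0) + \<phi> (0, v)" by (simp only: add sc)
qed

text \<open>The values of \<open>xi\<close> and \<open>eta\<close>, as functions of the point \<open>(t, x)\<close> to which directional
  derivatives apply.\<close>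

definition tcoeff :: "('n::finite) vfield \<Rightarrow> complex \<times> (complex^'n) \<Rightarrow> complex" where
  "tcoeff Q p = fst (Q p)"

definition xcoeff :: "('n::finite) vfield \<Rightarrow> 'n \<Rightarrow> complex \<times> (complex^'n) \<Rightarrow> complex" where
  "xcoeff Q b p = snd (Q p) $ b"

lemma cdifferentiable_coeffs:
  assumes "Q \<in> holomorphic_vfields U"
  shows "cdifferentiable U (tcoeff Q)" and "cdifferentiable U (xcoeff Q b)"
proof -
  have *: "\<exists>Q'. (Q has_derivative Q') (at p) \<and> (\<forall>c h. Q' (cscale c h) = cscale c (Q' h))"
    if "p \<in> U \<times> UNIV" for p using assms that unfolding holomorphic_vfields_def by blast
  show "cdifferentiable U (tcoeff Q)"
    unfolding cdifferentiable_def tcoeff_def [abs_def]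
  proof (intro ballI)
    fix p :: "complex \<times> (complex^'a)" assume "p \<in> U \<times> UNIV"
    from *[OF this] obtain Q' where Q': "(Q has_derivative Q') (at p)"
      "\<And>c h. Q' (cscale c h) = cscale c (Q' h)" by blast
    show "\<exists>f'. ((\<lambda>p. fst (Q p)) has_derivative f') (at p) \<and> (\<forall>c h. f' (cscale c h) = c * f' h)"
      by (rule exI[of _ "\<lambda>h. fst (Q' h)"]) (auto simp: Q' intro!: derivative_eq_intros)
  qed
  show "cdifferentiable U (xcoeff Q b)"
    unfolding cdifferentiable_def xcoeff_def [abs_def]
  proof (intro ballI)
    fix p :: "complex \<times> (complex^'a)" assume "p \<in> U \<times> UNIV"
    from *[OF this] obtain Q' where Q': "(Q has_derivative Q') (at p)"
      "\<And>c h. Q' (cscale c h) = cscale c (Q' h)" by blast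
    have "((\<lambda>p. snd (Q p) $ b) has_derivative (\<lambda>h. snd (Q' h) $ b)) (at p)"
      by (intro bounded_linear.has_derivative[OF bounded_linear_vec_nth] has_derivative_snd Q')
    then show "\<exists>f'. ((\<lambda>p. snd (Q p) $ b) has_derivative f') (at p) \<and> (\<forall>c h. f' (cscale c h) = c * f' h)"
      by (intro exI[of _ "\<lambda>h. snd (Q' h) $ b"]) (auto simp: Q')
  qed
qed

lemma partial_t:
  assumes "((\<lambda>s. f ((t, x) + cscale s (1, 0))) has_field_derivative l) (at 0)"
  shows "((\<lambda>s. f (s, x)) has_field_derivative l) (at t)"
  using assms DERIV_shift[of "\<lambda>s. f (s, x)" l 0 t]
  by (simp add: cscale_def algebra_simps)

text \<open>The formula for \<open>eta2\<close> becomes transparent in terms of derivatives along the direction \<open>(1, v)\<close> of a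
  curve with velocity \<open>v\<close>: on functions of \<open>(t, x)\<close>, the square of the total derivative is the second
  derivative in direction \<open>(1, v)\<close> plus the first derivative in direction \<open>(0, w)\<close>.\<close>

definition prolong2 :: "('n::finite) vfield \<Rightarrow> 'n \<Rightarrow> 'n jetfun" where
  "prolong2 Q b t x v w =
     dir_deriv (dir_deriv (xcoeff Q b) (1, v)) (1, v) (t, x) + dir_deriv (xcoeff Q b) (0, w) (t, x)
     - v $ b * (dir_deriv (dir_deriv (tcoeff Q) (1, v)) (1, v) (t, x) + dir_deriv (tcoeff Q) (0, w) (t, x))
     - 2 * w $ b * dir_deriv (tcoeff Q) (1, v) (t, x)"

context
  fixes U :: "complex set" and Q :: "('n::finite) vfield"
  assumes U: "open U" and Q: "Q \<in> holomorphic_vfields U"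
begin

lemma total_deriv_base:
  assumes f: "cdifferentiable U f" and t: "t \<in> U"
  shows "total_deriv (\<lambda>t x v w. f (t, x)) t x v w = dir_deriv f (1, v) (t, x)"
proof -
  have p: "(t, x) \<in> U \<times> UNIV" using t by simp
  have 1: "pd_t (\<lambda>t x v w. f (t, x)) t x v w = dir_deriv f (1, 0) (t, x)"
    unfolding pd_t_def by (rule DERIV_imp_deriv partial_t line_derivative0[OF f p])+
  have 2: "pd_x a (\<lambda>t x v w. f (t, x)) t x v w = dir_deriv f (0, axis a 1) (t, x)" for a
    unfolding pd_x_def dir_deriv_def by (simp add: cscale_def)
  have 3: "pd_v a (\<lambda>t x v w. f (t, x)) t x v w = 0" for a
    unfolding pd_v_def by simp
  show ?thesis
    unfolding total_deriv_def 1 2 3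
      complex_linear_expand(2)[of "\<lambda>h. dir_deriv f h (t, x)" 1 v, OF dir_deriv_add[OF f p] dir_deriv_cscale[OF f p]]
      complex_linear_expand(1)[of "\<lambda>h. dir_deriv f h (t, x)" v, OF dir_deriv_add[OF f p] dir_deriv_cscale[OF f p]]
    by simp
qed

lemma total_deriv_xi: "t \<in> U \<Longrightarrow> total_deriv (xi Q) t x v w = dir_deriv (tcoeff Q) (1, v) (t, x)"
  using total_deriv_base[OF cdifferentiable_coeffs(1)[OF Q]]
  by (simp add: xi_def [abs_def] tcoeff_def)

lemma eta1_eq:
  "t \<in> U \<Longrightarrow> eta1 Q b t x v w =
     dir_deriv (xcoeff Q b) (1, v) (t, x) - v $ b * dir_deriv (tcoeff Q) (1, v) (t, x)"
  using total_deriv_base[OF cdifferentiable_coeffs(2)[OF Q], of t b x v w]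
  by (simp add: eta1_def total_deriv_xi eta_def [abs_def] xcoeff_def)

text \<open>The function \<open>eta1\<close> depends on \<open>v\<close> through the factor \<open>v $ b\<close> and through the direction \<open>(1, v)\<close>, on
  which the directional derivatives depend linearly. The derivative of the factor explains the
  coefficient 2 of the last term of \<open>prolong2\<close>.\<close>

lemma eta2_eq:
  assumes t: "t \<in> U" shows "eta2 Q b t x v w = prolong2 Q b t x v w"
proof -
  let ?f = "xcoeff Q b" and ?g = "tcoeff Q"
  have p: "(t, x) \<in> U \<times> UNIV" using t by simp
  note f = cdifferentiable_coeffs(2)[OF Q, of b] and g = cdifferentiable_coeffs(1)[OF Q]
  have l2: "((\<lambda>s. dir_deriv h k ((t, x) + cscale s l)) has_field_derivative dir_deriv (dir_deriv h k) l (t, x)) (at 0)"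
    if "cdifferentiable U h" for h k l
    using line_derivative2[OF U that, of "(t, x)" 0 l k] p by simp
  have 1: "pd_t (eta1 Q b) t x v w =
      dir_deriv (dir_deriv ?f (1, v)) (1, 0) (t, x) - v $ b * dir_deriv (dir_deriv ?g (1, v)) (1, 0) (t, x)"
  proof -
    have "\<forall>\<^sub>F s in nhds t. eta1 Q b s x v w = dir_deriv ?f (1, v) (s, x) - v $ b * dir_deriv ?g (1, v) (s, x)"
      using eventually_nhds_in_open[OF U t] by eventually_elim (rule eta1_eq)
    then have "pd_t (eta1 Q b) t x v w =
        deriv (\<lambda>s. dir_deriv ?f (1, v) (s, x) - v $ b * dir_deriv ?g (1, v) (s, x)) t"
      unfolding pd_t_def by (rule deriv_cong_ev) simp
    also have "\<dots> = dir_deriv (dir_deriv ?f (1, v)) (1, 0) (t, x) - v $ b * dir_deriv (dir_deriv ?g (1, v)) (1, 0) (t, x)"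
      by (intro DERIV_imp_deriv DERIV_diff DERIV_cmult partial_t l2 f g)
    finally show ?thesis .
  qed
  have 2: "pd_x a (eta1 Q b) t x v w =
      dir_deriv (dir_deriv ?f (1, v)) (0, axis a 1) (t, x) - v $ b * dir_deriv (dir_deriv ?g (1, v)) (0, axis a 1) (t, x)" for a
  proof -
    have "((\<lambda>s. eta1 Q b t (x + s *s axis a 1) v w) has_field_derivative
      dir_deriv (dir_deriv ?f (1, v)) (0, axis a 1) (t, x) - v $ b * dir_deriv (dir_deriv ?g (1, v)) (0, axis a 1) (t, x)) (at 0)"
      using DERIV_diff[OF l2[OF f, of "(1, v)" "(0, axis a 1)"]
          DERIV_cmult[OF l2[OF g, of "(1, v)" "(0, axis a 1)"], of "v $ b"]] t
      by (simp add: eta1_eq cscale_def)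
    then show ?thesis unfolding pd_x_def by (rule DERIV_imp_deriv)
  qed
  have 3: "pd_v a (eta1 Q b) t x v w = dir_deriv ?f (0, axis a 1) (t, x)
      - axis a 1 $ b * dir_deriv ?g (1, v) (t, x) - v $ b * dir_deriv ?g (0, axis a 1) (t, x)" for a
  proof -
    have lin: "dir_deriv h (1, v + s *s axis a 1) (t, x) = dir_deriv h (1, v) (t, x) + s * dir_deriv h (0, axis a 1) (t, x)"
      if h: "cdifferentiable U h" for h s
    proof -
      have "(1, v + s *s axis a 1) = (1 :: complex, v) + cscale s (0, axis a 1)" by (simp add: cscale_def)
      then show ?thesis by (simp only: dir_deriv_add[OF h p] dir_deriv_cscale[OF h p])
    qed
    have "((\<lambda>s. dir_deriv ?f (1, v) (t, x) + s * dir_deriv ?f (0, axis a 1) (t, x) -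
        (v $ b + s * axis a 1 $ b) * (dir_deriv ?g (1, v) (t, x) + s * dir_deriv ?g (0, axis a 1) (t, x)))
        has_field_derivative dir_deriv ?f (0, axis a 1) (t, x)
      - axis a 1 $ b * dir_deriv ?g (1, v) (t, x) - v $ b * dir_deriv ?g (0, axis a 1) (t, x)) (at 0)"
      by (auto intro!: derivative_eq_intros)
    then have "((\<lambda>s. eta1 Q b t x (v + s *s axis a 1) w) has_field_derivative dir_deriv ?f (0, axis a 1) (t, x)
      - axis a 1 $ b * dir_deriv ?g (1, v) (t, x) - v $ b * dir_deriv ?g (0, axis a 1) (t, x)) (at 0)"
      using t by (simp add: eta1_eq lin f g)
    then show ?thesis unfolding pd_v_def by (rule DERIV_imp_deriv)
  qed
  have s2: "dir_deriv (dir_deriv h (1, v)) (1, v) (t, x) = dir_deriv (dir_deriv h (1, v)) (1, 0) (t, x)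
      + (\<Sum>a\<in>UNIV. v $ a * dir_deriv (dir_deriv h (1, v)) (0, axis a 1) (t, x))" if h: "cdifferentiable U h" for h
    unfolding complex_linear_expand(2)[of "\<lambda>k. dir_deriv (dir_deriv h (1, v)) k (t, x)" 1 v,
        OF dir_deriv2_add2[OF U h p] dir_deriv2_cscale2[OF U h p]]
      complex_linear_expand(1)[of "\<lambda>k. dir_deriv (dir_deriv h (1, v)) k (t, x)" v,
        OF dir_deriv2_add2[OF U h p] dir_deriv2_cscale2[OF U h p]] by simp
  have s1: "dir_deriv h (0, w) (t, x) = (\<Sum>a\<in>UNIV. w $ a * dir_deriv h (0, axis a 1) (t, x))"
    if h: "cdifferentiable U h" for h
    by (rule complex_linear_expand(1)[of "\<lambda>k. dir_deriv h k (t, x)",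
        OF dir_deriv_add[OF h p] dir_deriv_cscale[OF h p]])
  have w: "(\<Sum>a\<in>UNIV. w $ a * (axis a 1 $ b * c)) = w $ b * c" for c :: complex
  proof -
    have "(\<Sum>a\<in>UNIV. w $ a * (axis a 1 $ b * c)) = (\<Sum>a\<in>UNIV. if a = b then w $ b * c else 0)"
      by (intro sum.cong) (auto simp: axis_def)
    then show ?thesis by simp
  qed
  show ?thesis
    unfolding eta2_def prolong2_def total_deriv_def[of "eta1 Q b"] 1 2 3 s1[OF f] s1[OF g] s2[OF f] s2[OF g]
    using w[of "dir_deriv ?g (1, v) (t, x)"]
    by (simp add: total_deriv_xi t algebra_simps sum.distrib sum_subtractf sum_distrib_left)
qed

lemma lie_symmetry_linear_iff:
  fixes A B :: "complex^'n^'n" and C :: "complex \<Rightarrow> complex^'n"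
  assumes C: "\<And>b. (\<lambda>t. C t $ b) holomorphic_on U"
    and F: "F = (\<lambda>t x v. A *v v + B *v x + C t)"
  shows "lie_symmetry U F Q \<longleftrightarrow> (\<forall>b. \<forall>t\<in>U. \<forall>x v. prolong2 Q b t x v (F t x v) =
      tcoeff Q (t, x) * deriv (\<lambda>t. C t $ b) t
      + (\<Sum>a\<in>UNIV. B $ b $ a * xcoeff Q a (t, x))
      + (\<Sum>a\<in>UNIV. A $ b $ a * (dir_deriv (xcoeff Q a) (1, v) (t, x)
           - v $ a * dir_deriv (tcoeff Q) (1, v) (t, x))))"
proof -
  have mv: "(M *v (y + s *s axis a 1)) $ b = (M *v y) $ b + s * M $ b $ a"
    for M :: "complex^'n^'n" and y s a b
  proof -
    have "(\<Sum>j\<in>UNIV. M $ b $ j * (s * axis a 1 $ j)) = (\<Sum>j\<in>UNIV. if j = a then s * M $ b $ a else 0)"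
      by (intro sum.cong) (auto simp: axis_def)
    then show ?thesis
      by (simp add: matrix_vector_mult_def algebra_simps sum.distrib)
  qed
  have 1: "pd_t (rhs F b) t x v w = deriv (\<lambda>t. C t $ b) t" if "t \<in> U" for b t x v w
  proof -
    have "((\<lambda>s. (A *v v + B *v x) $ b + C s $ b) has_field_derivative 0 + deriv (\<lambda>t. C t $ b) t) (at t)"
      by (intro DERIV_add DERIV_const holomorphic_derivI[OF C U that])
    then show ?thesis
      unfolding pd_t_def rhs_def F by (simp add: DERIV_imp_deriv)
  qed
  have 2: "pd_x a (rhs F b) t x v w = B $ b $ a" for a b t x v w
    unfolding pd_x_def rhs_def F
    by (rule DERIV_imp_deriv) (auto simp: mv intro!: derivative_eq_intros)
  have 3: "pd_v a (rhs F b) t x v w = A $ b $ a" for a b t x v w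
    unfolding pd_v_def rhs_def F
    by (rule DERIV_imp_deriv) (auto simp: mv intro!: derivative_eq_intros)
  show ?thesis
    unfolding lie_symmetry_def Let_def
    by (simp add: 1 2 3 eta2_eq eta1_eq xi_def eta_def tcoeff_def xcoeff_def mult.commute)
qed

end

section \<open>Symmetries of a homogeneous system with non-scalar matrix\<close>

lemma quadratic_of_constant_second_derivative:
  fixes f f1 :: "complex \<Rightarrow> complex"
  assumes f: "\<And>s. (f has_field_derivative f1 s) (at s)"
    and f1: "\<And>s. (f1 has_field_derivative 2 * k) (at s)"
  shows "f 1 = f 0 + f1 0 + k"
proof -
  have *: "f1 s = f1 0 + 2 * k * s" for s
  proof -
    have "((\<lambda>s. f1 s - 2 * k * s) has_field_derivative 0) (at s)" for s
      by (auto intro!: derivative_eq_intros f1)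
    from constant_of_zero_derivative[OF connected_UNIV open_UNIV this, of s 0]
    show ?thesis by (simp add: algebra_simps)
  qed
  have "((\<lambda>s. f s - f1 0 * s - k * s^2) has_field_derivative 0) (at s)" for s
    by (auto intro!: derivative_eq_intros f simp: *[of s])
  from constant_of_zero_derivative[OF connected_UNIV open_UNIV this, of 1 0]
  show "f 1 = f 0 + f1 0 + k" by (simp add: algebra_simps)
qed

text \<open>Coefficient comparison by evaluation at 0, 1, -1 and 2.\<close>

lemma cubic_vanishes:
  fixes c0 c1 c2 c3 :: complex
  assumes "\<And>s. c0 + s * c1 + s^2 * c2 + s^3 * c3 = 0"
  shows "c0 = 0" "c1 = 0" "c2 = 0" "c3 = 0"
proof -
  have c0: "c0 = 0" using assms[of 0] by simp
  have e: "c1 + c2 + c3 = 0" "c2 - c1 - c3 = 0" "2 * c1 + 4 * c2 + 8 * c3 = 0"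
    using assms[of 1] assms[of "-1"] assms[of 2] c0 by (simp_all add: algebra_simps)
  have "2 * c2 = (c1 + c2 + c3) + (c2 - c1 - c3)" by simp
  then have c2: "c2 = 0" unfolding e by simp
  have "6 * c3 = (2 * c1 + 4 * c2 + 8 * c3) - 2 * (c1 + c2 + c3) - 2 * c2" by simp
  then have c3: "c3 = 0" unfolding e by (simp add: c2)
  show "c0 = 0" "c1 = 0" "c2 = 0" "c3 = 0" using e(1) c0 c2 c3 by simp_all
qed

lemma holomorphic_in_t:
  fixes f :: "complex \<times> (complex^'n::finite) \<Rightarrow> complex"
  assumes U: "open U" and f: "cdifferentiable U f"
  shows "(\<lambda>t. f (t, x)) holomorphic_on U" and "(\<lambda>t. dir_deriv f h (t, x)) holomorphic_on U"
proof -
  have "\<exists>l. ((\<lambda>s. f (s, x)) has_field_derivative l) (at t)" if "t \<in> U" for t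
    by (rule exI, rule partial_t, rule line_derivative0[OF f]) (use that in simp)
  then show "(\<lambda>t. f (t, x)) holomorphic_on U"
    by (simp add: holomorphic_on_open[OF U])
  have "\<exists>l. ((\<lambda>s. dir_deriv f h (s, x)) has_field_derivative l) (at t)" if "t \<in> U" for t
  proof (rule exI, rule partial_t)
    show "((\<lambda>s. dir_deriv f h ((t, x) + cscale s (1, 0))) has_field_derivative
        dir_deriv (dir_deriv f h) (1, 0) (t, x)) (at 0)"
      using line_derivative2[OF U f, of "(t, x)" 0 "(1, 0)" h] that by simp
  qed
  then show "(\<lambda>t. dir_deriv f h (t, x)) holomorphic_on U"
    by (simp add: holomorphic_on_open[OF U])
qed

lemma dir_deriv_t_eqI:
  assumes "((\<lambda>s. f (s, x)) has_field_derivative l) (at t)"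
  shows "dir_deriv f (1, 0) (t, x) = l"
  unfolding dir_deriv_def
  by (rule DERIV_imp_deriv) (use assms DERIV_shift[of "\<lambda>s. f (s, x)" l 0 t] in \<open>simp add: cscale_def algebra_simps\<close>)

lemma dir_deriv_x_eqI:
  assumes "((\<lambda>s. f (t, x + s *s v)) has_field_derivative l) (at 0)"
  shows "dir_deriv f (0, v) (t, x) = l"
  unfolding dir_deriv_def by (rule DERIV_imp_deriv) (use assms in \<open>simp add: cscale_def\<close>)

lemma dir_deriv_x_affine:
  fixes g :: "'n::finite \<Rightarrow> complex"
  assumes "\<And>x. f (t, x) = c + (\<Sum>a\<in>UNIV. g a * x $ a)"
  shows "dir_deriv f (0, v) (t, x) = (\<Sum>a\<in>UNIV. g a * v $ a)"
proof (rule dir_deriv_x_eqI)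
  have "f (t, x + s *s v) = (c + (\<Sum>a\<in>UNIV. g a * x $ a)) + s * (\<Sum>a\<in>UNIV. g a * v $ a)" for s
    by (simp add: assms algebra_simps sum.distrib sum_distrib_left)
  then show "((\<lambda>s. f (t, x + s *s v)) has_field_derivative (\<Sum>a\<in>UNIV. g a * v $ a)) (at 0)"
    by (auto intro!: derivative_eq_intros)
qed

text \<open>For fixed \<open>(t, x)\<close> the symmetry condition is a polynomial identity of degree 3 in the velocity.
  Replacing \<open>v\<close> by \<open>s *s v\<close> and comparing coefficients of powers of \<open>s\<close> separates it into these
  four equations, listed from degree 3 to degree 0.\<close>

lemma determining_equations:
  fixes D :: "complex^'n^'n::finite"
  assumes U: "open U" and Q: "Q \<in> holomorphic_vfields U"
    and sym: "lie_symmetry U (\<lambda>t x v. D *v x) Q" and t: "t \<in> U"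
  defines "X \<equiv> tcoeff Q" and "Y \<equiv> xcoeff Q"
  shows "v \<noteq> 0 \<Longrightarrow> dir_deriv (dir_deriv X (0, v)) (0, v) (t, x) = 0"
    and "dir_deriv (dir_deriv (Y b) (0, v)) (0, v) (t, x) =
           2 * v $ b * dir_deriv (dir_deriv X (0, v)) (1, 0) (t, x)"
    and "2 * dir_deriv (dir_deriv (Y b) (0, v)) (1, 0) (t, x) =
           v $ b * (dir_deriv (dir_deriv X (1, 0)) (1, 0) (t, x) + dir_deriv X (0, D *v x) (t, x))
           + 2 * (D *v x) $ b * dir_deriv X (0, v) (t, x)"
    and "dir_deriv (dir_deriv (Y b) (1, 0)) (1, 0) (t, x) + dir_deriv (Y b) (0, D *v x) (t, x)
           - 2 * (D *v x) $ b * dir_deriv X (1, 0) (t, x) = (\<Sum>a\<in>UNIV. D $ b $ a * Y a (t, x))"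
proof -
  have p: "(t, x) \<in> U \<times> UNIV" using t by simp
  have X: "cdifferentiable U X" and Y: "cdifferentiable U (Y b)" for b
    using cdifferentiable_coeffs[OF Q] by (simp_all add: X_def Y_def)
  have eq: "prolong2 Q b t x v (D *v x) = (\<Sum>a\<in>UNIV. D $ b $ a * Y a (t, x))" for b v
    using lie_symmetry_linear_iff[OF U Q, of "\<lambda>_. 0" _ 0 D] sym t
    by (simp add: Y_def)
  have dec: "(1 :: complex, s *s v) = (1, 0) + cscale s (0, v)" for s v by (simp add: cscale_def)
  have l1: "dir_deriv f (1, s *s v) (t, x) = dir_deriv f (1, 0) (t, x) + s * dir_deriv f (0, v) (t, x)"
    if f: "cdifferentiable U f" for f s v
    by (simp only: dec dir_deriv_add[OF f p] dir_deriv_cscale[OF f p])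
  have l2: "dir_deriv (dir_deriv f (1, s *s v)) (1, s *s v) (t, x) =
      dir_deriv (dir_deriv f (1, 0)) (1, 0) (t, x) + 2 * s * dir_deriv (dir_deriv f (0, v)) (1, 0) (t, x)
      + s^2 * dir_deriv (dir_deriv f (0, v)) (0, v) (t, x)"
    if f: "cdifferentiable U f" for f s v
    unfolding dec dir_deriv2_add1[OF U f p] dir_deriv2_add2[OF U f p]
      dir_deriv2_cscale1[OF U f p] dir_deriv2_cscale2[OF U f p] dir_deriv_commute[OF U f p, of "(1, 0)" "(0, v)"]
    by (simp add: algebra_simps power2_eq_square)
  have all: "v $ b * dir_deriv (dir_deriv X (0, v)) (0, v) (t, x) = 0 \<and>
    dir_deriv (dir_deriv (Y b) (0, v)) (0, v) (t, x) =
           2 * v $ b * dir_deriv (dir_deriv X (0, v)) (1, 0) (t, x) \<and>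
    2 * dir_deriv (dir_deriv (Y b) (0, v)) (1, 0) (t, x) =
           v $ b * (dir_deriv (dir_deriv X (1, 0)) (1, 0) (t, x) + dir_deriv X (0, D *v x) (t, x))
           + 2 * (D *v x) $ b * dir_deriv X (0, v) (t, x) \<and>
    dir_deriv (dir_deriv (Y b) (1, 0)) (1, 0) (t, x) + dir_deriv (Y b) (0, D *v x) (t, x)
           - 2 * (D *v x) $ b * dir_deriv X (1, 0) (t, x) = (\<Sum>a\<in>UNIV. D $ b $ a * Y a (t, x))" for b v
  proof -
    define c0 where "c0 = dir_deriv (dir_deriv (Y b) (1, 0)) (1, 0) (t, x) + dir_deriv (Y b) (0, D *v x) (t, x)
           - 2 * (D *v x) $ b * dir_deriv X (1, 0) (t, x) - (\<Sum>a\<in>UNIV. D $ b $ a * Y a (t, x))"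
    define c1 where "c1 = 2 * dir_deriv (dir_deriv (Y b) (0, v)) (1, 0) (t, x) -
           v $ b * (dir_deriv (dir_deriv X (1, 0)) (1, 0) (t, x) + dir_deriv X (0, D *v x) (t, x))
           - 2 * (D *v x) $ b * dir_deriv X (0, v) (t, x)"
    define c2 where "c2 = dir_deriv (dir_deriv (Y b) (0, v)) (0, v) (t, x) -
           2 * v $ b * dir_deriv (dir_deriv X (0, v)) (1, 0) (t, x)"
    define c3 where "c3 = - v $ b * dir_deriv (dir_deriv X (0, v)) (0, v) (t, x)"
    have "c0 + s * c1 + s^2 * c2 + s^3 * c3 = 0" for s
      using eq[of b "s *s v"]
      unfolding prolong2_def X_def[symmetric] Y_def[symmetric] l1[OF X] l1[OF Y] l2[OF X] l2[OF Y]
        c0_def c1_def c2_def c3_def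
      by (simp add: algebra_simps power2_eq_square power3_eq_cube)
    from cubic_vanishes[OF this] show ?thesis
      by (simp add: c0_def c1_def c2_def c3_def algebra_simps)
  qed
  show "dir_deriv (dir_deriv X (0, v)) (0, v) (t, x) = 0" if "v \<noteq> 0"
  proof -
    from that obtain b where "v $ b \<noteq> 0" by (auto simp: vec_eq_iff)
    with all[of v b] show ?thesis by simp
  qed
  show "dir_deriv (dir_deriv (Y b) (0, v)) (0, v) (t, x) =
           2 * v $ b * dir_deriv (dir_deriv X (0, v)) (1, 0) (t, x)"
    and "2 * dir_deriv (dir_deriv (Y b) (0, v)) (1, 0) (t, x) =
           v $ b * (dir_deriv (dir_deriv X (1, 0)) (1, 0) (t, x) + dir_deriv X (0, D *v x) (t, x))
           + 2 * (D *v x) $ b * dir_deriv X (0, v) (t, x)"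
    and "dir_deriv (dir_deriv (Y b) (1, 0)) (1, 0) (t, x) + dir_deriv (Y b) (0, D *v x) (t, x)
           - 2 * (D *v x) $ b * dir_deriv X (1, 0) (t, x) = (\<Sum>a\<in>UNIV. D $ b $ a * Y a (t, x))"
    using all[of v b] by blast+
qed

text \<open>The equations of degree 3 and 2 only involve second derivatives in directions of \<open>x\<close>. On each line
  through the origin of the \<open>x\<close>-space the first one makes the coefficient of $\partial_t$ affine; then the
  right-hand side of the second one is constant along the line, so the other coefficients are quadratic. What
  remains are ordinary functions of \<open>t\<close>.\<close>

lemma symmetry_polynomial_in_x:
  fixes D :: "complex^'n^'n::finite"
  assumes U: "open U" and Q: "Q \<in> holomorphic_vfields U"
    and sym: "lie_symmetry U (\<lambda>t x v. D *v x) Q"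
  shows "\<exists>\<alpha> \<beta> G h. \<alpha> holomorphic_on U \<and> (\<forall>a. \<beta> a holomorphic_on U) \<and> (\<forall>b a. G b a holomorphic_on U) \<and>
     (\<forall>b. h b holomorphic_on U) \<and>
     (\<forall>t\<in>U. \<forall>x. tcoeff Q (t, x) = \<alpha> t + (\<Sum>a\<in>UNIV. \<beta> a t * x $ a)) \<and>
     (\<forall>t\<in>U. \<forall>x b. xcoeff Q b (t, x) = h b t + (\<Sum>a\<in>UNIV. G b a t * x $ a)
        + x $ b * (\<Sum>a\<in>UNIV. deriv (\<beta> a) t * x $ a))"
proof -
  define X where "X = tcoeff Q"
  define Y where "Y = xcoeff Q"
  have X: "cdifferentiable U X" and Y: "cdifferentiable U (Y b)" for b
    using cdifferentiable_coeffs[OF Q] by (simp_all add: X_def Y_def)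
  note det = determining_equations[OF U Q sym, folded X_def Y_def]
  define \<alpha> where "\<alpha> t = X (t, 0)" for t
  define \<beta> where "\<beta> a t = dir_deriv X (0, axis a 1) (t, 0)" for a t
  define h where "h b t = Y b (t, 0)" for b t
  define G where "G b a t = dir_deriv (Y b) (0, axis a 1) (t, 0)" for a b t
  have hol: "\<alpha> holomorphic_on U" "\<beta> a holomorphic_on U" "h b holomorphic_on U" "G b a holomorphic_on U" for a b
    unfolding \<alpha>_def \<beta>_def h_def G_def
    by (auto intro!: holomorphic_in_t U X Y)
  have seg: "(t, s *s x) = (t, 0) + cscale s (0, x)" for t :: complex and s and x :: "complex^'n"
    by (simp add: cscale_def)
  have lin: "dir_deriv f (0, x) (t, 0) = (\<Sum>a\<in>UNIV. dir_deriv f (0, axis a 1) (t, 0) * x $ a)"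
    if "cdifferentiable U f" "t \<in> U" for f :: "complex \<times> (complex^'n) \<Rightarrow> complex" and t x
    using complex_linear_expand(1)[of "\<lambda>k. dir_deriv f k (t, 0)" x] dir_deriv_add[OF that(1), of "(t, 0)"]
      dir_deriv_cscale[OF that(1), of "(t, 0)"] that(2) by (simp add: mult.commute)
  have quad: "f (t, x) = f (t, 0) + (\<Sum>a\<in>UNIV. dir_deriv f (0, axis a 1) (t, 0) * x $ a) + k"
    if f: "cdifferentiable U f" and t: "t \<in> U"
      and k: "\<And>s. dir_deriv (dir_deriv f (0, x)) (0, x) (t, s *s x) = 2 * k" for f :: "complex \<times> (complex^'n) \<Rightarrow> complex" and t x k
  proof -
    have f1: "((\<lambda>s. f (t, s *s x)) has_field_derivative dir_deriv f (0, x) (t, s *s x)) (at s)" for s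
      unfolding seg by (rule line_derivative[OF f]) (use t in \<open>simp add: cscale_def\<close>)
    have f2: "((\<lambda>s. dir_deriv f (0, x) (t, s *s x)) has_field_derivative 2 * k) (at s)" for s
      unfolding k[of s, symmetric] unfolding seg by (rule line_derivative2[OF U f]) (use t in \<open>simp add: cscale_def\<close>)
    have "f (t, 1 *s x) = f (t, 0 *s x) + dir_deriv f (0, x) (t, 0 *s x) + k"
      by (rule quadratic_of_constant_second_derivative[OF f1 f2])
    then show ?thesis by (simp add: lin[OF f t, of x])
  qed
  have Xeq: "X (t, x) = \<alpha> t + (\<Sum>a\<in>UNIV. \<beta> a t * x $ a)" if t: "t \<in> U" for t x
  proof (cases "x = 0")
    case False
    then show ?thesis
      using quad[OF X t, of x 0] det(1)[OF t False] by (simp add: \<alpha>_def \<beta>_def)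
  qed (simp add: \<alpha>_def)
  have DX: "dir_deriv X (0, v) (t, x) = (\<Sum>a\<in>UNIV. \<beta> a t * v $ a)" if t: "t \<in> U" for t x v
    by (rule dir_deriv_x_affine[of X t "\<alpha> t"]) (rule Xeq[OF t])
  have DDX: "dir_deriv (dir_deriv X (0, v)) (1, 0) (t, x) = (\<Sum>a\<in>UNIV. deriv (\<beta> a) t * v $ a)"
    if t: "t \<in> U" for t x v
  proof -
    have "dir_deriv (dir_deriv X (0, v)) (1, 0) (t, x) = dir_deriv (\<lambda>p. \<Sum>a\<in>UNIV. \<beta> a (fst p) * v $ a) (1, 0) (t, x)"
      by (rule dir_deriv_cong[OF U]) (use t DX in auto)
    also have "\<dots> = (\<Sum>a\<in>UNIV. deriv (\<beta> a) t * v $ a)"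
      by (rule dir_deriv_t_eqI)
        (auto intro!: derivative_eq_intros holomorphic_derivI[OF hol(2) U t] sum.cong)
    finally show ?thesis .
  qed
  have Yeq: "Y b (t, x) = h b t + (\<Sum>a\<in>UNIV. G b a t * x $ a) + x $ b * (\<Sum>a\<in>UNIV. deriv (\<beta> a) t * x $ a)"
    if t: "t \<in> U" for t x b
    unfolding h_def G_def
    by (rule quad[OF Y t]) (simp add: det(2)[OF t] DDX t)
  show ?thesis
    unfolding X_def[symmetric] Y_def[symmetric]
    by (rule exI[of _ \<alpha>], rule exI[of _ \<beta>], rule exI[of _ G], rule exI[of _ h])
      (intro conjI allI ballI hol Xeq Yeq)
qed

text \<open>Scalar matrices have to be excluded because $\ddot x = cx$ has symmetries with a coefficient of
  $\partial_t$ that depends on \<open>x\<close>: it is equivalent to the free particle equation.\<close>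

definition scalar_matrix :: "complex^'n^'n::finite \<Rightarrow> bool" where
  "scalar_matrix D \<longleftrightarrow> (\<exists>c. \<forall>i j. D $ i $ j = (if i = j then c else 0))"

text \<open>Write \<open>\<alpha> + \<beta> x\<close> for the coefficient of $\partial_t$. The equation of degree 1 is a bilinear identity
  in \<open>x\<close> and \<open>v\<close>. Its trace in \<open>v\<close> gives $(n + 2)(\beta'' - \beta D) = 0$, and then the identity says that
  \<open>D\<close> times any component of \<open>\<beta>\<close> is a scalar matrix. So \<open>\<beta> = 0\<close>. The matrix \<open>G\<close> of the linear part
  of the other coefficients then satisfies $2G' = \alpha''$ and, by the equation of degree 0,
  $G'' + GD - 2\alpha' D = DG$. Differentiating this once eliminates \<open>G\<close> and makes $\alpha'' D$ scalar.
  Hence $\alpha'' = 0$, and \<open>G\<close> is constant.\<close>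

theorem nonscalar_symmetries:
  fixes D :: "complex^'n^'n::finite"
  assumes U: "open U" "connected U" and nonscalar: "\<not> scalar_matrix D"
    and Qhol: "Q \<in> holomorphic_vfields U" and sym: "lie_symmetry U (\<lambda>t x v. D *v x) Q"
  shows "\<exists>c d \<Gamma> h. (\<forall>b. (\<lambda>t. h t $ b) holomorphic_on U) \<and>
     (\<forall>t\<in>U. \<forall>b. deriv (deriv (\<lambda>t. h t $ b)) t = (D *v h t) $ b) \<and>
     (\<forall>i j. (\<Gamma> ** D) $ i $ j - (D ** \<Gamma>) $ i $ j = 2 * d * D $ i $ j) \<and>
     (\<forall>t\<in>U. \<forall>x. Q (t, x) = (c + d * t, \<Gamma> *v x + h t))"
proof (cases "U = {}")
  case True
  then show ?thesis
    by (intro exI[of _ 0] exI[of _ "0::complex^'n^'n"] exI[of _ "\<lambda>_. 0"])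
      (auto simp: matrix_matrix_mult_def)
next
  case False
  then obtain t0 where t0: "t0 \<in> U" by blast
  define X where "X = tcoeff Q"
  define Y where "Y = xcoeff Q"
  note det = determining_equations[OF U(1) Qhol sym, folded X_def Y_def]
  from symmetry_polynomial_in_x[OF U(1) Qhol sym, folded X_def Y_def]
  obtain \<alpha> \<beta> G h where hol: "\<alpha> holomorphic_on U" "\<And>a. \<beta> a holomorphic_on U"
      "\<And>b a. G b a holomorphic_on U" "\<And>b. h b holomorphic_on U"
    and Xeq: "\<And>t x. t \<in> U \<Longrightarrow> X (t, x) = \<alpha> t + (\<Sum>a\<in>UNIV. \<beta> a t * x $ a)"
    and Yeq: "\<And>t x b. t \<in> U \<Longrightarrow> Y b (t, x) = h b t + (\<Sum>a\<in>UNIV. G b a t * x $ a)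
        + x $ b * (\<Sum>a\<in>UNIV. deriv (\<beta> a) t * x $ a)" by blast
  have d1: "(f has_field_derivative deriv f t) (at t)" if "f holomorphic_on U" "t \<in> U" for f t
    using holomorphic_derivI[OF that(1) U(1) that(2)] .
  have d2: "deriv f holomorphic_on U" if "f holomorphic_on U" for f
    using holomorphic_deriv[OF that U(1)] .
  note ders = d1[OF hol(1)] d1[OF hol(2)] d1[OF hol(3)] d1[OF hol(4)]
    d1[OF d2[OF hol(1)]] d1[OF d2[OF hol(2)]] d1[OF d2[OF hol(3)]] d1[OF d2[OF hol(4)]]

  have DXx: "dir_deriv X (0, v) (t, x) = (\<Sum>a\<in>UNIV. \<beta> a t * v $ a)" if t: "t \<in> U" for t x v
    by (rule dir_deriv_x_affine[of X t "\<alpha> t"]) (rule Xeq[OF t])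
  have tder: "dir_deriv f (1, 0) (t, x) = l"
    if t: "t \<in> U" and f: "\<And>t. t \<in> U \<Longrightarrow> f (t, x) = g t" and g: "(g has_field_derivative l) (at t)" for f g t x l
    by (rule dir_deriv_t_eqI, rule has_field_derivative_transform_within_open[OF g U(1) t]) (simp add: f)
  have DXt: "dir_deriv X (1, 0) (t, x) = deriv \<alpha> t + (\<Sum>a\<in>UNIV. deriv (\<beta> a) t * x $ a)" if t: "t \<in> U" for t x
    by (rule tder[OF t], erule Xeq, auto intro!: derivative_eq_intros ders t sum.cong)
  have DXtt: "dir_deriv (dir_deriv X (1, 0)) (1, 0) (t, x)
      = deriv (deriv \<alpha>) t + (\<Sum>a\<in>UNIV. deriv (deriv (\<beta> a)) t * x $ a)" if t: "t \<in> U" for t x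
    by (rule tder[OF t], erule DXt, auto intro!: derivative_eq_intros ders t sum.cong)
  have DYx: "dir_deriv (Y b) (0, v) (t, x) = (\<Sum>a\<in>UNIV. G b a t * v $ a)
      + v $ b * (\<Sum>a\<in>UNIV. deriv (\<beta> a) t * x $ a) + x $ b * (\<Sum>a\<in>UNIV. deriv (\<beta> a) t * v $ a)"
    if t: "t \<in> U" for t x v b
  proof (rule dir_deriv_x_eqI)
    have "Y b (t, x + s *s v) = h b t + (\<Sum>a\<in>UNIV. G b a t * x $ a) + s * (\<Sum>a\<in>UNIV. G b a t * v $ a)
        + (x $ b + s * v $ b) * ((\<Sum>a\<in>UNIV. deriv (\<beta> a) t * x $ a) + s * (\<Sum>a\<in>UNIV. deriv (\<beta> a) t * v $ a))" for s
      by (simp add: Yeq t algebra_simps sum.distrib sum_distrib_left)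
    then show "((\<lambda>s. Y b (t, x + s *s v)) has_field_derivative (\<Sum>a\<in>UNIV. G b a t * v $ a)
      + v $ b * (\<Sum>a\<in>UNIV. deriv (\<beta> a) t * x $ a) + x $ b * (\<Sum>a\<in>UNIV. deriv (\<beta> a) t * v $ a)) (at 0)"
      by (auto intro!: derivative_eq_intros)
  qed
  have DYxt: "dir_deriv (dir_deriv (Y b) (0, v)) (1, 0) (t, x) = (\<Sum>a\<in>UNIV. deriv (G b a) t * v $ a)
      + v $ b * (\<Sum>a\<in>UNIV. deriv (deriv (\<beta> a)) t * x $ a) + x $ b * (\<Sum>a\<in>UNIV. deriv (deriv (\<beta> a)) t * v $ a)"
    if t: "t \<in> U" for t x v b
    by (rule tder[OF t], erule DYx, auto intro!: derivative_eq_intros ders t sum.cong)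

  \<comment> \<open>The linear form \<open>\<beta>'' - \<beta> D\<close>; taking the trace in the equation of degree 1 shows that it vanishes.\<close>
  define r where "r t x = (\<Sum>a\<in>UNIV. deriv (deriv (\<beta> a)) t * x $ a) - (\<Sum>a\<in>UNIV. \<beta> a t * (D *v x) $ a)" for t x
  have e1: "2 * (\<Sum>a\<in>UNIV. deriv (G b a) t * v $ a) = v $ b * deriv (deriv \<alpha>) t"
    if t: "t \<in> U" for t v b
    using det(3)[OF t, where b = b and v = v and x = 0] by (simp add: DYxt DXtt DXx t)
  have e1': "v $ b * r t x + 2 * (x $ b * (\<Sum>a\<in>UNIV. deriv (deriv (\<beta> a)) t * v $ a)
       - (D *v x) $ b * (\<Sum>a\<in>UNIV. \<beta> a t * v $ a)) = 0" if t: "t \<in> U" for t x v b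
    using det(3)[OF t, where b = b and v = v and x = x] e1[OF t, of b v] by (simp add: DYxt DXtt DXx t r_def algebra_simps)
  have r0: "r t x = 0" if t: "t \<in> U" for t x
  proof -
    have "r t x + 2 * (x $ b * deriv (deriv (\<beta> b)) t - (D *v x) $ b * \<beta> b t) = 0" for b
      using e1'[OF t, of "axis b 1" b x] by (simp add: sum_axis)
    then have "(\<Sum>b\<in>UNIV. r t x + 2 * (x $ b * deriv (deriv (\<beta> b)) t - (D *v x) $ b * \<beta> b t)) = 0"
      by simp
    then have "of_nat CARD('n) * r t x + 2 * r t x = 0"
      by (simp add: sum.distrib sum_subtractf sum_distrib_left[symmetric] r_def mult.commute)
    then have "of_nat (CARD('n) + 2) * r t x = 0" by (simp add: algebra_simps)
    then show ?thesis by (metis mult_eq_0_iff of_nat_eq_0_iff add_is_0 zero_neq_numeral)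
  qed
  have \<beta>0: "\<beta> a t = 0" if t: "t \<in> U" for a t
  proof (rule ccontr)
    assume nz: "\<beta> a t \<noteq> 0"
    define \<mu> where "\<mu> = deriv (deriv (\<beta> a)) t / \<beta> a t"
    have "(D *v x) $ b = \<mu> * x $ b" for x b
      using e1'[OF t, of "axis a 1" b x] r0[OF t] nz by (simp add: sum_axis \<mu>_def field_simps)
    from this[of "axis _ 1"] have "D $ b $ j = (if b = j then \<mu> else 0)" for b j
      by (simp add: matrix_vector_mult_def sum_axis) (simp add: axis_def)
    with nonscalar show False unfolding scalar_matrix_def by blast
  qed
  have d\<beta>0: "deriv (\<beta> a) t = 0" if t: "t \<in> U" for a t
    by (rule DERIV_imp_deriv, rule has_field_derivative_transform_within_open[OF DERIV_const U(1) t, of 0])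
      (simp add: \<beta>0)
  have X: "X (t, x) = \<alpha> t" if "t \<in> U" for t x using Xeq[OF that] \<beta>0[OF that] by simp
  have Y: "Y b (t, x) = h b t + (\<Sum>a\<in>UNIV. G b a t * x $ a)" if "t \<in> U" for b t x
    using Yeq[OF that] d\<beta>0[OF that] by simp
  have G1: "deriv (G b a) t = (if a = b then deriv (deriv \<alpha>) t / 2 else 0)" if t: "t \<in> U" for a b t
    using e1[OF t, of b "axis a 1"] unfolding sum_axis by (auto simp: axis_def field_simps)
  have G2: "deriv (deriv (G b a)) t = (if a = b then deriv (deriv (deriv \<alpha>)) t / 2 else 0)" if t: "t \<in> U" for a b t
    by (rule DERIV_imp_deriv, rule has_field_derivative_transform_within_open[OF _ U(1) t])
      (auto simp: G1 intro!: derivative_eq_intros d1 d2 hol t)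
  have DYt: "dir_deriv (Y b) (1, 0) (t, x) = deriv (h b) t + (\<Sum>a\<in>UNIV. deriv (G b a) t * x $ a)" if t: "t \<in> U" for t x b
    by (rule tder[OF t], erule Y, auto intro!: derivative_eq_intros ders t sum.cong)
  have DYtt: "dir_deriv (dir_deriv (Y b) (1, 0)) (1, 0) (t, x)
      = deriv (deriv (h b)) t + (\<Sum>a\<in>UNIV. deriv (deriv (G b a)) t * x $ a)" if t: "t \<in> U" for t x b
    by (rule tder[OF t], erule DYt, auto intro!: derivative_eq_intros ders t sum.cong)
  have e0: "deriv (deriv (h b)) t + (\<Sum>a\<in>UNIV. deriv (deriv (G b a)) t * x $ a)
      + (\<Sum>a\<in>UNIV. G b a t * (D *v x) $ a) - 2 * (D *v x) $ b * deriv \<alpha> t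
      = (\<Sum>c\<in>UNIV. D $ b $ c * (h c t + (\<Sum>a\<in>UNIV. G c a t * x $ a)))" if t: "t \<in> U" for t x b
    using det(4)[OF t, where b = b and x = x] by (simp add: DYtt DYx DXt Y d\<beta>0 t)
  have h2: "deriv (deriv (h b)) t = (\<Sum>c\<in>UNIV. D $ b $ c * h c t)" if t: "t \<in> U" for t b
    using e0[OF t, of b 0] by simp
  have Dax: "(D *v axis j 1) $ a = D $ a $ j" for a j
    by (simp add: matrix_vector_mult_def sum_axis)
  \<comment> \<open>The entry \<open>(b, j)\<close> of $\frac12\alpha^{(3)} + GD - 2\alpha' D = DG$.\<close>
  have comm: "(if j = b then deriv (deriv (deriv \<alpha>)) t / 2 else 0) + (\<Sum>a\<in>UNIV. G b a t * D $ a $ j)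
      - 2 * D $ b $ j * deriv \<alpha> t = (\<Sum>c\<in>UNIV. D $ b $ c * G c j t)" if t: "t \<in> U" for t b j
    using e0[OF t, of b "axis j 1"] unfolding sum_axis Dax h2[OF t]
    by (simp add: G2 t algebra_simps sum.distrib)
  have \<alpha>2: "deriv (deriv \<alpha>) t = 0" if t: "t \<in> U" for t
  proof (rule ccontr)
    assume nz: "deriv (deriv \<alpha>) t \<noteq> 0"
    define \<mu> where "\<mu> = deriv (deriv (deriv (deriv \<alpha>))) t / (4 * deriv (deriv \<alpha>) t)"
    have "D $ b $ j = (if b = j then \<mu> else 0)" for b j
    proof -
      \<comment> \<open>The difference of the two sides of this identity vanishes on \<open>U\<close>, and so does its derivative.\<close>
      define f where "f t = (if j = b then deriv (deriv (deriv \<alpha>)) t / 2 else 0) + (\<Sum>a\<in>UNIV. G b a t * D $ a $ j)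
        - 2 * D $ b $ j * deriv \<alpha> t - (\<Sum>c\<in>UNIV. D $ b $ c * G c j t)" for t
      have "(f has_field_derivative (if j = b then deriv (deriv (deriv (deriv \<alpha>))) t / 2 else 0)
         + (\<Sum>a\<in>UNIV. deriv (G b a) t * D $ a $ j)
        - 2 * D $ b $ j * deriv (deriv \<alpha>) t - (\<Sum>c\<in>UNIV. D $ b $ c * deriv (G c j) t)) (at t)"
        unfolding f_def [abs_def]
        by (auto intro!: derivative_eq_intros d1 d2 hol t sum.cong)
      moreover have "(f has_field_derivative 0) (at t)"
        by (rule has_field_derivative_transform_within_open[OF DERIV_const U(1) t, of 0])
          (use comm in \<open>simp add: f_def\<close>)
      ultimately have "(if j = b then deriv (deriv (deriv (deriv \<alpha>))) t / 2 else 0)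
         + (\<Sum>a\<in>UNIV. deriv (G b a) t * D $ a $ j)
        - 2 * D $ b $ j * deriv (deriv \<alpha>) t - (\<Sum>c\<in>UNIV. D $ b $ c * deriv (G c j) t) = 0"
        by (rule DERIV_unique)
      then have *: "(if j = b then deriv (deriv (deriv (deriv \<alpha>))) t / 2 else 0) = 2 * D $ b $ j * deriv (deriv \<alpha>) t"
        by (cases "j = b") (auto simp: G1 t if_distrib if_distribR cong: if_cong)
      show ?thesis
      proof (cases "j = b")
        case True
        with * nz show ?thesis by (simp add: \<mu>_def field_simps)
      next
        case False
        with * nz show ?thesis by auto
      qed
    qed
    with nonscalar show False unfolding scalar_matrix_def by blast
  qed
  define d where "d = deriv \<alpha> t0"
  have \<alpha>1: "deriv \<alpha> t = d" if "t \<in> U" for t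
    unfolding d_def
    by (rule constant_of_zero_derivative[OF U(2,1) _ that t0]) (use d1[OF d2[OF hol(1)]] \<alpha>2 in force)
  have \<alpha>: "\<alpha> t = (\<alpha> t0 - d * t0) + d * t" if "t \<in> U" for t
  proof -
    have "((\<lambda>t. \<alpha> t - d * t) has_field_derivative 0) (at s)" if "s \<in> U" for s
      using that by (auto intro!: derivative_eq_intros ders simp: \<alpha>1)
    from constant_of_zero_derivative[OF U(2,1) this that t0]
    show ?thesis by (simp add: algebra_simps)
  qed
  have Gc: "G b a t = G b a t0" if "t \<in> U" for a b t
  proof (rule constant_of_zero_derivative[OF U(2,1) _ that t0])
    fix s assume s: "s \<in> U"
    have "deriv (G b a) s = 0" by (simp add: G1 \<alpha>2 s)
    then show "(G b a has_field_derivative 0) (at s)" using d1[OF hol(3)[of b a] s] by simp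
  qed
  have \<alpha>3: "deriv (deriv (deriv \<alpha>)) t0 = 0"
    by (rule DERIV_imp_deriv, rule has_field_derivative_transform_within_open[OF DERIV_const U(1) t0, of 0])
      (simp add: \<alpha>2)
  show ?thesis
  proof (intro exI conjI allI ballI)
    let ?h = "\<lambda>t. (\<chi> b. h b t) :: complex^'n" and ?\<Gamma> = "(\<chi> b a. G b a t0) :: complex^'n^'n"
    show "(\<lambda>t. ?h t $ b) holomorphic_on U" for b using hol(4) by simp
    show "deriv (deriv (\<lambda>t. ?h t $ b)) t = (D *v ?h t) $ b" if "t \<in> U" for t b
      using h2[OF that] by (simp add: matrix_vector_mult_def)
    show "(?\<Gamma> ** D) $ i $ j - (D ** ?\<Gamma>) $ i $ j = 2 * d * D $ i $ j" for i j
      using comm[OF t0, of j i] by (simp add: matrix_matrix_mult_def \<alpha>3 d_def algebra_simps split: if_splits)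
    show "Q (t, x) = (\<alpha> t0 - d * t0 + d * t, ?\<Gamma> *v x + ?h t)" if t: "t \<in> U" for t x
      using X[OF t, of x] Y[OF t, of _ x] \<alpha>[OF t] Gc[OF t]
      by (simp add: X_def Y_def tcoeff_def xcoeff_def prod_eq_iff vec_eq_iff matrix_vector_mult_def algebra_simps)
  qed
qed

section \<open>Linear systems with constant coefficients\<close>

text \<open>Entrywise, because the multiplication by complex scalars is not part of the normed space structure of
  the types of vectors and matrices.\<close>

definition has_mderiv :: "(complex \<Rightarrow> complex^'m^'n) \<Rightarrow> complex^'m^'n \<Rightarrow> complex \<Rightarrow> bool" where
  "has_mderiv G G' t \<longleftrightarrow> (\<forall>i j. ((\<lambda>s. G s $ i $ j) has_field_derivative G' $ i $ j) (at t))"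

definition has_vderiv :: "(complex \<Rightarrow> complex^'n) \<Rightarrow> complex^'n \<Rightarrow> complex \<Rightarrow> bool" where
  "has_vderiv h h' t \<longleftrightarrow> (\<forall>i. ((\<lambda>s. h s $ i) has_field_derivative h' $ i) (at t))"

lemma has_mderiv_const: "has_mderiv (\<lambda>s. M) 0 t"
  by (simp add: has_mderiv_def)

lemma has_mderiv_add:
  "has_mderiv G G' t \<Longrightarrow> has_mderiv H H' t \<Longrightarrow> has_mderiv (\<lambda>s. G s + H s) (G' + H') t"
  by (auto simp: has_mderiv_def intro!: derivative_eq_intros)

lemma has_mderiv_diff:
  "has_mderiv G G' t \<Longrightarrow> has_mderiv H H' t \<Longrightarrow> has_mderiv (\<lambda>s. G s - H s) (G' - H') t"
  by (auto simp: has_mderiv_def intro!: derivative_eq_intros)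

lemma has_mderiv_msmult:
  "(f has_field_derivative f') (at t) \<Longrightarrow> has_mderiv G G' t \<Longrightarrow>
   has_mderiv (\<lambda>s. msmult (f s) (G s)) (msmult f' (G t) + msmult (f t) G') t"
  by (auto simp: has_mderiv_def intro!: derivative_eq_intros)

lemma has_mderiv_mult:
  fixes G :: "complex \<Rightarrow> complex^'m::finite^'n"
  assumes "has_mderiv G G' t" "has_mderiv H H' t"
  shows "has_mderiv (\<lambda>s. G s ** H s) (G' ** H t + G t ** H') t"
  unfolding has_mderiv_def
proof (intro allI)
  fix i j
  have "((\<lambda>s. \<Sum>k\<in>UNIV. G s $ i $ k * H s $ k $ j) has_field_derivative
     (\<Sum>k\<in>UNIV. G' $ i $ k * H t $ k $ j + G t $ i $ k * H' $ k $ j)) (at t)"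
  proof (rule DERIV_sum)
    fix k
    have "((\<lambda>s. G s $ i $ k) has_field_derivative G' $ i $ k) (at t)"
      and "((\<lambda>s. H s $ k $ j) has_field_derivative H' $ k $ j) (at t)"
      using assms by (simp_all add: has_mderiv_def)
    from DERIV_mult[OF this]
    show "((\<lambda>s. G s $ i $ k * H s $ k $ j) has_field_derivative
        G' $ i $ k * H t $ k $ j + G t $ i $ k * H' $ k $ j) (at t)"
      by (simp add: mult.commute)
  qed
  then show "((\<lambda>s. (G s ** H s) $ i $ j) has_field_derivative (G' ** H t + G t ** H') $ i $ j) (at t)"
    by (simp add: matrix_matrix_mult_def sum.distrib)
qed

lemma has_vderiv_const: "has_vderiv (\<lambda>s. c) 0 t"
  by (simp add: has_vderiv_def)

lemma has_vderiv_add: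
  "has_vderiv g g' t \<Longrightarrow> has_vderiv h h' t \<Longrightarrow> has_vderiv (\<lambda>s. g s + h s) (g' + h') t"
  by (auto simp: has_vderiv_def intro!: derivative_eq_intros)

lemma has_vderiv_diff:
  "has_vderiv g g' t \<Longrightarrow> has_vderiv h h' t \<Longrightarrow> has_vderiv (\<lambda>s. g s - h s) (g' - h') t"
  by (auto simp: has_vderiv_def intro!: derivative_eq_intros)

lemma has_vderiv_smult:
  "(f has_field_derivative f') (at t) \<Longrightarrow> has_vderiv h h' t \<Longrightarrow>
   has_vderiv (\<lambda>s. f s *s h s) (f' *s h t + f t *s h') t"
  by (auto simp: has_vderiv_def intro!: derivative_eq_intros)

lemma has_vderiv_mult:
  fixes G :: "complex \<Rightarrow> complex^'m::finite^'n"
  assumes "has_mderiv G G' t" "has_vderiv h h' t"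
  shows "has_vderiv (\<lambda>s. G s *v h s) (G' *v h t + G t *v h') t"
  unfolding has_vderiv_def
proof (intro allI)
  fix i
  have "((\<lambda>s. \<Sum>k\<in>UNIV. G s $ i $ k * h s $ k) has_field_derivative
     (\<Sum>k\<in>UNIV. G' $ i $ k * h t $ k + G t $ i $ k * h' $ k)) (at t)"
  proof (rule DERIV_sum)
    fix k
    have "((\<lambda>s. G s $ i $ k) has_field_derivative G' $ i $ k) (at t)"
      and "((\<lambda>s. h s $ k) has_field_derivative h' $ k) (at t)"
      using assms by (simp_all add: has_mderiv_def has_vderiv_def)
    from DERIV_mult[OF this]
    show "((\<lambda>s. G s $ i $ k * h s $ k) has_field_derivative
        G' $ i $ k * h t $ k + G t $ i $ k * h' $ k) (at t)"
      by (simp add: mult.commute)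
  qed
  then show "((\<lambda>s. (G s *v h s) $ i) has_field_derivative (G' *v h t + G t *v h') $ i) (at t)"
    by (simp add: matrix_vector_mult_def sum.distrib)
qed

definition mpow :: "complex^'n^'n::finite \<Rightarrow> nat \<Rightarrow> complex^'n^'n" where
  "mpow M k = ((**) M ^^ k) (mat 1)"

lemma mpow_0 [simp]: "mpow M 0 = mat 1" and mpow_Suc: "mpow M (Suc k) = M ** mpow M k"
  by (simp_all add: mpow_def)

lemma mpow_commute: "X ** M = M ** X \<Longrightarrow> X ** mpow M k = mpow M k ** X"
  by (induction k) (simp_all add: mpow_Suc, metis matrix_mul_assoc)

text \<open>This bound lets the exponential series below converge everywhere.\<close>

lemma mpow_bound: "cmod (mpow M k $ i $ j) \<le> (\<Sum>i\<in>UNIV. \<Sum>j\<in>UNIV. cmod (M $ i $ j)) ^ k"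
proof (induction k arbitrary: i)
  case (Suc k)
  let ?K = "\<Sum>i\<in>UNIV. \<Sum>j\<in>UNIV. cmod (M $ i $ j)"
  have "cmod (mpow M (Suc k) $ i $ j) \<le> (\<Sum>l\<in>UNIV. cmod (M $ i $ l) * cmod (mpow M k $ l $ j))"
    by (simp add: mpow_Suc matrix_matrix_mult_def norm_mult[symmetric] norm_sum)
  also have "\<dots> \<le> (\<Sum>l\<in>UNIV. cmod (M $ i $ l) * ?K ^ k)"
    by (intro sum_mono mult_left_mono Suc) auto
  also have "\<dots> = (\<Sum>l\<in>UNIV. cmod (M $ i $ l)) * ?K ^ k" by (simp add: sum_distrib_right)
  also have "\<dots> \<le> ?K * ?K ^ k"
    by (intro mult_right_mono member_le_sum zero_le_power sum_nonneg) auto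
  finally show ?case by simp
qed (simp add: Finite_Cartesian_Product.mat_def)

definition mexp :: "complex^'n^'n::finite \<Rightarrow> complex \<Rightarrow> complex^'n^'n" where
  "mexp M t = (\<chi> i j. \<Sum>k. mpow M k $ i $ j / fact k * t ^ k)"

lemma mexp_summable: "summable (\<lambda>k. mpow M k $ i $ j / fact k * (t :: complex) ^ k)"
proof (rule summable_comparison_test')
  let ?K = "\<Sum>i\<in>UNIV. \<Sum>j\<in>UNIV. cmod (M $ i $ j)"
  show "summable (\<lambda>k. inverse (fact k) * (?K * cmod t) ^ k)" by (rule summable_exp)
  show "norm (mpow M k $ i $ j / fact k * t ^ k) \<le> inverse (fact k) * (?K * cmod t) ^ k" for k
    using mult_right_mono[OF mpow_bound[of M k i j], of "cmod t ^ k / fact k"]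
    by (simp add: norm_mult norm_divide norm_power power_mult_distrib field_simps)
qed

text \<open>For \<open>X = M\<close> this shows that both $ME$ and $EM$ are derivatives of $E(t) = e^{tM}$. The case
  of other \<open>X\<close> is used where $e^{tA/2}$ has to commute with $B + \frac14A^2$.\<close>

lemma mexp_commute:
  assumes "X ** M = M ** X" shows "X ** mexp M t = mexp M t ** X"
proof -
  have "(X ** mexp M t) $ i $ j = (mexp M t ** X) $ i $ j" for i j
  proof -
    have "(X ** mexp M t) $ i $ j = (\<Sum>l\<in>UNIV. \<Sum>k. X $ i $ l * (mpow M k $ l $ j / fact k * t ^ k))"
      unfolding matrix_matrix_mult_def mexp_def by (simp only: vec_lambda_beta suminf_mult[OF mexp_summable])
    also have "\<dots> = (\<Sum>k. \<Sum>l\<in>UNIV. X $ i $ l * (mpow M k $ l $ j / fact k * t ^ k))"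
      by (rule suminf_sum[symmetric]) (intro summable_mult mexp_summable)
    also have "\<dots> = (\<Sum>k. (X ** mpow M k) $ i $ j / fact k * t ^ k)"
      by (simp add: matrix_matrix_mult_def sum_distrib_left sum_distrib_right sum_divide_distrib mult_ac)
    also have "\<dots> = (\<Sum>k. (mpow M k ** X) $ i $ j / fact k * t ^ k)"
      by (simp add: mpow_commute[OF assms])
    also have "\<dots> = (\<Sum>k. \<Sum>l\<in>UNIV. (mpow M k $ i $ l / fact k * t ^ k) * X $ l $ j)"
      by (simp add: matrix_matrix_mult_def sum_distrib_left sum_distrib_right sum_divide_distrib mult_ac)
    also have "\<dots> = (\<Sum>l\<in>UNIV. \<Sum>k. (mpow M k $ i $ l / fact k * t ^ k) * X $ l $ j)"
      by (rule suminf_sum) (intro summable_mult2 mexp_summable)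
    also have "\<dots> = (mexp M t ** X) $ i $ j"
      unfolding matrix_matrix_mult_def mexp_def by (simp only: vec_lambda_beta suminf_mult2[OF mexp_summable])
    finally show ?thesis .
  qed
  then show ?thesis by (simp add: vec_eq_iff)
qed

lemma mexp_0 [simp]: "mexp M 0 = mat 1"
  using powser_zero[of "\<lambda>k. mpow M k $ _ $ _ / fact k"] by (simp add: vec_eq_iff mexp_def del: powser_zero)

lemma has_mderiv_mexp: "has_mderiv (mexp M) (M ** mexp M t) t"
  unfolding has_mderiv_def
proof (intro allI)
  fix i j
  let ?c = "\<lambda>k. mpow M k $ i $ j / fact k :: complex"
  have "((\<lambda>s. \<Sum>k. ?c k * s ^ k) has_field_derivative (\<Sum>k. diffs ?c k * t ^ k)) (at t)"
    by (rule termdiffs_strong_converges_everywhere) (rule mexp_summable)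
  moreover have "(\<Sum>k. diffs ?c k * t ^ k) = (M ** mexp M t) $ i $ j"
  proof -
    have "diffs ?c k = mpow M (Suc k) $ i $ j / fact k" for k
      by (simp add: diffs_def field_simps del: of_nat_Suc)
    then have "diffs ?c k * t ^ k = (\<Sum>l\<in>UNIV. M $ i $ l * (mpow M k $ l $ j / fact k * t ^ k))" for k
      by (simp add: mpow_Suc matrix_matrix_mult_def sum_distrib_left sum_distrib_right sum_divide_distrib mult_ac)
    then have "(\<Sum>k. diffs ?c k * t ^ k) = (\<Sum>k. \<Sum>l\<in>UNIV. M $ i $ l * (mpow M k $ l $ j / fact k * t ^ k))"
      by simp
    also have "\<dots> = (\<Sum>l\<in>UNIV. \<Sum>k. M $ i $ l * (mpow M k $ l $ j / fact k * t ^ k))"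
      by (rule suminf_sum) (intro summable_mult mexp_summable)
    finally show ?thesis
      unfolding matrix_matrix_mult_def mexp_def by (simp only: vec_lambda_beta suminf_mult[OF mexp_summable])
  qed
  ultimately show "((\<lambda>s. mexp M s $ i $ j) has_field_derivative (M ** mexp M t) $ i $ j) (at t)"
    by (simp add: mexp_def)
qed

lemma has_mderiv_compose:
  assumes "has_mderiv G G' (f t)" "(f has_field_derivative f') (at t)"
  shows "has_mderiv (\<lambda>s. G (f s)) (msmult f' G') t"
  unfolding has_mderiv_def
proof (intro allI)
  fix i j
  have "((\<lambda>s. G s $ i $ j) has_field_derivative G' $ i $ j) (at (f t))"
    using assms(1) by (simp add: has_mderiv_def)
  from DERIV_chain2[OF this assms(2)]
  show "((\<lambda>s. G (f s) $ i $ j) has_field_derivative msmult f' G' $ i $ j) (at t)"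
    by (simp add: mult.commute)
qed

lemma has_mderiv_mexp_minus: "has_mderiv (\<lambda>s. mexp M (- s)) (msmult (- 1) (M ** mexp M (- t))) t"
  by (rule has_mderiv_compose[OF has_mderiv_mexp]) (auto intro!: derivative_eq_intros)

text \<open>The product has derivative zero and equals the identity at \<open>t = 0\<close>.\<close>

lemma mexp_minus: "mexp M (- t) ** mexp M t = mat 1" "mexp M t ** mexp M (- t) = mat 1"
proof -
  have *: "mexp M (- t) ** mexp M t = mat 1" for t
  proof -
    have "has_mderiv (\<lambda>s. mexp M (- s) ** mexp M s) 0 s" for s
    proof -
      have "(M ** mexp M (- s)) ** mexp M s = mexp M (- s) ** (M ** mexp M s)"
        by (simp only: mexp_commute[where X = M and M = M and t = "- s", OF refl] matrix_mul_assoc)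
      then show ?thesis
        using has_mderiv_mult[OF has_mderiv_mexp_minus[of M s] has_mderiv_mexp[of M s]]
        by (simp add: matrix_distribs vec_eq_iff has_mderiv_def)
    qed
    then have "(mexp M (- t) ** mexp M t) $ i $ j = (mexp M (- 0) ** mexp M 0) $ i $ j" for i j
      by (intro constant_of_zero_derivative[OF connected_UNIV open_UNIV]) (auto simp: has_mderiv_def)
    then show ?thesis by (simp add: vec_eq_iff)
  qed
  show "mexp M (- t) ** mexp M t = mat 1" "mexp M t ** mexp M (- t) = mat 1"
    using *[of t] *[of "- t"] by simp_all
qed

lemma mexp_zero_matrix: "mexp (0 :: complex^'n^'n::finite) t = mat 1"
proof -
  have "mexp (0 :: complex^'n^'n) t $ i $ j = mexp 0 0 $ i $ j" for i j
    by (rule constant_of_zero_derivative[OF connected_UNIV open_UNIV])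
      (use has_mderiv_mexp[of "0 :: complex^'n^'n"] in \<open>auto simp: has_mderiv_def matrix_distribs\<close>)
  then show ?thesis by (simp add: vec_eq_iff)
qed

text \<open>The function $e^{-(t - t_0)M} y(t)$ has derivative zero.\<close>

lemma linear_system_unique:
  fixes y :: "complex \<Rightarrow> complex^'n::finite"
  assumes U: "open U" "connected U" and y: "\<And>t. t \<in> U \<Longrightarrow> has_vderiv y (M *v y t) t"
    and t: "t0 \<in> U" "t \<in> U"
  shows "y t = mexp M (t - t0) *v y t0"
proof -
  have d: "has_vderiv (\<lambda>s. mexp M (- (s - t0)) *v y s) 0 s" if s: "s \<in> U" for s
  proof -
    have "has_mderiv (\<lambda>s. mexp M (- (s - t0))) (msmult (- 1) (M ** mexp M (- (s - t0)))) s"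
      by (rule has_mderiv_compose[OF has_mderiv_mexp]) (auto intro!: derivative_eq_intros)
    from has_vderiv_mult[OF this y[OF s]]
    show ?thesis
      unfolding mexp_commute[where X = M and M = M, OF refl]
      by (simp add: matrix_vector_distribs matrix_vector_mul_assoc has_vderiv_def)
  qed
  have "(mexp M (- (t - t0)) *v y t) $ i = (mexp M (- (t0 - t0)) *v y t0) $ i" for i
    by (rule constant_of_zero_derivative[OF U(2,1) _ t(2,1)]) (use d in \<open>auto simp: has_vderiv_def\<close>)
  then have "mexp M (- (t - t0)) *v y t = y t0" by (simp add: vec_eq_iff)
  then have "mexp M (t - t0) *v y t0 = mexp M (t - t0) *v (mexp M (- (t - t0)) *v y t)"
    by simp
  then show ?thesis unfolding matrix_vector_mul_assoc mexp_minus by simp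
qed

text \<open>Variation of constants. On a simply connected domain every entry of $e^{-tM}c(t)$ has a primitive.\<close>

lemma linear_system_exists:
  fixes c :: "complex \<Rightarrow> complex^'n::finite"
  assumes U: "open U" "simply_connected U" and c: "\<And>i. (\<lambda>t. c t $ i) holomorphic_on U"
  shows "\<exists>y. \<forall>t\<in>U. has_vderiv y (M *v y t + c t) t"
proof -
  have "\<exists>u. \<forall>t\<in>U. (u has_field_derivative (mexp M (- t) *v c t) $ i) (at t)" for i
  proof -
    have "(\<lambda>t. mexp M (- t) $ i $ k) holomorphic_on U" for k
      using has_mderiv_mexp_minus[of M] U(1)
      by (auto simp: holomorphic_on_open has_mderiv_def)
    then have "(\<lambda>t. (mexp M (- t) *v c t) $ i) holomorphic_on U"
      unfolding matrix_vector_mult_def by (auto intro!: holomorphic_intros c)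
    then show ?thesis using U simply_connected_eq_global_primitive[OF U(1)] by blast
  qed
  then obtain u where u: "\<And>i t. t \<in> U \<Longrightarrow> (u i has_field_derivative (mexp M (- t) *v c t) $ i) (at t)"
    by metis
  define w where "w t = (\<chi> i. u i t)" for t
  have w: "has_vderiv w (mexp M (- t) *v c t) t" if "t \<in> U" for t
    using u[OF that] by (simp add: has_vderiv_def w_def)
  have "has_vderiv (\<lambda>t. mexp M t *v w t) (M *v (mexp M t *v w t) + c t) t" if "t \<in> U" for t
    using has_vderiv_mult[OF has_mderiv_mexp w[OF that], of M]
    by (simp add: matrix_vector_mul_assoc mexp_minus)
  then show ?thesis by blast
qed

text \<open>The block matrix with rows \<open>0 1\<close> and \<open>B A\<close>, which turns $\ddot x = A\dot x + Bx$ into a first order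
  system for the pair of \<open>x\<close> and its derivative.\<close>

definition companion :: "complex^'n^'n \<Rightarrow> complex^'n^'n \<Rightarrow> complex^('n + 'n)^('n + 'n)" where
  "companion A B = (\<chi> i j. case i of
      Inl i \<Rightarrow> (case j of Inl j \<Rightarrow> 0 | Inr j \<Rightarrow> if i = j then 1 else 0)
    | Inr i \<Rightarrow> (case j of Inl j \<Rightarrow> B $ i $ j | Inr j \<Rightarrow> A $ i $ j))"

definition upper :: "complex^('n + 'n) \<Rightarrow> complex^'n" where "upper z = (\<chi> i. z $ Inl i)"
definition lower :: "complex^('n + 'n) \<Rightarrow> complex^'n" where "lower z = (\<chi> i. z $ Inr i)"
definition stack :: "complex^'n \<Rightarrow> complex^'n \<Rightarrow> complex^('n + 'n)" where
  "stack x y = (\<chi> i. case i of Inl i \<Rightarrow> x $ i | Inr i \<Rightarrow> y $ i)"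

lemma upper_stack [simp]: "upper (stack x y) = x" and lower_stack [simp]: "lower (stack x y) = y"
  by (simp_all add: upper_def lower_def stack_def vec_eq_iff)

lemma vec_sum_eqI: "upper y = upper z \<Longrightarrow> lower y = lower z \<Longrightarrow> y = z"
  unfolding upper_def lower_def vec_eq_iff by (auto split: sum.split) (metis sum.exhaust)

lemma upper_linear: "upper (y + z) = upper y + upper z" "upper (c *s z) = c *s upper z" "upper 0 = 0"
  and lower_linear: "lower (y + z) = lower y + lower z" "lower (c *s z) = c *s lower z" "lower 0 = 0"
  by (simp_all add: upper_def lower_def vec_eq_iff)

lemma sum_UNIV_Plus: "(\<Sum>i\<in>UNIV. f i) = (\<Sum>i\<in>UNIV. f (Inl i)) + (\<Sum>i\<in>UNIV. f (Inr i))"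
  for f :: "'n::finite + 'm::finite \<Rightarrow> complex"
  by (subst UNIV_Plus_UNIV[symmetric], subst sum.Plus) (simp_all add: o_def)

lemma companion_upper: "upper (companion A B *v z) = lower z" for z :: "complex^('n::finite + 'n)"
  by (simp add: vec_eq_iff upper_def lower_def companion_def matrix_vector_mult_def
      sum_UNIV_Plus if_distrib if_distribR cong: if_cong)

lemma companion_lower: "lower (companion A B *v z) = B *v upper z + A *v lower z" for z :: "complex^('n::finite + 'n)"
  by (simp add: vec_eq_iff upper_def lower_def companion_def matrix_vector_mult_def
      sum_UNIV_Plus)

lemma has_vderiv_upper_lower:
  assumes "has_vderiv y y' t"
  shows "has_vderiv (\<lambda>s. upper (y s)) (upper y') t" "has_vderiv (\<lambda>s. lower (y s)) (lower y') t"
  using assms by (auto simp: has_vderiv_def upper_def lower_def)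

lemma second_order_exists:
  fixes C :: "complex \<Rightarrow> complex^'n::finite"
  assumes U: "open U" "simply_connected U" and C: "\<And>i. (\<lambda>t. C t $ i) holomorphic_on U"
  shows "\<exists>p p1. \<forall>t\<in>U. has_vderiv p (p1 t) t \<and> has_vderiv p1 (A *v p1 t + B *v p t + C t) t"
proof -
  have "(\<lambda>t. stack 0 (C t) $ i) holomorphic_on U" for i
    using C by (cases i) (simp_all add: stack_def)
  from linear_system_exists[OF U this, of "companion A B"]
  obtain y where y: "\<forall>t\<in>U. has_vderiv y (companion A B *v y t + stack 0 (C t)) t" by blast
  show ?thesis
  proof (intro exI ballI)
    fix t assume "t \<in> U"
    with y have y: "has_vderiv y (companion A B *v y t + stack 0 (C t)) t" by blast
    from has_vderiv_upper_lower[OF y]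
    show "has_vderiv (\<lambda>t. upper (y t)) (lower (y t)) t \<and>
        has_vderiv (\<lambda>t. lower (y t)) (A *v lower (y t) + B *v upper (y t) + C t) t"
      by (simp add: upper_linear lower_linear companion_upper companion_lower add_ac)
  qed
qed

text \<open>These are the \<open>2n\<close> solutions that occur in the symmetry fields; \<open>z\<close> consists of the initial values
  at \<open>t0\<close>.\<close>

lemma second_order_homogeneous:
  fixes A B :: "complex^'n^'n::finite" and t0 :: complex
  defines "y \<equiv> \<lambda>z t. mexp (companion A B) (t - t0) *v z"
  shows "has_vderiv (\<lambda>t. upper (y z t)) (lower (y z t)) t"
    and "has_vderiv (\<lambda>t. lower (y z t)) (A *v lower (y z t) + B *v upper (y z t)) t"
    and "y z t0 = z"
proof -
  have "has_mderiv (\<lambda>t. mexp (companion A B) (t - t0)) (msmult 1 (companion A B ** mexp (companion A B) (t - t0))) t"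
    by (rule has_mderiv_compose[OF has_mderiv_mexp]) (auto intro!: derivative_eq_intros)
  from has_vderiv_mult[OF this has_vderiv_const]
  have "has_vderiv (y z) (companion A B *v y z t) t"
    by (simp add: y_def msmult_distribs matrix_vector_mul_assoc)
  from has_vderiv_upper_lower[OF this]
  show "has_vderiv (\<lambda>t. upper (y z t)) (lower (y z t)) t"
    and "has_vderiv (\<lambda>t. lower (y z t)) (A *v lower (y z t) + B *v upper (y z t)) t"
    by (simp_all add: companion_upper companion_lower add.commute)
  show "y z t0 = z" by (simp add: y_def)
qed

lemma second_order_unique:
  fixes A B :: "complex^'n^'n::finite"
  assumes U: "open U" "connected U" and t: "t0 \<in> U" "t \<in> U"
    and h: "\<And>t. t \<in> U \<Longrightarrow> has_vderiv h (h1 t) t"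
    and h1: "\<And>t. t \<in> U \<Longrightarrow> has_vderiv h1 (A *v h1 t + B *v h t) t"
  shows "h t = upper (mexp (companion A B) (t - t0) *v stack (h t0) (h1 t0))"
proof -
  define y where "y t = stack (h t) (h1 t)" for t
  have "has_vderiv y (companion A B *v y t) t" if t: "t \<in> U" for t
  proof -
    have eq: "companion A B *v y t = stack (h1 t) (A *v h1 t + B *v h t)"
      by (rule vec_sum_eqI) (simp_all add: companion_upper companion_lower y_def)
    show ?thesis
      unfolding eq has_vderiv_def
    proof
      fix i show "((\<lambda>s. y s $ i) has_field_derivative stack (h1 t) (A *v h1 t + B *v h t) $ i) (at t)"
        using h[OF t] h1[OF t] by (cases i) (simp_all add: y_def stack_def has_vderiv_def)
    qed
  qed
  from linear_system_unique[OF U this t]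
  have "upper (y t) = upper (mexp (companion A B) (t - t0) *v y t0)" by simp
  then show ?thesis by (simp add: y_def)
qed

section \<open>Jordan form, centralizers and weight vectors\<close>

text \<open>Stated for the diagonal \<open>lam\<close> and the set \<open>u\<close> of those places at which the superdiagonal of a Jordan
  matrix is 1: the last place of a block does not share its eigenvalue with any later place, which means that
  different blocks have different eigenvalues. In this form the condition is easy to follow through the
  recursion on the list of blocks.\<close>

definition separated :: "nat \<Rightarrow> (nat \<Rightarrow> complex) \<Rightarrow> (nat \<Rightarrow> bool) \<Rightarrow> bool" where
  "separated n lam u \<longleftrightarrow> (\<forall>a b. a < b \<and> b < n \<and> lam a = lam b \<longrightarrow> u a)"

text \<open>From here on a Jordan matrix is a bidiagonal matrix with diagonal \<open>lam\<close> and superdiagonal \<open>u\<close>, and the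
  division into blocks is only visible through \<open>u\<close>.\<close>

lemma jordan_matrix_entries:
  assumes "0 \<notin> fst ` set bs"
  shows "\<exists>lam u. (\<forall>i < sum_list (map fst bs). \<forall>j < sum_list (map fst bs). jordan_matrix bs $$ (i, j) =
          (if i = j then lam i else if j = Suc i \<and> u i then 1 else (0::complex))) \<and>
     (\<forall>i. u i \<longrightarrow> Suc i < sum_list (map fst bs) \<and> lam (Suc i) = lam i) \<and>
     lam ` {..<sum_list (map fst bs)} = snd ` set bs \<and>
     (distinct (map snd bs) \<longleftrightarrow> separated (sum_list (map fst bs)) lam u)"
  using assms
proof (induction bs)
  case Nil
  show ?case
    by (rule exI[of _ "\<lambda>_. 0"], rule exI[of _ "\<lambda>_. False"]) (simp add: separated_def)
next
  case (Cons kl bs)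
  obtain k l where kl: "kl = (k, l)" by force
  define m where "m = sum_list (map fst bs)"
  have k: "k > 0" using Cons.prems kl by force
  have "0 \<notin> fst ` set bs" using Cons.prems by simp
  from Cons.IH[OF this, folded m_def] obtain lam u where
    ent: "\<And>i j. i < m \<Longrightarrow> j < m \<Longrightarrow> jordan_matrix bs $$ (i, j) =
          (if i = j then lam i else if j = Suc i \<and> u i then 1 else (0::complex))"
    and u: "\<And>i. u i \<Longrightarrow> Suc i < m \<and> lam (Suc i) = lam i"
    and im: "lam ` {..<m} = snd ` set bs"
    and dist: "distinct (map snd bs) \<longleftrightarrow> separated m lam u"
    by (elim exE conjE) simp
  define lam' where "lam' i = (if i < k then l else lam (i - k))" for i
  define u' where "u' i = (if i < k then Suc i < k else u (i - k))" for i
  have sum: "sum_list (map fst (kl # bs)) = k + m" by (simp add: kl m_def)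
  have dims: "dim_row (jordan_matrix bs) = m" "dim_col (jordan_matrix bs) = m" by (simp_all add: m_def)
  have 1: "jordan_matrix (kl # bs) $$ (i, j) =
      (if i = j then lam' i else if j = Suc i \<and> u' i then 1 else 0)" if "i < k + m" "j < k + m" for i j
  proof -
    have "jordan_matrix (kl # bs) $$ (i, j) =
        (if i < k then if j < k then jordan_block k l $$ (i, j) else 0
         else if j < k then 0 else jordan_matrix bs $$ (i - k, j - k))"
      unfolding kl jordan_matrix_Cons m_def[symmetric] using that dims by simp
    moreover have "jordan_matrix bs $$ (i - k, j - k) = (if i - k = j - k then lam (i - k)
        else if j - k = Suc (i - k) \<and> u (i - k) then 1 else 0)" if "\<not> i < k" "\<not> j < k"
      using that \<open>i < k + m\<close> \<open>j < k + m\<close> by (intro ent) auto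
    moreover have "j - k = Suc (i - k) \<longleftrightarrow> j = Suc i" "i - k = j - k \<longleftrightarrow> i = j" if "\<not> i < k" "\<not> j < k"
      using that by auto
    ultimately show ?thesis by (simp add: lam'_def u'_def) auto
  qed
  have 2: "Suc i < k + m \<and> lam' (Suc i) = lam' i" if "u' i" for i
    using that u[of "i - k"] k by (auto simp: u'_def lam'_def Suc_diff_le split: if_splits)
  have 3: "lam' ` {..<k + m} = snd ` set (kl # bs)"
  proof -
    have "{..<k + m} = {..<k} \<union> (\<lambda>i. k + i) ` {..<m}"
    proof (intro Set.set_eqI iffI)
      fix x assume x: "x \<in> {..<k + m}"
      show "x \<in> {..<k} \<union> (\<lambda>i. k + i) ` {..<m}"
      proof (cases "x < k")
        case False
        with x have "x = k + (x - k)" "x - k \<in> {..<m}" by auto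
        then show ?thesis by blast
      qed simp
    qed auto
    moreover have "lam' ` {..<k} = {l}" using k by (auto simp: lam'_def)
    moreover have "lam' ` (\<lambda>i. k + i) ` {..<m} = lam ` {..<m}"
      unfolding image_image by (rule image_cong) (simp_all add: lam'_def)
    ultimately show ?thesis using im by (simp add: image_Un kl)
  qed
  have 4: "distinct (map snd (kl # bs)) \<longleftrightarrow> separated (k + m) lam' u'"
  proof
    assume "distinct (map snd (kl # bs))"
    then have l: "l \<notin> lam ` {..<m}" and sep: "separated m lam u"
      using im dist by (auto simp: kl image_iff)
    show "separated (k + m) lam' u'"
      unfolding separated_def
    proof (intro allI impI)
      fix a b assume ab: "a < b \<and> b < k + m \<and> lam' a = lam' b"
      show "u' a"
      proof (cases "b < k")
        case True then show ?thesis using ab by (simp add: u'_def)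
      next
        case b: False
        then have bm: "b - k < m" using ab by linarith
        show ?thesis
        proof (cases "a < k")
          case True
          then have "lam (b - k) = l" using ab b by (simp add: lam'_def)
          with l bm show ?thesis by blast
        next
          case False
          then have "a - k < b - k" "lam (a - k) = lam (b - k)" using ab b by (auto simp: lam'_def)
          with sep bm have "u (a - k)" unfolding separated_def by blast
          with False show ?thesis by (simp add: u'_def)
        qed
      qed
    qed
  next
    assume sep: "separated (k + m) lam' u'"
    have "separated m lam u"
      unfolding separated_def
    proof (intro allI impI)
      fix a b assume "a < b \<and> b < m \<and> lam a = lam b"
      then have "u' (k + a)"
        using sep[unfolded separated_def, rule_format, of "k + a" "k + b"] by (simp add: lam'_def)
      then show "u a" by (simp add: u'_def)
    qed
    moreover have "l \<notin> lam ` {..<m}"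
    proof
      assume "l \<in> lam ` {..<m}"
      then obtain b where "b < m" "lam b = l" by auto
      then have "u' (k - 1)"
        using sep[unfolded separated_def, rule_format, of "k - 1" "k + b"] k by (simp add: lam'_def)
      then show False using k by (simp add: u'_def)
    qed
    ultimately show "distinct (map snd (kl # bs))" using dist im by (auto simp: kl image_iff)
  qed
  show ?case
    unfolding sum
    by (rule exI[of _ lam'], rule exI[of _ u']) (use 1 2 3 4 in blast)
qed

text \<open>The functions \<open>pos\<close> and \<open>e\<close> translate between the unordered index type and the places
  \<open>0, ..., n - 1\<close>.\<close>

locale jordan_shape =
  fixes pos :: "'n::finite \<Rightarrow> nat" and e :: "nat \<Rightarrow> 'n" and lam :: "nat \<Rightarrow> complex" and u :: "nat \<Rightarrow> bool"
  assumes pos_less [simp]: "pos i < CARD('n)" and e_pos [simp]: "e (pos i) = i"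
    and pos_e [simp]: "a < CARD('n) \<Longrightarrow> pos (e a) = a"
    and u_less: "u a \<Longrightarrow> Suc a < CARD('n)" and u_lam: "u a \<Longrightarrow> lam (Suc a) = lam a"
begin

definition J :: "complex^'n^'n" where
  "J = (\<chi> i j. if i = j then lam (pos i) else if pos j = Suc (pos i) \<and> u (pos i) then 1 else 0)"

lemma J_mult: "(J ** X) $ i $ j = lam (pos i) * X $ i $ j + (if u (pos i) then X $ e (Suc (pos i)) $ j else 0)"
proof -
  have "(J ** X) $ i $ j = (\<Sum>k\<in>UNIV. (if k = i then lam (pos i) * X $ i $ j else 0) +
      (if k = e (Suc (pos i)) then if u (pos i) then X $ e (Suc (pos i)) $ j else 0 else 0))"
    unfolding matrix_matrix_mult_def vec_lambda_beta
  proof (rule sum.cong)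
    fix k
    have "pos k = Suc (pos i) \<and> u (pos i) \<longleftrightarrow> k = e (Suc (pos i)) \<and> u (pos i)"
      using u_less pos_e e_pos by metis
    moreover have "i \<noteq> e (Suc (pos i))" if "u (pos i)"
      using u_less[OF that] pos_e n_not_Suc_n by metis
    ultimately show "J $ i $ k * X $ k $ j = (if k = i then lam (pos i) * X $ i $ j else 0) +
      (if k = e (Suc (pos i)) then if u (pos i) then X $ e (Suc (pos i)) $ j else 0 else 0)"
      by (auto simp: J_def)
  qed simp
  then show ?thesis by (simp add: sum.distrib)
qed

lemma mult_J: "(X ** J) $ i $ j = X $ i $ j * lam (pos j) + (if 0 < pos j \<and> u (pos j - 1) then X $ i $ e (pos j - 1) else 0)"
proof -
  have "(X ** J) $ i $ j = (\<Sum>k\<in>UNIV. (if k = j then X $ i $ j * lam (pos j) else 0) +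
      (if k = e (pos j - 1) then if 0 < pos j \<and> u (pos j - 1) then X $ i $ e (pos j - 1) else 0 else 0))"
    unfolding matrix_matrix_mult_def vec_lambda_beta
  proof (rule sum.cong)
    fix k
    have "pos j - 1 < CARD('n)" using pos_less[of j] by linarith
    then have pe: "pos (e (pos j - 1)) = pos j - 1" by simp
    then have "pos j = Suc (pos k) \<and> u (pos k) \<longleftrightarrow> k = e (pos j - 1) \<and> 0 < pos j \<and> u (pos j - 1)"
      by (metis Suc_diff_1 diff_Suc_1 e_pos zero_less_Suc)
    moreover have "j \<noteq> e (pos j - 1)" if "0 < pos j"
    proof
      assume "j = e (pos j - 1)"
      then have "pos j = pos j - 1" using pe by metis
      with that show False by simp
    qed
    ultimately show "X $ i $ k * J $ k $ j = (if k = j then X $ i $ j * lam (pos j) else 0) +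
      (if k = e (pos j - 1) then if 0 < pos j \<and> u (pos j - 1) then X $ i $ e (pos j - 1) else 0 else 0)"
      by (auto simp: J_def)
  qed simp
  then show ?thesis by (simp add: sum.distrib)
qed

text \<open>Along the diagonals inside a block this says that entries of \<open>X\<close> are passed on from \<open>(a, b - 1)\<close> to
  \<open>(a + 1, b)\<close>. For entries with different eigenvalues it expresses an entry by its left and lower neighbours.\<close>

lemma commutes_iff:
  "X ** J = J ** X \<longleftrightarrow> (\<forall>a < CARD('n). \<forall>b < CARD('n).
     lam a * X $ e a $ e b + (if u a then X $ e (Suc a) $ e b else 0)
     = X $ e a $ e b * lam b + (if 0 < b \<and> u (b - 1) then X $ e a $ e (b - 1) else 0))"
proof -
  have "X ** J = J ** X \<longleftrightarrow> (\<forall>i j. (J ** X) $ i $ j = (X ** J) $ i $ j)"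
    by (auto simp: vec_eq_iff)
  also have "\<dots> \<longleftrightarrow> (\<forall>a < CARD('n). \<forall>b < CARD('n). (J ** X) $ e a $ e b = (X ** J) $ e a $ e b)"
    by (metis pos_less e_pos)
  finally show ?thesis by (simp add: J_mult mult_J)
qed

primrec block_start :: "nat \<Rightarrow> nat" where
  "block_start 0 = 0"
| "block_start (Suc a) = (if u a then block_start a else Suc a)"

lemma block_start_le: "block_start a \<le> a" by (induction a) auto

lemma block_start_eq: "block_start b \<le> a \<Longrightarrow> a \<le> b \<Longrightarrow> block_start a = block_start b"
  by (induction b) (auto simp: le_Suc_eq)

lemma u_of_block_start: "block_start b \<le> a \<Longrightarrow> a < b \<Longrightarrow> u a"
  by (induction b) (auto simp: less_Suc_eq split: if_splits)

lemma lam_block_start: "lam (block_start a) = lam a"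
  by (induction a) (auto simp: u_lam)

lemma lam_block: "block_start b \<le> a \<Longrightarrow> a \<le> b \<Longrightarrow> lam a = lam b"
  using lam_block_start block_start_eq by metis

text \<open>The block diagonal matrices with upper triangular Toeplitz blocks. The parameter \<open>\<gamma>\<close> consists of the first
  rows of the blocks, so there are \<open>n\<close> parameters.\<close>

definition toeplitz :: "complex^'n \<Rightarrow> complex^'n^'n" where
  "toeplitz \<gamma> = (\<chi> i j. if block_start (pos j) \<le> pos i \<and> pos i \<le> pos j
       then \<gamma> $ e (block_start (pos j) + (pos j - pos i)) else 0)"

lemma toeplitz_linear: "toeplitz (\<gamma> + \<delta>) = toeplitz \<gamma> + toeplitz \<delta>" "toeplitz (c *s \<gamma>) = msmult c (toeplitz \<gamma>)"
  by (auto simp: toeplitz_def vec_eq_iff)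

lemma toeplitz_first_row: "toeplitz \<gamma> $ e (block_start (pos j)) $ j = \<gamma> $ j"
proof -
  have "block_start (pos j) < CARD('n)" using block_start_le[of "pos j"] pos_less[of j] by linarith
  then show ?thesis using block_start_le[of "pos j"] by (simp add: toeplitz_def)
qed

lemma toeplitz_lower_zero: "pos j < pos i \<Longrightarrow> toeplitz \<gamma> $ i $ j = 0" by (simp add: toeplitz_def)

lemma toeplitz_inj: assumes "toeplitz \<gamma> = 0" shows "\<gamma> = 0"
  using toeplitz_first_row[of \<gamma>] assms by (simp add: vec_eq_iff)

lemma toeplitz_commutes: "toeplitz \<gamma> ** J = J ** toeplitz \<gamma>"
  unfolding commutes_iff
proof (intro allI impI)
  fix a b assume ab: "a < CARD('n)" "b < CARD('n)"
  have 1: "lam a * toeplitz \<gamma> $ e a $ e b = toeplitz \<gamma> $ e a $ e b * lam b"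
    using lam_block[of b a] ab by (auto simp: toeplitz_def)
  have 2: "(if u a then toeplitz \<gamma> $ e (Suc a) $ e b else 0) = (if 0 < b \<and> u (b - 1) then toeplitz \<gamma> $ e a $ e (b - 1) else 0)"
  proof (cases b)
    case 0
    then show ?thesis using ab u_less[of a] by (simp add: toeplitz_def)
  next
    case (Suc c)
    have c: "c < CARD('n)" using Suc ab by simp
    have "(u a \<and> block_start b \<le> Suc a \<and> Suc a \<le> b) \<longleftrightarrow> (u c \<and> block_start c \<le> a \<and> a \<le> c)"
    proof
      assume h: "u a \<and> block_start b \<le> Suc a \<and> Suc a \<le> b"
      have "block_start (Suc a) = block_start b" using h block_start_eq by blast
      then have "block_start b \<le> a" using h block_start_le[of a] by simp
      then have uc: "u c" using h Suc u_of_block_start[of b c] by (metis Suc_le_mono le_less_trans less_Suc_eq_le order_refl le_trans)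
      then show "u c \<and> block_start c \<le> a \<and> a \<le> c" using h Suc \<open>block_start b \<le> a\<close> by simp
    next
      assume h: "u c \<and> block_start c \<le> a \<and> a \<le> c"
      then have "block_start b \<le> a" "a < b" using Suc by simp_all
      then show "u a \<and> block_start b \<le> Suc a \<and> Suc a \<le> b" using u_of_block_start[of b a] by simp
    qed
    moreover have "block_start b = block_start c" if "u c" using that Suc by simp
    ultimately show ?thesis using u_less[of a] ab c Suc
      by (auto simp: toeplitz_def)
  qed
  show "lam a * toeplitz \<gamma> $ e a $ e b + (if u a then toeplitz \<gamma> $ e (Suc a) $ e b else 0)
     = toeplitz \<gamma> $ e a $ e b * lam b + (if 0 < b \<and> u (b - 1) then toeplitz \<gamma> $ e a $ e (b - 1) else 0)"
    using 1 2 by simp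
qed

text \<open>Outside the diagonal blocks \<open>lam a\<close> and \<open>lam b\<close> differ, and an induction from the lower left corner
  shows that the entries vanish. Inside a block, entries are passed on along diagonals, starting either in the
  first row of the block or at its left edge, where the neighbour lies outside of the block.\<close>

lemma commuting_zero_first_rows:
  assumes sep: "separated CARD('n) lam u" and Z: "Z ** J = J ** Z"
    and first: "\<And>b. b < CARD('n) \<Longrightarrow> Z $ e (block_start b) $ e b = 0"
  shows "Z = 0"
proof -
  define z where "z a b = Z $ e a $ e b" for a b
  have eq: "lam a * z a b + (if u a then z (Suc a) b else 0)
     = z a b * lam b + (if 0 < b \<and> u (b - 1) then z a (b - 1) else 0)"
    if "a < CARD('n)" "b < CARD('n)" for a b
    using Z that unfolding commutes_iff z_def by blast
  have ne: "z a b = 0" if "a < CARD('n)" "b < CARD('n)" "lam a \<noteq> lam b" for a b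
    using that
  proof (induction "b + (CARD('n) - a)" arbitrary: a b rule: less_induct)
    case less
    have "z (Suc a) b = 0" if "u a"
      using less.prems u_less[OF that] u_lam[OF that] by (intro less.hyps) auto
    moreover have "z a (b - 1) = 0" if "0 < b" "u (b - 1)"
      using less.prems u_lam[OF that(2)] that(1) by (intro less.hyps) auto
    ultimately have "lam a * z a b = z a b * lam b" using eq[of a b] less.prems by (auto split: if_splits)
    then show ?case using less.prems by (auto simp: mult.commute)
  qed
  have blk: "block_start a = block_start b" if "a \<le> b" "b < CARD('n)" "lam a = lam b" for a b
    using that
  proof (induction "b - a" arbitrary: a)
    case (Suc d)
    then have "a < b" by simp
    then have ua: "u a" using Suc.prems sep unfolding separated_def by blast
    have "block_start (Suc a) = block_start b" using \<open>a < b\<close> Suc u_lam[OF ua] by (intro Suc.hyps) auto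
    then show ?case using ua by simp
  qed simp
  have eq0: "z a b = 0" if "a < CARD('n)" "b < CARD('n)" "lam a = lam b" for a b
    using that
  proof (induction a arbitrary: b)
    case 0
    then have "block_start b = 0" using blk[of 0 b] by simp
    then show ?case using first[of b] 0 by (simp add: z_def)
  next
    case (Suc c)
    show ?case
    proof (cases "u c")
      case True
      have c: "c < CARD('n)" "lam c = lam b" using Suc.prems u_lam[OF True] by auto
      have "z c b = 0" using Suc.IH c Suc.prems by blast
      moreover have "z c (b - 1) = 0" if "0 < b" "u (b - 1)"
        using c that u_lam[OF that(2)] Suc.prems by (intro Suc.IH) auto
      ultimately show ?thesis using eq[of c b] c Suc.prems True by (auto split: if_splits)
    next
      case False
      have "block_start b = Suc c"
      proof (cases "Suc c \<le> b")
        case True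
        then show ?thesis using blk[of "Suc c" b] Suc.prems False by simp
      next
        case b: False
        then have "b < Suc c" by simp
        then have "block_start b = block_start (Suc c)" using blk[of b "Suc c"] Suc.prems by simp
        then show ?thesis using False b block_start_le[of b] by simp
      qed
      then show ?thesis using first[of b] Suc.prems by (simp add: z_def)
    qed
  qed
  have "Z $ i $ j = 0" for i j
    using ne[of "pos i" "pos j"] eq0[of "pos i" "pos j"] by (cases "lam (pos i) = lam (pos j)") (auto simp: z_def)
  then show ?thesis by (simp add: vec_eq_iff)
qed

lemma centralizer_separated:
  assumes sep: "separated CARD('n) lam u" and X: "X ** J = J ** X"
  shows "\<exists>\<gamma>. X = toeplitz \<gamma>"
proof -
  define \<gamma> where "\<gamma> = (\<chi> j. X $ e (block_start (pos j)) $ j)"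
  have "(X - toeplitz \<gamma>) ** J = J ** (X - toeplitz \<gamma>)" by (simp add: matrix_distribs X toeplitz_commutes)
  moreover have "(X - toeplitz \<gamma>) $ e (block_start b) $ e b = 0" if "b < CARD('n)" for b
    using toeplitz_first_row[of \<gamma> "e b"] that by (simp add: \<gamma>_def)
  ultimately have "X - toeplitz \<gamma> = 0" by (rule commuting_zero_first_rows[OF sep])
  then show ?thesis by auto
qed

text \<open>Suppose that the last place \<open>a\<close> of a block and the first place \<open>b\<close> of a later block have the same
  eigenvalue. The matrix unit in position \<open>(b, a)\<close> commutes with \<open>J\<close>, since row \<open>a\<close> and column \<open>b\<close> of \<open>J\<close> are
  zero outside of the diagonal. It lies below the diagonal, where all Toeplitz matrices vanish.\<close>

lemma extra_commuting:
  assumes "\<not> separated CARD('n) lam u"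
  shows "\<exists>E i j. E ** J = J ** E \<and> pos j < pos i \<and> E $ i $ j \<noteq> 0"
proof -
  from assms obtain a b0 where b0: "a < b0" "b0 < CARD('n)" "lam b0 = lam a" and ua: "\<not> u a"
    unfolding separated_def by force
  \<comment> \<open>The least such place is the first one of its block: its predecessor would have the same eigenvalue, or
  would be \<open>a\<close> itself, the last place of a block.\<close>
  define b where "b = (LEAST b. a < b \<and> lam b = lam a)"
  have b: "a < b" "lam b = lam a" using LeastI[of "\<lambda>b. a < b \<and> lam b = lam a" b0] b0 by (auto simp: b_def)
  have le: "b \<le> c" if "a < c" "lam c = lam a" for c using that by (auto simp: b_def intro: Least_le)
  have bn: "b < CARD('n)" using le[of b0] b0 by simp
  have ub: "\<not> u c" if "Suc c = b" for c
  proof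
    assume u: "u c"
    have "lam c = lam a" using u_lam[OF u] that b by simp
    moreover have "c \<noteq> a" using u ua by blast
    ultimately show False using le[of c] that b by simp
  qed
  define E :: "complex^'n^'n" where "E = (\<chi> i j. if pos i = b \<and> pos j = a then 1 else 0)"
  have "E ** J = J ** E"
    unfolding commutes_iff
  proof (intro allI impI)
    fix c d assume cd: "c < CARD('n)" "d < CARD('n)"
    have 1: "lam c * E $ e c $ e d = E $ e c $ e d * lam d" using b cd by (simp add: E_def)
    have 2: "(if u c then E $ e (Suc c) $ e d else 0) = 0"
      using u_less[of c] ub[of c] by (auto simp: E_def)
    have 3: "(if 0 < d \<and> u (d - 1) then E $ e c $ e (d - 1) else 0) = 0"
      using ua cd by (auto simp: E_def)
    show "lam c * E $ e c $ e d + (if u c then E $ e (Suc c) $ e d else 0)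
     = E $ e c $ e d * lam d + (if 0 < d \<and> u (d - 1) then E $ e c $ e (d - 1) else 0)"
      using 1 2 3 by simp
  qed
  moreover have "pos (e a) < pos (e b)" "E $ e b $ e a \<noteq> 0"
    using b bn by (simp_all add: E_def)
  ultimately show ?thesis by blast
qed

text \<open>For a diagonal matrix \<open>N\<close> the commutator multiplies the entry \<open>(i, j)\<close> of \<open>J\<close> by \<open>N $ i $ i - N $ j $ j\<close>,
  and \<open>J\<close> has only superdiagonal entries. So the diagonal of \<open>N\<close> has to decrease in steps of 2.\<close>

lemma nilpotent_weight:
  assumes "\<And>a. a < CARD('n) \<Longrightarrow> lam a = 0"
  shows "\<exists>N. N ** J - J ** N = msmult 2 J"
proof -
  define N :: "complex^'n^'n" where "N = (\<chi> i j. if i = j then - 2 * of_nat (pos i) else 0)"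
  have lam0: "lam (pos i) = 0" for i by (rule assms) simp
  have "(N ** J - J ** N) $ i $ j = msmult 2 J $ i $ j" for i j
  proof -
    have "(N ** J) $ i $ j = - 2 * of_nat (pos i) * J $ i $ j"
      by (simp add: matrix_matrix_mult_def N_def if_distrib if_distribR cong: if_cong)
    moreover have "(J ** N) $ i $ j = - 2 * of_nat (pos j) * J $ i $ j"
      by (simp add: matrix_matrix_mult_def N_def if_distrib if_distribR cong: if_cong)
    ultimately show ?thesis by (auto simp: J_def lam0 algebra_simps)
  qed
  then show ?thesis by (intro exI[of _ N]) (simp add: vec_eq_iff)
qed

lemma J_eigenvector:
  assumes a: "a < CARD('n)"
  shows "J *v axis (e (block_start a)) 1 = lam a *s axis (e (block_start a)) 1"
proof -
  have sta: "block_start a < CARD('n)" using block_start_le[of a] a by simp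
  have nu: "\<not> u c" if "Suc c = block_start a" for c
  proof
    assume "u c"
    then have "block_start (Suc c) = block_start c" by simp
    moreover have "block_start (Suc c) = Suc c"
      unfolding that using block_start_eq[of a "block_start a", OF order_refl block_start_le] .
    ultimately show False using block_start_le[of c] by simp
  qed
  have "J $ i $ e (block_start a) = (if i = e (block_start a) then lam a else 0)" for i
    using sta lam_block_start[of a] nu[of "pos i"] by (auto simp: J_def)
  then show ?thesis
    by (simp add: vec_eq_iff matrix_vector_mult_def sum_axis) (simp add: axis_def)
qed

lemma J_nonscalar:
  assumes "CARD('n) \<ge> 2" and sep: "separated CARD('n) lam u"
  shows "J \<noteq> mat c"
proof
  assume J: "J = mat c"
  have 01: "(0::nat) < CARD('n)" "1 < CARD('n)" using assms(1) by auto
  have "lam a = c" if "a < CARD('n)" for a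
  proof -
    have "J $ e a $ e a = c" by (simp add: J Finite_Cartesian_Product.mat_def)
    with that show ?thesis by (simp add: J_def)
  qed
  with 01 have "u 0" using sep unfolding separated_def by (metis less_one)
  have "e 0 \<noteq> e 1" using pos_e[OF 01(1)] pos_e[OF 01(2)] by (metis zero_neq_one)
  with \<open>u 0\<close> 01 have "J $ e 0 $ e 1 = 1" by (simp add: J_def)
  with \<open>e 0 \<noteq> e 1\<close> show False by (simp add: J Finite_Cartesian_Product.mat_def)
qed

end

lemma coprime_linear_powers:
  fixes a b :: complex
  assumes "k > 0" "l > 0"
  shows "coprime ([:- a, 1:] ^ k) ([:- b, 1:] ^ l) \<longleftrightarrow> a \<noteq> b"
proof
  assume "coprime ([:- a, 1:] ^ k) ([:- b, 1:] ^ l)"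
  moreover have "\<not> is_unit [:- a, 1:]" by (simp add: is_unit_poly_iff)
  ultimately show "a \<noteq> b"
    using assms dvd_power[of k "[:- a, 1:]"] dvd_power[of l "[:- a, 1:]"] by (metis coprime_common_divisor)
next
  assume ab: "a \<noteq> b"
  show "coprime ([:- a, 1:] ^ k) ([:- b, 1:] ^ l)"
  proof (rule coprimeI, rule ccontr)
    fix c assume c: "c dvd [:- a, 1:] ^ k" "c dvd [:- b, 1:] ^ l" "\<not> is_unit c"
    have "c \<noteq> 0" using c(1) by auto
    with c(3) have "degree c \<noteq> 0" by (auto simp: is_unit_iff_degree)
    then obtain z where "poly c z = 0"
      using Fundamental_Theorem_Algebra.fundamental_theorem_of_algebra[of c] constant_degree[of c] by auto
    then have "poly p z = 0" if "c dvd p" for p using that by (auto elim: dvdE)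
    from this[OF c(1)] this[OF c(2)] ab show False by simp
  qed
qed

text \<open>The index type only has an arbitrary numbering, so the Jordan form is transported from the matrices with
  natural numbers as indices. By \<open>coprime_linear_powers\<close> the condition on the elementary divisors says that the
  list of eigenvalues, with one entry for each block, has no repetition.\<close>

theorem jordan_shape_exists:
  fixes D :: "complex^'n^'n::finite"
  shows "\<exists>(pos :: 'n \<Rightarrow> nat) e lam u P R. jordan_shape pos e lam u \<and> D = P ** jordan_shape.J pos lam u ** R
     \<and> P ** R = mat 1 \<and> R ** P = mat 1
     \<and> (pairwise_coprime (elementary_divisors D) \<longleftrightarrow> separated CARD('n) lam u)"
proof -
  define bs where "bs = (SOME bs. has_jordan_form D bs)"
  have "has_jordan_form D bs" unfolding bs_def by (rule someI_ex) (rule has_jordan_form_exists)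
  then obtain e where e: "bij_betw e {..<CARD('n)} UNIV" and jnf: "jordan_nf (matrix_along e D) bs"
    unfolding has_jordan_form_def by blast
  have fst0: "0 \<notin> fst ` set bs" and sim: "similar_mat (matrix_along e D) (jordan_matrix bs)"
    using jnf unfolding jordan_nf_def by auto
  obtain n P Q where PQ: "matrix_along e D \<in> carrier_mat n n" "jordan_matrix bs \<in> carrier_mat n n"
      "P \<in> carrier_mat n n" "Q \<in> carrier_mat n n" "P * Q = 1\<^sub>m n" "Q * P = 1\<^sub>m n"
      "matrix_along e D = P * jordan_matrix bs * Q"
    using similar_matD[OF sim] by auto
  have n: "n = CARD('n)" using PQ(1) by (auto simp: matrix_along_def)
  have nsum: "sum_list (map fst bs) = CARD('n)" using PQ(2) n by auto
  define pos where "pos = inv_into {..<CARD('n)} e"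
  have pos: "pos i < CARD('n)" "e (pos i) = i" for i
    using bij_betw_inv_into_right[OF e] bij_betwE[OF bij_betw_inv_into[OF e]] by (auto simp: pos_def)
  have pos_e: "pos (e a) = a" if "a < CARD('n)" for a
    using bij_betw_inv_into_left[OF e] that by (simp add: pos_def)
  have bij: "bij_betw pos UNIV {0..<CARD('n)}"
    using bij_betw_inv_into[OF e] by (simp add: pos_def atLeast0LessThan)
  define lift :: "complex Matrix.mat \<Rightarrow> complex^'n^'n" where "lift X = (\<chi> i j. X $$ (pos i, pos j))" for X
  have lift_mult: "lift (X * Y) = lift X ** lift Y" if "X \<in> carrier_mat n n" "Y \<in> carrier_mat n n" for X Y
  proof -
    have "(X * Y) $$ (pos i, pos j) = (\<Sum>k\<in>UNIV. X $$ (pos i, pos k) * Y $$ (pos k, pos j))" for i j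
    proof -
      have "(X * Y) $$ (pos i, pos j) = (\<Sum>k\<in>{0..<CARD('n)}. X $$ (pos i, k) * Y $$ (k, pos j))"
        using that pos by (auto simp: n scalar_prod_def)
      also have "\<dots> = (\<Sum>k\<in>UNIV. X $$ (pos i, pos k) * Y $$ (pos k, pos j))"
        by (rule sum.reindex_bij_betw[OF bij, symmetric])
      finally show ?thesis .
    qed
    then show ?thesis by (simp add: lift_def matrix_matrix_mult_def vec_eq_iff)
  qed
  have inj: "pos i = pos j \<longleftrightarrow> i = j" for i j using pos(2) by metis
  have lift_1: "lift (1\<^sub>m n) = mat 1"
    using pos by (simp add: lift_def vec_eq_iff Finite_Cartesian_Product.mat_def n inj)
  have D: "lift (matrix_along e D) = D"
    using pos by (simp add: lift_def matrix_along_def vec_eq_iff)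
  from jordan_matrix_entries[OF fst0] obtain lam u where
    ent: "\<And>i j. i < CARD('n) \<Longrightarrow> j < CARD('n) \<Longrightarrow> jordan_matrix bs $$ (i, j) =
          (if i = j then lam i else if j = Suc i \<and> u i then 1 else (0::complex))"
    and u: "\<And>i. u i \<Longrightarrow> Suc i < CARD('n) \<and> lam (Suc i) = lam i"
    and dist: "distinct (map snd bs) \<longleftrightarrow> separated CARD('n) lam u"
    unfolding nsum by (elim exE conjE) simp
  have shape: "jordan_shape pos e lam u"
    by unfold_locales (use pos pos_e u in auto)
  have J: "lift (jordan_matrix bs) = jordan_shape.J pos lam u"
    unfolding jordan_shape.J_def[OF shape] lift_def
    by (simp add: vec_eq_iff ent pos inj)
  have "D = lift P ** lift (jordan_matrix bs) ** lift Q"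
    using PQ lift_mult D by (metis mult_carrier_mat)
  moreover have "lift P ** lift Q = mat 1" "lift Q ** lift P = mat 1"
    using PQ lift_mult lift_1 by metis+
  moreover have "pairwise_coprime (elementary_divisors D) \<longleftrightarrow> distinct (map snd bs)"
  proof -
    have "fst (bs ! i) > 0" if "i < length bs" for i
      using fst0 nth_mem[OF that] by (metis gr0I image_eqI)
    then have "coprime (map (\<lambda>(k, l). [:- l, 1:] ^ k) bs ! i) (map (\<lambda>(k, l). [:- l, 1:] ^ k) bs ! j)
        \<longleftrightarrow> map snd bs ! i \<noteq> map snd bs ! j" if "i < length bs" "j < length bs" for i j
      using that by (simp add: case_prod_unfold coprime_linear_powers)
    then show ?thesis
      unfolding pairwise_coprime_def elementary_divisors_def bs_def[symmetric] distinct_conv_nth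
      by auto
  qed
  ultimately show ?thesis
    unfolding J dist using shape by blast
qed

lemma nilpotent_matrix_iff: "nilpotent_matrix D \<longleftrightarrow> (\<exists>k. mpow D k = 0)"
  by (simp add: nilpotent_matrix_def mpow_def)

lemma nilpotent_eigenvalue:
  assumes "nilpotent_matrix D" and Dv: "D *v v = c *s v" and "v \<noteq> 0"
  shows "c = 0"
proof -
  obtain k where k: "mpow D k = 0" using assms(1) nilpotent_matrix_iff by blast
  have "mpow D k *v v = c ^ k *s v" for k
  proof (induction k)
    case (Suc k)
    have "mpow D (Suc k) *v v = D *v (mpow D k *v v)" by (simp add: mpow_Suc matrix_vector_mul_assoc)
    also have "\<dots> = c ^ Suc k *s v" by (simp add: Suc Dv matrix_vector_distribs mult.commute)
    finally show ?case .
  qed simp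
  from this[of k] have "c ^ k *s v = 0" by (simp add: k)
  with \<open>v \<noteq> 0\<close> show ?thesis by (auto simp: vec_eq_iff)
qed

text \<open>Any submultiplicative norm would do.\<close>

definition entry_norm :: "complex^'n^'n::finite \<Rightarrow> real" where
  "entry_norm M = (\<Sum>i\<in>UNIV. \<Sum>j\<in>UNIV. cmod (M $ i $ j))"

lemma entry_norm_mult: "entry_norm (A ** B) \<le> entry_norm A * entry_norm B"
proof -
  have "entry_norm (A ** B) \<le> (\<Sum>i\<in>UNIV. \<Sum>j\<in>UNIV. \<Sum>k\<in>UNIV. cmod (A $ i $ k) * cmod (B $ k $ j))"
    unfolding entry_norm_def matrix_matrix_mult_def
    by (intro sum_mono) (simp add: norm_mult[symmetric] norm_sum)
  also have "\<dots> = (\<Sum>i\<in>UNIV. \<Sum>k\<in>UNIV. cmod (A $ i $ k) * (\<Sum>j\<in>UNIV. cmod (B $ k $ j)))"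
    by (subst sum.swap) (simp add: sum_distrib_left)
  also have "\<dots> \<le> (\<Sum>i\<in>UNIV. \<Sum>k\<in>UNIV. cmod (A $ i $ k) * entry_norm B)"
    unfolding entry_norm_def
    by (intro sum_mono mult_left_mono member_le_sum sum_nonneg) auto
  also have "\<dots> = entry_norm A * entry_norm B"
    by (simp add: entry_norm_def sum_distrib_right)
  finally show ?thesis .
qed

lemma entry_norm_is_norm:
  shows entry_norm_msmult: "entry_norm (msmult c A) = cmod c * entry_norm A"
    and entry_norm_diff: "entry_norm (A - B) \<le> entry_norm A + entry_norm B"
    and entry_norm_nonneg: "entry_norm A \<ge> 0"
    and entry_norm_eq_0: "entry_norm A = 0 \<Longrightarrow> A = 0"
proof -
  show "entry_norm (msmult c A) = cmod c * entry_norm A"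
    by (simp add: entry_norm_def norm_mult sum_distrib_left)
  show "entry_norm (A - B) \<le> entry_norm A + entry_norm B"
    unfolding entry_norm_def sum.distrib[symmetric]
    by (intro sum_mono) (simp add: norm_triangle_ineq4)
  show "entry_norm A \<ge> 0" by (simp add: entry_norm_def sum_nonneg)
  show "entry_norm A = 0 \<Longrightarrow> A = 0"
    by (simp add: entry_norm_def vec_eq_iff sum_nonneg_eq_0_iff sum_nonneg)
qed

text \<open>Induction gives $\Gamma D^k - D^k\Gamma = kcD^k$. Taking norms bounds $k|c|$ by twice the norm of \<open>\<Gamma>\<close>
  as long as $D^k \neq 0$.\<close>

lemma weight_vector_nilpotent:
  assumes comm: "\<Gamma> ** D - D ** \<Gamma> = msmult c D" and "c \<noteq> 0"
  shows "nilpotent_matrix D"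
proof -
  have pw: "\<Gamma> ** mpow D k - mpow D k ** \<Gamma> = msmult (of_nat k * c) (mpow D k)" for k
  proof (induction k)
    case (Suc k)
    have c: "\<Gamma> ** D = D ** \<Gamma> + msmult c D" using comm by (simp add: algebra_simps)
    have IH: "\<Gamma> ** mpow D k = mpow D k ** \<Gamma> + msmult (of_nat k * c) (mpow D k)"
      using Suc by (simp add: algebra_simps)
    have "\<Gamma> ** mpow D (Suc k) = (\<Gamma> ** D) ** mpow D k" by (simp add: mpow_Suc matrix_mul_assoc)
    also have "\<dots> = D ** (\<Gamma> ** mpow D k) + msmult c (mpow D (Suc k))"
      by (simp add: c matrix_distribs mpow_Suc matrix_mul_assoc)
    also have "\<dots> = mpow D (Suc k) ** \<Gamma> + msmult (of_nat k * c) (mpow D (Suc k)) + msmult c (mpow D (Suc k))"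
      by (simp add: IH matrix_distribs mpow_Suc matrix_mul_assoc)
    finally show ?case by (simp add: msmult_distribs algebra_simps)
  qed (simp add: msmult_distribs)
  obtain k :: nat where k: "real k > 2 * entry_norm \<Gamma> / cmod c" using reals_Archimedean2 by blast
  have "real k * cmod c * entry_norm (mpow D k) \<le> entry_norm (\<Gamma> ** mpow D k) + entry_norm (mpow D k ** \<Gamma>)"
    using entry_norm_diff[of "\<Gamma> ** mpow D k" "mpow D k ** \<Gamma>"]
    by (simp add: pw entry_norm_msmult norm_mult)
  also have "\<dots> \<le> 2 * entry_norm \<Gamma> * entry_norm (mpow D k)"
  proof -
    have "2 * entry_norm \<Gamma> * entry_norm (mpow D k)
        = entry_norm \<Gamma> * entry_norm (mpow D k) + entry_norm (mpow D k) * entry_norm \<Gamma>"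
      by (simp add: algebra_simps)
    then show ?thesis
      using entry_norm_mult[of \<Gamma> "mpow D k"] entry_norm_mult[of "mpow D k" \<Gamma>] by linarith
  qed
  finally have "(real k * cmod c - 2 * entry_norm \<Gamma>) * entry_norm (mpow D k) \<le> 0"
    by (simp add: algebra_simps)
  moreover have "real k * cmod c - 2 * entry_norm \<Gamma> > 0"
    using k \<open>c \<noteq> 0\<close> by (simp add: field_simps)
  ultimately have "entry_norm (mpow D k) = 0"
    using entry_norm_nonneg[of "mpow D k"] by (simp add: mult_le_0_iff)
  then have "mpow D k = 0" by (rule entry_norm_eq_0)
  then show ?thesis unfolding nilpotent_matrix_iff by blast
qed

text \<open>A linear injection of a coordinate space into the space of weights of \<open>D\<close>, the pairs $(\Gamma, d)$ with
  $\Gamma D - D\Gamma = 2dD$. The dimension of the coordinate space is a lower bound for the dimension of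
  the space of weights.\<close>

definition weight_embedding ::
  "complex^'n^'n::finite \<Rightarrow> (complex^'k::finite \<Rightarrow> (complex^'n^'n) \<times> complex) \<Rightarrow> bool" where
  "weight_embedding D L \<longleftrightarrow>
     (\<forall>x y. L (x + y) = L x + L y) \<and>
     (\<forall>c x. L (c *s x) = (msmult c (fst (L x)), c * snd (L x))) \<and>
     (\<forall>x. L x = 0 \<longrightarrow> x = 0) \<and>
     (\<forall>x. fst (L x) ** D - D ** fst (L x) = msmult (2 * snd (L x)) D)"

lemma weight_embedding_conj:
  assumes L: "weight_embedding J L" and D: "D = P ** J ** R" and PR: "P ** R = mat 1" "R ** P = mat 1"
  shows "weight_embedding D (\<lambda>x. (P ** fst (L x) ** R, snd (L x)))"
proof -
  note L = L[unfolded weight_embedding_def]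
  have conj: "(P ** G ** R) ** D - D ** (P ** G ** R) = P ** (G ** J - J ** G) ** R" for G
  proof -
    have "(P ** G ** R) ** D = P ** G ** (R ** P) ** J ** R"
      by (simp add: D matrix_mul_assoc)
    moreover have "D ** (P ** G ** R) = P ** J ** (R ** P) ** G ** R"
      by (simp add: D matrix_mul_assoc)
    ultimately show ?thesis by (simp add: PR matrix_distribs matrix_mul_assoc)
  qed
  have "(P ** fst (L x) ** R) ** D - D ** (P ** fst (L x) ** R) = msmult (2 * snd (L x)) D" for x
  proof -
    have "fst (L x) ** J - J ** fst (L x) = msmult (2 * snd (L x)) J" using L by blast
    then show ?thesis unfolding conj by (simp add: matrix_distribs D)
  qed
  moreover have "x = 0" if "P ** fst (L x) ** R = 0" "snd (L x) = 0" for x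
  proof -
    have "fst (L x) = (R ** P) ** fst (L x) ** (R ** P)" by (simp add: PR)
    also have "\<dots> = R ** (P ** fst (L x) ** R) ** P" by (simp add: matrix_mul_assoc)
    also have "\<dots> = 0" by (simp add: that matrix_distribs)
    finally show "x = 0" using L that by (simp add: prod_eq_iff)
  qed
  ultimately show ?thesis
    unfolding weight_embedding_def using L
    by (auto simp: matrix_distribs prod_eq_iff zero_prod_def plus_prod_def)
qed

text \<open>The weights with \<open>d = 0\<close> that come from Toeplitz matrices are always there. A further
  independent one is the nilpotent weight with \<open>d = 1\<close>, or the matrix unit of \<open>extra_commuting\<close>. If \<open>D\<close> is not
  nilpotent, then \<open>d = 0\<close> by \<open>weight_vector_nilpotent\<close>, and for separated eigenvalues the Toeplitz matrices are
  the whole centralizer. A scalar matrix of size at least 2 has several blocks with the same eigenvalue.\<close>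

theorem weight_embeddings:
  fixes D :: "complex^'n^'n::finite"
  shows centralizer_embedding: "\<exists>L :: complex^'n \<Rightarrow> _. weight_embedding D L"
    and extra_weight: "nilpotent_matrix D \<or> \<not> pairwise_coprime (elementary_divisors D) \<Longrightarrow>
         \<exists>L :: complex^('n + unit) \<Rightarrow> _. weight_embedding D L"
    and all_weights: "\<not> nilpotent_matrix D \<Longrightarrow> pairwise_coprime (elementary_divisors D) \<Longrightarrow>
         \<exists>L :: complex^'n \<Rightarrow> _. weight_embedding D L \<and>
           (\<forall>\<Gamma> d. \<Gamma> ** D - D ** \<Gamma> = msmult (2 * d) D \<longrightarrow> d = 0 \<and> (\<exists>x. L x = (\<Gamma>, 0)))"
    and nonscalar_if_coprime: "CARD('n) \<ge> 2 \<Longrightarrow> pairwise_coprime (elementary_divisors D) \<Longrightarrow> D \<noteq> mat c"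
proof -
  from jordan_shape_exists[of D] obtain pos :: "'n \<Rightarrow> nat" and e lam u P R where
    shape: "jordan_shape pos e lam u" and D: "D = P ** jordan_shape.J pos lam u ** R"
    and PR: "P ** R = mat 1" "R ** P = mat 1"
    and sep: "pairwise_coprime (elementary_divisors D) \<longleftrightarrow> separated CARD('n) lam u" by blast
  interpret jordan_shape pos e lam u by (rule shape)
  have base: "weight_embedding J (\<lambda>x. (toeplitz x, 0))"
    unfolding weight_embedding_def
    by (auto simp: toeplitz_linear toeplitz_commutes toeplitz_inj msmult_distribs zero_prod_def)
  note emb = weight_embedding_conj[OF _ D PR]
  show "\<exists>L :: complex^'n \<Rightarrow> _. weight_embedding D L" using emb[OF base] by - (rule exI)
  show "\<exists>L :: complex^('n + unit) \<Rightarrow> _. weight_embedding D L"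
    if "nilpotent_matrix D \<or> \<not> pairwise_coprime (elementary_divisors D)"
  proof (cases "nilpotent_matrix D")
    case True
    have "lam a = 0" if a: "a < CARD('n)" for a
    proof (rule nilpotent_eigenvalue[OF True])
      let ?w = "axis (e (block_start a)) 1 :: complex^'n"
      have "D *v (P *v ?w) = P *v (J *v ((R ** P) *v ?w))"
        by (simp only: D matrix_vector_mul_assoc matrix_mul_assoc)
      also have "\<dots> = lam a *s (P *v ?w)"
        by (simp add: PR J_eigenvector[OF a] matrix_vector_distribs)
      finally show "D *v (P *v ?w) = lam a *s (P *v ?w)" .
      have "R *v (P *v ?w) = ?w" by (simp add: matrix_vector_mul_assoc PR)
      then show "P *v ?w \<noteq> 0" by (auto simp: axis_eq_0_iff)
    qed
    from nilpotent_weight[OF this] obtain N where N: "N ** J - J ** N = msmult 2 J" by blast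
    define L where "L x = (toeplitz (\<chi> i. x $ Inl i) + msmult (x $ Inr ()) N, x $ Inr ())"
      for x :: "complex^('n + unit)"
    have "weight_embedding J L"
      unfolding weight_embedding_def
    proof (intro conjI allI impI)
      fix x y :: "complex^('n + unit)" and c
      have 1: "(\<chi> i. (x + y) $ Inl i) = (\<chi> i. x $ Inl i) + (\<chi> i. y $ Inl i )"
        and 2: "(\<chi> i. (c *s x) $ Inl i) = c *s (\<chi> i. x $ Inl i)" by (simp_all add: vec_eq_iff)
      show "L (x + y) = L x + L y"
        unfolding L_def 1 toeplitz_linear by (simp add: msmult_distribs)
      show "L (c *s x) = (msmult c (fst (L x)), c * snd (L x))"
        unfolding L_def 2 toeplitz_linear by (simp add: msmult_distribs)
      show "fst (L x) ** J - J ** fst (L x) = msmult (2 * snd (L x)) J"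
      proof -
        have "fst (L x) ** J - J ** fst (L x) = msmult (x $ Inr ()) (N ** J - J ** N)"
          by (simp add: L_def matrix_distribs toeplitz_commutes msmult_distribs)
        then show ?thesis by (simp add: N msmult_distribs L_def mult.commute)
      qed
      assume "L x = 0"
      then have z: "x $ Inr () = 0" "toeplitz (\<chi> i. x $ Inl i) = 0"
        by (auto simp: L_def zero_prod_def msmult_distribs)
      from toeplitz_inj[OF z(2)] have "x $ Inl i = 0" for i by (simp add: vec_eq_iff)
      with z show "x = 0" by (simp add: vec_eq_iff) (metis (full_types) old.sum.exhaust old.unit.exhaust)
    qed
    from emb[OF this] show ?thesis by - (rule exI)
  next
    case False
    with that sep have "\<not> separated CARD('n) lam u" by blast
    from extra_commuting[OF this] obtain E i j where
      E: "E ** J = J ** E" "pos j < pos i" "E $ i $ j \<noteq> 0" by blast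
    define L where "L x = (toeplitz (\<chi> i. x $ Inl i) + msmult (x $ Inr ()) E, 0 :: complex)"
      for x :: "complex^('n + unit)"
    have "weight_embedding J L"
      unfolding weight_embedding_def
    proof (intro conjI allI impI)
      fix x y :: "complex^('n + unit)" and c
      have 1: "(\<chi> i. (x + y) $ Inl i) = (\<chi> i. x $ Inl i) + (\<chi> i. y $ Inl i )"
        and 2: "(\<chi> i. (c *s x) $ Inl i) = c *s (\<chi> i. x $ Inl i)" by (simp_all add: vec_eq_iff)
      show "L (x + y) = L x + L y"
        unfolding L_def 1 toeplitz_linear by (simp add: msmult_distribs)
      show "L (c *s x) = (msmult c (fst (L x)), c * snd (L x))"
        unfolding L_def 2 toeplitz_linear by (simp add: msmult_distribs)
      show "fst (L x) ** J - J ** fst (L x) = msmult (2 * snd (L x)) J"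
        by (simp add: L_def matrix_distribs toeplitz_commutes msmult_distribs E)
      assume "L x = 0"
      then have z: "toeplitz (\<chi> i. x $ Inl i) + msmult (x $ Inr ()) E = 0"
        by (auto simp: L_def zero_prod_def)
      then have "(toeplitz (\<chi> i. x $ Inl i) + msmult (x $ Inr ()) E) $ i $ j = 0" by simp
      then have x: "x $ Inr () = 0" using E toeplitz_lower_zero by simp
      with z have "toeplitz (\<chi> i. x $ Inl i) = 0" by (simp add: msmult_distribs)
      from toeplitz_inj[OF this] have "x $ Inl i = 0" for i by (simp add: vec_eq_iff)
      with x show "x = 0" by (simp add: vec_eq_iff) (metis (full_types) old.sum.exhaust old.unit.exhaust)
    qed
    from emb[OF this] show ?thesis by - (rule exI)
  qed
  show "\<exists>L :: complex^'n \<Rightarrow> _. weight_embedding D L \<and>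
      (\<forall>\<Gamma> d. \<Gamma> ** D - D ** \<Gamma> = msmult (2 * d) D \<longrightarrow> d = 0 \<and> (\<exists>x. L x = (\<Gamma>, 0)))"
    if nn: "\<not> nilpotent_matrix D" and cop: "pairwise_coprime (elementary_divisors D)"
  proof (rule exI, intro conjI allI impI)
    show "weight_embedding D (\<lambda>x. (P ** fst (toeplitz x, 0 :: complex) ** R, snd (toeplitz x, 0 :: complex)))" by (rule emb[OF base])
    fix \<Gamma> d assume G: "\<Gamma> ** D - D ** \<Gamma> = msmult (2 * d) D"
    show d: "d = 0" using weight_vector_nilpotent[OF G] nn by auto
    have GD: "\<Gamma> ** D = D ** \<Gamma>" using G d by (simp add: msmult_distribs)
    have "(R ** \<Gamma> ** P) ** J = J ** (R ** \<Gamma> ** P)"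
    proof -
      have "(R ** \<Gamma> ** P) ** J = R ** (\<Gamma> ** D) ** P"
      proof -
        have "R ** (\<Gamma> ** D) ** P = (R ** \<Gamma> ** P) ** J ** (R ** P)" by (simp add: D matrix_mul_assoc)
        then show ?thesis by (simp add: PR)
      qed
      also have "\<dots> = R ** (D ** \<Gamma>) ** P" by (simp add: GD)
      also have "\<dots> = (R ** P) ** J ** (R ** \<Gamma> ** P)" by (simp add: D matrix_mul_assoc)
      finally show ?thesis by (simp add: PR)
    qed
    from centralizer_separated[OF _ this] sep cop obtain x where x: "R ** \<Gamma> ** P = toeplitz x" by blast
    have "P ** toeplitz x ** R = (P ** R) ** \<Gamma> ** (P ** R)" by (simp add: x[symmetric] matrix_mul_assoc)
    then show "\<exists>x. (P ** fst (toeplitz x, 0 :: complex) ** R, snd (toeplitz x, 0 :: complex)) = (\<Gamma>, 0)"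
      by (auto simp: PR)
  qed
  show "D \<noteq> mat c" if "CARD('n) \<ge> 2" "pairwise_coprime (elementary_divisors D)"
  proof
    assume "D = mat c"
    have *: "X ** mat c = mat c ** X" for X :: "complex^'n^'n"
      by (simp add: vec_eq_iff matrix_matrix_mult_def Finite_Cartesian_Product.mat_def if_distrib if_distribR cong: if_cong)
    have "J = (R ** P) ** J ** (R ** P)" by (simp add: PR)
    also have "\<dots> = R ** D ** P" by (simp add: D matrix_mul_assoc)
    also have "\<dots> = mat c ** (R ** P)" by (simp add: \<open>D = mat c\<close> * matrix_mul_assoc)
    finally have "J = mat c" by (simp add: PR)
    with J_nonscalar that sep show False by blast
  qed
qed

section \<open>Dimension of spaces of vector fields\<close>

lemma linear_vf:
  fixes L :: "complex^'i::finite \<Rightarrow> ('n::finite) vfield"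
  assumes "\<And>x y. L (x + y) = L x + L y" "\<And>c x. L (c *s x) = vf_scale c (L x)"
  shows "Vector_Spaces.linear (*s) vf_scale L"
  by unfold_locales
    (auto simp: assms vec.scale_right_distrib vec.scale_left_distrib vf.scale_right_distrib vf.scale_left_distrib)

lemma vf_dim_lower:
  fixes L :: "complex^'i::finite \<Rightarrow> ('n::finite) vfield"
  assumes add: "\<And>x y. L (x + y) = L x + L y" and sc: "\<And>c x. L (c *s x) = vf_scale c (L x)"
    and inj: "\<And>x. L x = 0 \<Longrightarrow> x = 0" and V: "range L \<subseteq> V"
  shows "enat CARD('i) \<le> vf_dim V"
proof (cases "\<exists>B. finite B \<and> V \<subseteq> vf.span B")
  case True
  then obtain B where B: "finite B" "V \<subseteq> vf.span B" by blast
  interpret lp: vector_space_pair "(*s) :: complex \<Rightarrow> complex^'i \<Rightarrow> _" "vf_scale :: complex \<Rightarrow> 'n vfield \<Rightarrow> _"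
    by unfold_locales
  interpret lin: Vector_Spaces.linear "(*s) :: complex \<Rightarrow> complex^'i \<Rightarrow> _" "vf_scale :: complex \<Rightarrow> 'n vfield \<Rightarrow> _" L
    by (rule linear_vf[OF add sc])
  have injL: "inj L"
  proof (rule injI)
    fix x y assume "L x = L y"
    then have "L (x - y) = 0" by (simp add: lin.diff)
    then show "x = y" using inj by force
  qed
  have indep: "vf.independent (L ` cart_basis)"
    by (rule lp.linear_independent_injective_image[OF linear_vf[OF add sc] independent_cart_basis])
      (use injL in \<open>auto intro: inj_on_subset\<close>)
  have card: "card (L ` cart_basis) = CARD('i)"
    using injL by (simp add: card_image inj_on_subset card_cart_basis)
  obtain B' where B': "B' \<subseteq> V" "vf.independent B'" "V \<subseteq> vf.span B'" "card B' = vf.dim V"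
    using vf.basis_exists[of V] by metis
  have "finite B'" using vf.independent_span_bound[OF B(1) B'(2)] B'(1) B(2) by blast
  then have "card (L ` cart_basis) \<le> card B'"
    using vf.independent_span_bound[OF _ indep, of B'] B'(3) V by blast
  with card B'(4) True show ?thesis by (simp add: vf_dim_def)
qed (auto simp: vf_dim_def)

lemma vf_dim_upper:
  fixes L :: "complex^'i::finite \<Rightarrow> ('n::finite) vfield"
  assumes add: "\<And>x y. L (x + y) = L x + L y" and sc: "\<And>c x. L (c *s x) = vf_scale c (L x)"
    and V: "V \<subseteq> range L"
  shows "vf_dim V \<le> enat CARD('i)"
proof -
  interpret lp: vector_space_pair "(*s) :: complex \<Rightarrow> complex^'i \<Rightarrow> _" "vf_scale :: complex \<Rightarrow> 'n vfield \<Rightarrow> _"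
    by unfold_locales
  have span: "vf.span (L ` cart_basis) = range L"
    using lp.linear_span_image[OF linear_vf[OF add sc], of cart_basis] by (simp add: span_cart_basis)
  have fin: "finite (L ` cart_basis)" by (simp add: finite_cart_basis)
  have "vf.dim V \<le> card (L ` cart_basis)"
    by (rule vf.dim_le_card) (use V span fin in auto)
  also have "\<dots> \<le> CARD('i)" using card_image_le[OF finite_cart_basis, of L] by (simp add: card_cart_basis)
  finally show ?thesis using V span fin by (auto simp: vf_dim_def)
qed

section \<open>Symmetries obtained from weight vectors\<close>

definition affine_field :: "complex set \<Rightarrow> (complex \<Rightarrow> complex) \<Rightarrow> (complex \<Rightarrow> complex^'n^'n) \<Rightarrow> (complex \<Rightarrow> complex^'n) \<Rightarrow> ('n::finite) vfield" where
  "affine_field U \<tau> G h = (\<lambda>(t, x). if t \<in> U then (\<tau> t, G t *v x + h t) else 0)"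

text \<open>With respect to \<open>x\<close> the right-hand side is of the same form as the function, so the lemma can be
  applied twice to compute second derivatives.\<close>

lemma dir_deriv_affine:
  fixes g :: "'n::finite \<Rightarrow> complex \<Rightarrow> complex"
  assumes U: "open U" and t: "t \<in> U"
    and f: "\<And>t x. t \<in> U \<Longrightarrow> f (t, x) = (\<Sum>a\<in>UNIV. g a t * x $ a) + k t"
    and g: "\<And>a. (g a has_field_derivative g' a) (at t)" and k: "(k has_field_derivative k') (at t)"
  shows "dir_deriv f (\<tau>, y) (t, x) = \<tau> * ((\<Sum>a\<in>UNIV. g' a * x $ a) + k') + (\<Sum>a\<in>UNIV. g a t * y $ a)"
proof -
  let ?F = "\<lambda>p. (\<Sum>a\<in>UNIV. g a (fst p) * snd p $ a) + k (fst p)"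
  have "dir_deriv f (\<tau>, y) (t, x) = dir_deriv ?F (\<tau>, y) (t, x)"
    by (rule dir_deriv_cong[OF U]) (use f t in auto)
  also have "\<dots> = deriv (\<lambda>s. (\<Sum>a\<in>UNIV. g a (t + s * \<tau>) * (x $ a + s * y $ a)) + k (t + s * \<tau>)) 0"
    unfolding dir_deriv_def by (simp add: cscale_def)
  also have "\<dots> = (\<Sum>a\<in>UNIV. (g' a * \<tau>) * x $ a + g a t * y $ a) + k' * \<tau>"
  proof (rule DERIV_imp_deriv, rule DERIV_add)
    have lin: "((\<lambda>s. t + s * \<tau>) has_field_derivative \<tau>) (at 0)" by (auto intro!: derivative_eq_intros)
    have "(k has_field_derivative k') (at (t + 0 * \<tau>))" using k by simp
    from DERIV_chain2[OF this lin]
    show "((\<lambda>s. k (t + s * \<tau>)) has_field_derivative k' * \<tau>) (at 0)" .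
    show "((\<lambda>s. \<Sum>a\<in>UNIV. g a (t + s * \<tau>) * (x $ a + s * y $ a)) has_field_derivative
        (\<Sum>a\<in>UNIV. (g' a * \<tau>) * x $ a + g a t * y $ a)) (at 0)"
    proof (rule DERIV_sum)
      fix a
      have "(g a has_field_derivative g' a) (at (t + 0 * \<tau>))" using g by simp
      from DERIV_chain2[OF this lin]
      have 1: "((\<lambda>s. g a (t + s * \<tau>)) has_field_derivative g' a * \<tau>) (at 0)" .
      have 2: "((\<lambda>s. x $ a + s * y $ a) has_field_derivative y $ a) (at 0)"
        by (auto intro!: derivative_eq_intros)
      show "((\<lambda>s. g a (t + s * \<tau>) * (x $ a + s * y $ a)) has_field_derivative
          (g' a * \<tau>) * x $ a + g a t * y $ a) (at 0)"
        using DERIV_mult[OF 1 2] by (simp add: mult.commute)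
    qed
  qed
  finally show ?thesis by (simp add: sum.distrib sum_distrib_left algebra_simps)
qed

lemma has_derivative_vec_lambda:
  fixes f :: "'n::finite \<Rightarrow> 'a::euclidean_space \<Rightarrow> complex"
  assumes "\<And>b. (f b has_derivative f' b) (at p)"
  shows "((\<lambda>q. \<chi> b. f b q) has_derivative (\<lambda>q. \<chi> b. f' b q)) (at p)"
proof (rule has_derivative_componentwise_within[THEN iffD2], rule ballI)
  fix i :: "complex^'n" assume "i \<in> Basis"
  then obtain k r where "i = axis k r" by (auto simp: Basis_vec_def)
  then show "((\<lambda>q. (\<chi> b. f b q) \<bullet> i) has_derivative (\<lambda>q. (\<chi> b. f' b q) \<bullet> i)) (at p)"
    using has_derivative_inner_left[OF assms[of k], of r] by (simp add: inner_axis)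
qed

lemma affine_field_holomorphic:
  fixes G :: "complex \<Rightarrow> complex^'n^'n::finite"
  assumes U: "open U" and \<tau>: "\<And>t. t \<in> U \<Longrightarrow> (\<tau> has_field_derivative \<tau>1 t) (at t)"
    and G: "\<And>t. t \<in> U \<Longrightarrow> has_mderiv G (G1 t) t" and h: "\<And>t. t \<in> U \<Longrightarrow> has_vderiv h (h1 t) t"
  shows "affine_field U \<tau> G h \<in> holomorphic_vfields U"
  unfolding holomorphic_vfields_def
proof (intro CollectI conjI ballI allI impI)
  show "affine_field U \<tau> G h p = 0" if "p \<notin> U \<times> UNIV" for p :: "complex \<times> (complex^'n)"
    using that by (auto simp: affine_field_def split: prod.splits)
next
  fix p :: "complex \<times> (complex^'n)" assume "p \<in> U \<times> UNIV"
  then obtain t x where p: "p = (t, x)" "t \<in> U" by auto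
  define Q' where "Q' q = (\<tau>1 t * fst q, \<chi> b. (\<Sum>a\<in>UNIV. (G1 t $ b $ a * fst q) * x $ a + G t $ b $ a * snd q $ a) + h1 t $ b * fst q)"
    for q :: "complex \<times> (complex^'n)"
  have comp: "((\<lambda>q. f (fst q)) has_derivative (\<lambda>q. f' * fst q)) (at p)"
    if "(f has_field_derivative f') (at t)" for f f'
  proof (rule has_derivative_compose[where f = fst and f' = fst and g = f and g' = "(*) f'"])
    show "(fst has_derivative fst) (at p)" by (rule has_derivative_fst[OF has_derivative_ident])
    show "(f has_derivative (*) f') (at (fst p))"
      using that p by (simp add: has_field_derivative_def)
  qed
  have snd: "((\<lambda>q. snd q $ a) has_derivative (\<lambda>q. snd q $ a)) (at p)" for a
    by (rule bounded_linear.has_derivative[OF bounded_linear_vec_nth has_derivative_snd[OF has_derivative_ident]])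
  have "((\<lambda>q. (\<tau> (fst q), \<chi> b. (\<Sum>a\<in>UNIV. G (fst q) $ b $ a * snd q $ a) + h (fst q) $ b)) has_derivative Q') (at p)"
    unfolding Q'_def [abs_def]
  proof (intro has_derivative_Pair has_derivative_vec_lambda has_derivative_add has_derivative_sum)
    show "((\<lambda>q. \<tau> (fst q)) has_derivative (\<lambda>q. \<tau>1 t * fst q)) (at p)" by (rule comp[OF \<tau>[OF p(2)]])
    show "((\<lambda>q. h (fst q) $ b) has_derivative (\<lambda>q. h1 t $ b * fst q)) (at p)" for b
      by (rule comp) (use h[OF p(2)] in \<open>simp add: has_vderiv_def\<close>)
    fix a b
    have "((\<lambda>q. G (fst q) $ b $ a) has_derivative (\<lambda>q. G1 t $ b $ a * fst q)) (at p)"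
      by (rule comp) (use G[OF p(2)] in \<open>simp add: has_mderiv_def\<close>)
    from has_derivative_mult[OF this snd[of a]]
    show "((\<lambda>q. G (fst q) $ b $ a * snd q $ a) has_derivative
        (\<lambda>q. G1 t $ b $ a * fst q * x $ a + G t $ b $ a * snd q $ a)) (at p)"
      by (simp add: p add.commute)
  qed
  then have "(affine_field U \<tau> G h has_derivative Q') (at p)"
    by (rule has_derivative_transform_within_open[OF _ open_Times[OF U open_UNIV]])
      (use p in \<open>auto simp: affine_field_def matrix_vector_mult_def vec_eq_iff\<close>)
  moreover have "Q' (cscale c q) = cscale c (Q' q)" for c q
    by (simp add: Q'_def cscale_def vec_eq_iff sum_distrib_left algebra_simps sum.distrib)
  ultimately show "\<exists>Q'. (affine_field U \<tau> G h has_derivative Q') (at p) \<and> (\<forall>c q. Q' (cscale c q) = cscale c (Q' q))"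
    by blast
qed

text \<open>The three equations are the coefficients of \<open>v\<close>, of \<open>x\<close> and of 1 in the symmetry condition, which is
  affine in \<open>(x, v)\<close> for these fields.\<close>

lemma affine_field_symmetry:
  fixes A B :: "complex^'n^'n::finite" and C :: "complex \<Rightarrow> complex^'n"
  assumes U: "open U" and C: "\<And>b. (\<lambda>t. C t $ b) holomorphic_on U"
    and G: "\<And>t. t \<in> U \<Longrightarrow> has_mderiv G (G1 t) t" "\<And>t. t \<in> U \<Longrightarrow> has_mderiv G1 (G2 t) t"
    and h: "\<And>t. t \<in> U \<Longrightarrow> has_vderiv h (h1 t) t" "\<And>t. t \<in> U \<Longrightarrow> has_vderiv h1 (h2 t) t"
    and eqv: "\<And>t. t \<in> U \<Longrightarrow> msmult 2 (G1 t) + G t ** A = A ** G t + msmult d A"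
    and eqx: "\<And>t. t \<in> U \<Longrightarrow> G2 t + G t ** B = B ** G t + A ** G1 t + msmult (2 * d) B"
    and eq1: "\<And>t. t \<in> U \<Longrightarrow> h2 t + G t *v C t =
       (c + d * t) *s (\<chi> b. deriv (\<lambda>t. C t $ b) t) + B *v h t + A *v h1 t + (2 * d) *s C t"
  shows "affine_field U (\<lambda>t. c + d * t) G h \<in> max_lie_invariance_algebra U (\<lambda>t x v. A *v v + B *v x + C t)"
proof -
  let ?Q = "affine_field U (\<lambda>t. c + d * t) G h"
  have Q: "?Q \<in> holomorphic_vfields U"
    by (rule affine_field_holomorphic[OF U _ G(1) h(1), where ?\<tau>1.0 = "\<lambda>_. d"])
      (auto intro!: derivative_eq_intros)
  have T: "tcoeff ?Q (t, x) = (\<Sum>a\<in>UNIV. 0 * x $ a) + (c + d * t)" if "t \<in> U" for t x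
    using that by (simp add: tcoeff_def affine_field_def)
  have X: "xcoeff ?Q b (t, x) = (\<Sum>a\<in>UNIV. G t $ b $ a * x $ a) + h t $ b" if "t \<in> U" for t x b
    using that by (simp add: xcoeff_def affine_field_def matrix_vector_mult_def)
  have G': "((\<lambda>t. G t $ b $ a) has_field_derivative G1 t $ b $ a) (at t)"
      "((\<lambda>t. G1 t $ b $ a) has_field_derivative G2 t $ b $ a) (at t)" if "t \<in> U" for t a b
    using G that by (simp_all add: has_mderiv_def)
  have h': "((\<lambda>t. h t $ b) has_field_derivative h1 t $ b) (at t)"
      "((\<lambda>t. h1 t $ b) has_field_derivative h2 t $ b) (at t)" if "t \<in> U" for t b
    using h that by (simp_all add: has_vderiv_def)
  have T1: "dir_deriv (tcoeff ?Q) (r, y) (t, x) = r * d" if t: "t \<in> U" for r y t x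
  proof -
    have "dir_deriv (tcoeff ?Q) (r, y) (t, x) = r * ((\<Sum>a\<in>UNIV. 0 * x $ a) + d) + (\<Sum>a\<in>UNIV. 0 * y $ a)"
      by (rule dir_deriv_affine[OF U t T]) (auto intro!: derivative_eq_intros)
    then show ?thesis by simp
  qed
  have T2: "dir_deriv (dir_deriv (tcoeff ?Q) (1, v)) (1, v) (t, x) = 0" if t: "t \<in> U" for v t x
  proof -
    have "dir_deriv (dir_deriv (tcoeff ?Q) (1, v)) (1, v) (t, x) = 1 * ((\<Sum>a\<in>UNIV. 0 * x $ a) + 0) + (\<Sum>a\<in>UNIV. 0 * v $ a)"
      by (rule dir_deriv_affine[OF U t, where k = "\<lambda>_. d"]) (auto simp: T1 intro!: derivative_eq_intros)
    then show ?thesis by simp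
  qed
  have X1: "dir_deriv (xcoeff ?Q b) (r, y) (t, x) = r * ((G1 t *v x) $ b + h1 t $ b) + (G t *v y) $ b"
    if t: "t \<in> U" for b r y t x
    unfolding matrix_vector_mult_def vec_lambda_beta
    by (rule dir_deriv_affine[OF U t X]) (use G' h' t in auto)
  have X2: "dir_deriv (dir_deriv (xcoeff ?Q b) (1, v)) (1, v) (t, x) =
      (G2 t *v x) $ b + h2 t $ b + 2 * (G1 t *v v) $ b" if t: "t \<in> U" for b v t x
  proof -
    have "dir_deriv (dir_deriv (xcoeff ?Q b) (1, v)) (1, v) (t, x) =
        1 * ((\<Sum>a\<in>UNIV. G2 t $ b $ a * x $ a) + (h2 t $ b + (\<Sum>a\<in>UNIV. G1 t $ b $ a * v $ a)))
        + (\<Sum>a\<in>UNIV. G1 t $ b $ a * v $ a)"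
      by (rule dir_deriv_affine[OF U t, where k = "\<lambda>t. h1 t $ b + (\<Sum>a\<in>UNIV. G t $ b $ a * v $ a)"])
        (use t in \<open>auto simp: X1 matrix_vector_mult_def intro!: derivative_eq_intros G' h' sum.cong\<close>)
    then show ?thesis by (simp add: matrix_vector_mult_def)
  qed
  have "prolong2 ?Q b t x v (A *v v + B *v x + C t) =
      tcoeff ?Q (t, x) * deriv (\<lambda>t. C t $ b) t
      + (\<Sum>a\<in>UNIV. B $ b $ a * xcoeff ?Q a (t, x))
      + (\<Sum>a\<in>UNIV. A $ b $ a * (dir_deriv (xcoeff ?Q a) (1, v) (t, x)
           - v $ a * dir_deriv (tcoeff ?Q) (1, v) (t, x)))" if t: "t \<in> U" for b t x v
  proof -
    let ?w = "A *v v + B *v x + C t"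
    have ev: "2 *s (G1 t *v v) + G t *v (A *v v) = A *v (G t *v v) + d *s (A *v v)"
      using arg_cong[OF eqv[OF t], of "\<lambda>M. M *v v"] by (simp add: matrix_vector_distribs matrix_vector_mul_assoc)
    have ex: "G2 t *v x + G t *v (B *v x) = B *v (G t *v x) + A *v (G1 t *v x) + (2 * d) *s (B *v x)"
      using arg_cong[OF eqx[OF t], of "\<lambda>M. M *v x"] by (simp add: matrix_vector_distribs matrix_vector_mul_assoc)
    have "(G2 t *v x + h2 t + 2 *s (G1 t *v v)) + G t *v ?w - (2 * d) *s ?w =
        (c + d * t) *s (\<chi> b. deriv (\<lambda>t. C t $ b) t) + B *v (G t *v x + h t)
        + A *v (G1 t *v x + h1 t + G t *v v - d *s v)"
    proof -
      have "(G2 t *v x + h2 t + 2 *s (G1 t *v v)) + G t *v ?w - (2 * d) *s ?w =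
        (2 *s (G1 t *v v) + G t *v (A *v v)) + (G2 t *v x + G t *v (B *v x)) + (h2 t + G t *v C t) - (2 * d) *s ?w"
        by (simp add: matrix_vector_distribs algebra_simps)
      also have "\<dots> = (c + d * t) *s (\<chi> b. deriv (\<lambda>t. C t $ b) t) + B *v (G t *v x + h t)
        + A *v (G1 t *v x + h1 t + G t *v v - d *s v)"
        unfolding ev ex eq1[OF t]
        by (simp add: matrix_vector_distribs vec_eq_iff algebra_simps)
      finally show ?thesis .
    qed
    then have "((G2 t *v x + h2 t + 2 *s (G1 t *v v)) + G t *v ?w - (2 * d) *s ?w) $ b =
        ((c + d * t) *s (\<chi> b. deriv (\<lambda>t. C t $ b) t) + B *v (G t *v x + h t)
        + A *v (G1 t *v x + h1 t + G t *v v - d *s v)) $ b" by (rule arg_cong)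
    moreover have "(\<Sum>a\<in>UNIV. B $ b $ a * xcoeff ?Q a (t, x)) = (B *v (G t *v x + h t)) $ b"
      unfolding matrix_vector_mult_def[of B] by (simp add: X t) (simp add: matrix_vector_mult_def)
    moreover have "(\<Sum>a\<in>UNIV. A $ b $ a * (dir_deriv (xcoeff ?Q a) (1, v) (t, x)
           - v $ a * dir_deriv (tcoeff ?Q) (1, v) (t, x))) = (A *v (G1 t *v x + h1 t + G t *v v - d *s v)) $ b"
      unfolding matrix_vector_mult_def[of A] X1[OF t] T1[OF t] by (simp add: mult.commute)
    moreover have "prolong2 ?Q b t x v ?w = ((G2 t *v x + h2 t + 2 *s (G1 t *v v)) + G t *v ?w - (2 * d) *s ?w) $ b"
      unfolding prolong2_def X2[OF t] X1[OF t] T1[OF t] T2[OF t] by (simp add: algebra_simps)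
    ultimately show ?thesis by (simp add: T t distrib_right)
  qed
  then show ?thesis
    unfolding max_lie_invariance_algebra_def mem_Collect_eq
    using Q lie_symmetry_linear_iff[OF U Q C refl, of A B] by blast
qed

text \<open>In the variable $x - p(t)$ the system is homogeneous; the field is
  $(c + dt)\partial_t + (G(x - p) + (c + dt)\dot p + y)\partial_x$. In this form the part of the symmetry condition
  that does not involve \<open>x\<close> and \<open>v\<close> follows from the two equations for \<open>G\<close>.\<close>

lemma symmetry_from_particular_solution:
  fixes A B :: "complex^'n^'n::finite" and C :: "complex \<Rightarrow> complex^'n"
  assumes U: "open U" and C: "\<And>b. (\<lambda>t. C t $ b) holomorphic_on U"
    and p: "\<And>t. t \<in> U \<Longrightarrow> has_vderiv p (p1 t) t" "\<And>t. t \<in> U \<Longrightarrow> has_vderiv p1 (A *v p1 t + B *v p t + C t) t"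
    and y: "\<And>t. t \<in> U \<Longrightarrow> has_vderiv y (y1 t) t" "\<And>t. t \<in> U \<Longrightarrow> has_vderiv y1 (A *v y1 t + B *v y t) t"
    and G: "\<And>t. t \<in> U \<Longrightarrow> has_mderiv G (G1 t) t" "\<And>t. t \<in> U \<Longrightarrow> has_mderiv G1 (G2 t) t"
    and eqv: "\<And>t. t \<in> U \<Longrightarrow> msmult 2 (G1 t) + G t ** A = A ** G t + msmult d A"
    and eqx: "\<And>t. t \<in> U \<Longrightarrow> G2 t + G t ** B = B ** G t + A ** G1 t + msmult (2 * d) B"
  shows "affine_field U (\<lambda>t. c + d * t) G (\<lambda>t. (c + d * t) *s p1 t - G t *v p t + y t)
     \<in> max_lie_invariance_algebra U (\<lambda>t x v. A *v v + B *v x + C t)"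
proof -
  define C1 where "C1 t = (\<chi> b. deriv (\<lambda>t. C t $ b) t)" for t
  have C1: "has_vderiv C (C1 t) t" if "t \<in> U" for t
    using holomorphic_derivI[OF C U that] by (simp add: has_vderiv_def C1_def)
  define p2 where "p2 t = A *v p1 t + B *v p t + C t" for t
  define p3 where "p3 t = A *v p2 t + B *v p1 t + C1 t" for t
  have p1: "has_vderiv p1 (p2 t) t" if "t \<in> U" for t using p(2)[OF that] by (simp add: p2_def)
  have p2: "has_vderiv p2 (p3 t) t" if t: "t \<in> U" for t
  proof -
    have "has_vderiv p2 ((0 *v p1 t + A *v p2 t) + (0 *v p t + B *v p1 t) + C1 t) t"
      unfolding p2_def [abs_def, of] using p1[OF t, unfolded p2_def]
      by (intro has_vderiv_add has_vderiv_mult has_mderiv_const p1 p C1 t)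
    then show ?thesis by (simp add: p3_def)
  qed
  have \<tau>: "((\<lambda>t. c + d * t) has_field_derivative d) (at t)" for t
    by (auto intro!: derivative_eq_intros)
  define y2 where "y2 t = A *v y1 t + B *v y t" for t
  have y2: "has_vderiv y1 (y2 t) t" if "t \<in> U" for t using y(2)[OF that] by (simp add: y2_def)
  define h1 where "h1 t = (d *s p1 t + (c + d * t) *s p2 t) - (G1 t *v p t + G t *v p1 t) + y1 t" for t
  define h2 where "h2 t = (0 *s p1 t + d *s p2 t + (d *s p2 t + (c + d * t) *s p3 t))
      - ((G2 t *v p t + G1 t *v p1 t) + (G1 t *v p1 t + G t *v p2 t)) + y2 t" for t
  have eq1: "h2 t + G t *v C t = (c + d * t) *s C1 t
      + B *v ((c + d * t) *s p1 t - G t *v p t + y t) + A *v h1 t + (2 * d) *s C t" if t: "t \<in> U" for t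
  proof -
    have ev: "2 *s (G1 t *v p1 t) = A *v (G t *v p1 t) + d *s (A *v p1 t) - G t *v (A *v p1 t)"
      using arg_cong[OF eqv[OF t], of "\<lambda>M. M *v p1 t"]
      by (simp add: matrix_vector_distribs matrix_vector_mul_assoc algebra_simps)
    have ex: "G2 t *v p t = B *v (G t *v p t) + A *v (G1 t *v p t) + (2 * d) *s (B *v p t) - G t *v (B *v p t)"
      using arg_cong[OF eqx[OF t], of "\<lambda>M. M *v p t"]
      by (simp add: matrix_vector_distribs matrix_vector_mul_assoc algebra_simps)
    have Gp2: "G t *v p2 t = G t *v (A *v p1 t) + G t *v (B *v p t) + G t *v C t"
      by (simp add: p2_def matrix_vector_distribs)
    have "h2 t = (2 * d) *s p2 t + (c + d * t) *s p3 t - (G2 t *v p t + 2 *s (G1 t *v p1 t) + G t *v p2 t) + y2 t"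
      by (simp add: h2_def vec_eq_iff algebra_simps)
    then show ?thesis
      unfolding ev ex Gp2 h1_def p3_def y2_def matrix_vector_distribs
      by (simp add: p2_def vec_eq_iff algebra_simps)
  qed
  show ?thesis
  proof (rule affine_field_symmetry[OF U C G _ _ eqv eqx])
    fix t assume t: "t \<in> U"
    show "has_vderiv (\<lambda>t. (c + d * t) *s p1 t - G t *v p t + y t) (h1 t) t"
      unfolding h1_def by (intro has_vderiv_add has_vderiv_diff has_vderiv_smult has_vderiv_mult \<tau> p1 p G y t)
    show "has_vderiv h1 (h2 t) t"
      unfolding h1_def h2_def
      by (intro has_vderiv_add has_vderiv_diff has_vderiv_smult has_vderiv_mult \<tau> DERIV_const p1 p2 p G y y2 t)
    show "h2 t + G t *v C t = (c + d * t) *s (\<chi> b. deriv (\<lambda>t. C t $ b) t)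
        + B *v ((c + d * t) *s p1 t - G t *v p t + y t) + A *v h1 t + (2 * d) *s C t"
      using eq1[OF t] by (simp add: C1_def)
  qed
qed

text \<open>Under $x = e^{tA/2}y$ the field $dt\,\partial_t + \Gamma y\,\partial_y$ has the linear part
  $e^{tA/2}\Gamma e^{-tA/2}x + \frac12 dt\,Ax$; the second term comes from the dependence of the substitution on
  \<open>t\<close>.\<close>

definition pullback :: "complex^'n^'n::finite \<Rightarrow> complex^'n^'n \<Rightarrow> complex \<Rightarrow> complex \<Rightarrow> complex^'n^'n" where
  "pullback A \<Gamma> d t = mexp (msmult (1/2) A) t ** \<Gamma> ** mexp (msmult (1/2) A) (- t) + msmult (d * t / 2) A"

text \<open>With \<open>K\<close> for half of \<open>A\<close>, the matrix $H = e^{tK}\Gamma e^{-tK}$ has the derivative \<open>K H - H K\<close>, and the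
  matrix $B + K^2$ commutes with $e^{tK}$. So \<open>H\<close> is a weight of $B + K^2$ like \<open>\<Gamma>\<close>, and the remaining
  identities are algebra.\<close>

lemma pullback_equations:
  fixes A B \<Gamma> :: "complex^'n^'n::finite"
  defines "D \<equiv> B + msmult (1/4) (A ** A)"
  assumes AB: "A ** B = B ** A" and weight: "\<Gamma> ** D - D ** \<Gamma> = msmult (2 * d) D"
  shows "\<exists>G1 G2. \<forall>t. has_mderiv (pullback A \<Gamma> d) (G1 t) t \<and> has_mderiv G1 (G2 t) t \<and>
     msmult 2 (G1 t) + pullback A \<Gamma> d t ** A = A ** pullback A \<Gamma> d t + msmult d A \<and>
     G2 t + pullback A \<Gamma> d t ** B = B ** pullback A \<Gamma> d t + A ** G1 t + msmult (2 * d) B"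
proof -
  define K where "K = msmult (1/2) A"
  have A: "A = msmult 2 K" by (simp add: K_def msmult_distribs)
  have KB: "K ** B = B ** K" using AB by (simp add: K_def matrix_distribs)
  have D: "D = B + K ** K" by (simp add: D_def K_def matrix_distribs msmult_distribs)
  define E where "E = mexp K"
  define H where "H t = E t ** \<Gamma> ** E (- t)" for t
  have EK: "K ** E t = E t ** K" for t unfolding E_def by (rule mexp_commute) simp
  have ED: "D ** E t = E t ** D" for t unfolding E_def
    by (rule mexp_commute) (simp add: D matrix_distribs KB matrix_mul_assoc)
  have H': "has_mderiv H (K ** H t - H t ** K) t" for t
  proof -
    have "has_mderiv H ((K ** E t ** \<Gamma> + E t ** 0) ** E (- t) + E t ** \<Gamma> ** msmult (- 1) (K ** E (- t))) t"
      unfolding H_def [abs_def] E_def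
      by (intro has_mderiv_mult has_mderiv_mexp has_mderiv_const has_mderiv_mexp_minus)
    moreover have "(K ** E t ** \<Gamma> + E t ** 0) ** E (- t) + E t ** \<Gamma> ** msmult (- 1) (K ** E (- t)) = K ** H t - H t ** K"
      unfolding EK[of "- t"] by (simp add: H_def matrix_distribs matrix_mul_assoc vec_eq_iff)
    ultimately show ?thesis by simp
  qed
  define H1 where "H1 t = K ** H t - H t ** K" for t
  have H1: "has_mderiv H1 (K ** H1 t - H1 t ** K) t" for t
  proof -
    have "has_mderiv H1 ((0 ** H t + K ** H1 t) - (H1 t ** K + H t ** 0)) t"
      unfolding H1_def [abs_def] by (intro has_mderiv_diff has_mderiv_mult has_mderiv_const H')
    then show ?thesis by (simp add: matrix_distribs)
  qed
  have HD: "H t ** D - D ** H t = msmult (2 * d) D" for t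
  proof -
    have "H t ** D = E t ** \<Gamma> ** (E (- t) ** D)" by (simp add: H_def matrix_mul_assoc)
    then have 1: "H t ** D = E t ** (\<Gamma> ** D) ** E (- t)" by (simp add: ED[symmetric] matrix_mul_assoc)
    have "D ** H t = (D ** E t) ** \<Gamma> ** E (- t)" by (simp add: H_def matrix_mul_assoc)
    then have 2: "D ** H t = E t ** (D ** \<Gamma>) ** E (- t)" by (simp add: ED matrix_mul_assoc)
    have "H t ** D - D ** H t = E t ** (\<Gamma> ** D - D ** \<Gamma>) ** E (- t)"
      unfolding 1 2 by (simp add: matrix_distribs)
    also have "\<dots> = msmult (2 * d) (D ** (E t ** E (- t)))"
      by (simp add: weight matrix_distribs ED[symmetric] matrix_mul_assoc)
    finally show ?thesis by (simp add: E_def mexp_minus)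
  qed
  have mov: "pullback A \<Gamma> d t = H t + msmult (d * t) K" for t
    by (simp add: pullback_def K_def[symmetric] H_def E_def) (simp add: A msmult_distribs)
  show ?thesis
  proof (intro exI allI conjI)
    fix t
    have "has_mderiv (pullback A \<Gamma> d) (H1 t + (msmult d K + msmult (d * t) 0)) t"
      unfolding mov [abs_def] H1_def
      by (intro has_mderiv_add has_mderiv_msmult has_mderiv_const H') (auto intro!: derivative_eq_intros)
    then show "has_mderiv (pullback A \<Gamma> d) (H1 t + msmult d K) t" by (simp add: msmult_distribs)
    have "has_mderiv (\<lambda>t. H1 t + msmult d K) ((K ** H1 t - H1 t ** K) + 0) t"
      by (intro has_mderiv_add has_mderiv_const H1)
    then show "has_mderiv (\<lambda>t. H1 t + msmult d K) (K ** H1 t - H1 t ** K) t" by simp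
    show "msmult 2 (H1 t + msmult d K) + pullback A \<Gamma> d t ** A = A ** pullback A \<Gamma> d t + msmult d A"
      unfolding mov by (simp add: H1_def A matrix_distribs msmult_distribs algebra_simps)
    have HD': "H t ** B + H t ** K ** K = B ** H t + K ** K ** H t + msmult (2 * d) B + msmult (2 * d) (K ** K)"
      using HD[of t] by (simp add: D matrix_distribs msmult_distribs matrix_mul_assoc algebra_simps)
    then have HB: "H t ** B = B ** H t + K ** K ** H t + msmult (2 * d) B + msmult (2 * d) (K ** K) - H t ** K ** K"
      by (simp add: algebra_simps)
    show "(K ** H1 t - H1 t ** K) + pullback A \<Gamma> d t ** B = B ** pullback A \<Gamma> d t + A ** (H1 t + msmult d K) + msmult (2 * d) B"
      unfolding mov
      by (simp add: H1_def A matrix_distribs msmult_distribs matrix_mul_assoc KB HB)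
        (simp add: vec_eq_iff algebra_simps)
  qed
qed

text \<open>The coordinates of \<open>q\<close> are \<open>c\<close>, the parameter of the weight and the initial values of a homogeneous
  solution. Using a single coordinate space makes the count of dimensions a matter of cardinalities of types.\<close>

definition symmetry_family :: "complex set \<Rightarrow> complex^'n^'n \<Rightarrow> complex^'n^'n \<Rightarrow> (complex \<Rightarrow> complex^'n)
    \<Rightarrow> (complex \<Rightarrow> complex^'n) \<Rightarrow> complex \<Rightarrow> (complex^'k \<Rightarrow> (complex^'n^'n) \<times> complex)
    \<Rightarrow> complex^(unit + ('k + ('n + 'n))) \<Rightarrow> ('n::finite) vfield" where
  "symmetry_family U A B p p1 t0 W q = (let c = q $ Inl (); (\<Gamma>, d) = W (\<chi> i. q $ Inr (Inl i));
       z = (\<chi> i. q $ Inr (Inr i)) in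
     affine_field U (\<lambda>t. c + d * t) (pullback A \<Gamma> d)
       (\<lambda>t. (c + d * t) *s p1 t - pullback A \<Gamma> d t *v p t + upper (mexp (companion A B) (t - t0) *v z)))"

lemma pullback_linear:
  "pullback A (\<Gamma> + \<Gamma>') (d + d') t = pullback A \<Gamma> d t + pullback A \<Gamma>' d' t"
  "pullback A (msmult c \<Gamma>) (c * d) t = msmult c (pullback A \<Gamma> d t)"
  by (auto simp: pullback_def matrix_distribs msmult_distribs algebra_simps add_divide_distrib)

lemma symmetry_family_linear:
  fixes W :: "complex^'k::finite \<Rightarrow> (complex^'n^'n::finite) \<times> complex"
  assumes W: "\<And>x y. W (x + y) = W x + W y" "\<And>c x. W (c *s x) = (msmult c (fst (W x)), c * snd (W x))"
  shows "symmetry_family U A B p p1 t0 W (q + q') = symmetry_family U A B p p1 t0 W q + symmetry_family U A B p p1 t0 W q'"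
    and "symmetry_family U A B p p1 t0 W (c *s q) = vf_scale c (symmetry_family U A B p p1 t0 W q)"
proof -
  have 1: "(\<chi> i. (q + q') $ Inr (Inl i)) = (\<chi> i. q $ Inr (Inl i)) + (\<chi> i. q' $ Inr (Inl i))"
    "(\<chi> i. (c *s q) $ Inr (Inl i)) = c *s (\<chi> i. q $ Inr (Inl i))"
    "(\<chi> i. (q + q') $ Inr (Inr i)) = (\<chi> i. q $ Inr (Inr i)) + (\<chi> i. q' $ Inr (Inr i))"
    "(\<chi> i. (c *s q) $ Inr (Inr i)) = c *s (\<chi> i. q $ Inr (Inr i))"
    by (simp_all add: vec_eq_iff)
  show "symmetry_family U A B p p1 t0 W (q + q') = symmetry_family U A B p p1 t0 W q + symmetry_family U A B p p1 t0 W q'"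
    unfolding symmetry_family_def affine_field_def Let_def case_prod_unfold 1 W fst_add snd_add pullback_linear
    by (simp add: fun_eq_iff prod_eq_iff matrix_vector_distribs upper_linear)
      (simp add: vec_eq_iff algebra_simps)
  show "symmetry_family U A B p p1 t0 W (c *s q) = vf_scale c (symmetry_family U A B p p1 t0 W q)"
    unfolding symmetry_family_def affine_field_def Let_def case_prod_unfold 1 W fst_conv snd_conv pullback_linear
    by (simp add: fun_eq_iff prod_eq_iff matrix_vector_distribs upper_linear vf_scale_def cscale_def)
      (simp add: vec_eq_iff algebra_simps)
qed

text \<open>The family is injective: the coefficient of $\partial_t$ determines \<open>c\<close> and \<open>d\<close>. If these are zero,
  the field at \<open>x = p t\<close> is the homogeneous solution, which determines its initial values; the
  linear part at \<open>t0\<close> is a conjugate of \<open>\<Gamma>\<close>.\<close>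

theorem vf_dim_lower_bound:
  fixes A B :: "complex^'n^'n::finite" and C :: "complex \<Rightarrow> complex^'n"
    and W :: "complex^'k::finite \<Rightarrow> (complex^'n^'n) \<times> complex"
  assumes U: "open U" "U \<noteq> {}" "simply_connected U"
    and AB: "A ** B = B ** A" and C: "\<And>b. (\<lambda>t. C t $ b) holomorphic_on U"
    and W: "weight_embedding (B + msmult (1/4) (A ** A)) W"
  shows "enat (1 + CARD('k) + 2 * CARD('n))
     \<le> vf_dim (max_lie_invariance_algebra U (\<lambda>t x v. A *v v + B *v x + C t))"
proof -
  note W = W[unfolded weight_embedding_def]
  obtain t0 where t0: "t0 \<in> U" using U(2) by blast
  from second_order_exists[OF U(1,3) C, of A B]
  obtain p p1 where p: "\<And>t. t \<in> U \<Longrightarrow> has_vderiv p (p1 t) t"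
    "\<And>t. t \<in> U \<Longrightarrow> has_vderiv p1 (A *v p1 t + B *v p t + C t) t" by blast
  define L where "L = symmetry_family U A B p p1 t0 W"
  let ?V = "max_lie_invariance_algebra U (\<lambda>t x v. A *v v + B *v x + C t)"
  note hom = second_order_homogeneous[of A B t0]
  have "enat CARD(unit + ('k + ('n + 'n))) \<le> vf_dim ?V"
  proof (rule vf_dim_lower[where L = L])
    show "L (q + q') = L q + L q'" "L (c *s q) = vf_scale c (L q)" for q q' c
      unfolding L_def by (rule symmetry_family_linear; use W in blast)+
    show "range L \<subseteq> ?V"
    proof clarify
      fix q :: "complex^(unit + ('k + ('n + 'n)))"
      define \<Gamma> where "\<Gamma> = fst (W (\<chi> i. q $ Inr (Inl i)))"
      define d where "d = snd (W (\<chi> i. q $ Inr (Inl i)))"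
      have "\<Gamma> ** (B + msmult (1/4) (A ** A)) - (B + msmult (1/4) (A ** A)) ** \<Gamma>
          = msmult (2 * d) (B + msmult (1/4) (A ** A))"
        unfolding \<Gamma>_def d_def using W by blast
      from pullback_equations[OF AB this] obtain G1 G2 where G: "\<And>t. has_mderiv (pullback A \<Gamma> d) (G1 t) t"
        "\<And>t. has_mderiv G1 (G2 t) t"
        "\<And>t. msmult 2 (G1 t) + pullback A \<Gamma> d t ** A = A ** pullback A \<Gamma> d t + msmult d A"
        "\<And>t. G2 t + pullback A \<Gamma> d t ** B = B ** pullback A \<Gamma> d t + A ** G1 t + msmult (2 * d) B" by blast
      have "affine_field U (\<lambda>t. q $ Inl () + d * t) (pullback A \<Gamma> d)
         (\<lambda>t. (q $ Inl () + d * t) *s p1 t - pullback A \<Gamma> d t *v p t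
            + upper (mexp (companion A B) (t - t0) *v (\<chi> i. q $ Inr (Inr i)))) \<in> ?V"
        by (rule symmetry_from_particular_solution[OF U(1) C p hom(1,2) G])
      then show "L q \<in> ?V"
        unfolding L_def symmetry_family_def Let_def case_prod_unfold \<Gamma>_def d_def .
    qed
  next
    fix q :: "complex^(unit + ('k + ('n + 'n)))" assume "L q = 0"
    define c where "c = q $ Inl ()"
    define \<Gamma> where "\<Gamma> = fst (W (\<chi> i. q $ Inr (Inl i)))"
    define d where "d = snd (W (\<chi> i. q $ Inr (Inl i)))"
    define z where "z = (\<chi> i. q $ Inr (Inr i))"
    define y where "y t = mexp (companion A B) (t - t0) *v z" for t
    have "affine_field U (\<lambda>t. c + d * t) (pullback A \<Gamma> d)
         (\<lambda>t. (c + d * t) *s p1 t - pullback A \<Gamma> d t *v p t + upper (y t)) = 0"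
      using \<open>L q = 0\<close>
      unfolding L_def symmetry_family_def Let_def case_prod_unfold \<Gamma>_def d_def c_def z_def y_def .
    then have field0: "affine_field U (\<lambda>t. c + d * t) (pullback A \<Gamma> d)
         (\<lambda>t. (c + d * t) *s p1 t - pullback A \<Gamma> d t *v p t + upper (y t)) (t, x) = 0" for t x
      by simp
    have pair: "(c + d * t, pullback A \<Gamma> d t *v x
        + ((c + d * t) *s p1 t - pullback A \<Gamma> d t *v p t + upper (y t))) = 0"
      if t: "t \<in> U" for t x
      using field0[of t x] unfolding affine_field_def case_prod_conv if_P[OF t] .
    have zero: "c + d * t = 0"
      "pullback A \<Gamma> d t *v x + ((c + d * t) *s p1 t - pullback A \<Gamma> d t *v p t + upper (y t)) = 0"
      if t: "t \<in> U" for t x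
      using pair[OF t, of x] unfolding zero_prod_def prod.inject by blast+
    have cd: "d = 0" "c = 0"
    proof -
      have "((\<lambda>t. c + d * t) has_field_derivative d) (at t0)" by (auto intro!: derivative_eq_intros)
      moreover have "((\<lambda>t. c + d * t) has_field_derivative 0) (at t0)"
        by (rule has_field_derivative_transform_within_open[OF DERIV_const U(1) t0, of 0]) (simp add: zero)
      ultimately show "d = 0" by (rule DERIV_unique)
      with zero(1)[OF t0] show "c = 0" by simp
    qed
    have up: "upper (y t) = 0" if "t \<in> U" for t
      using zero(2)[OF that, of "p t"] by (simp add: cd)
    have low: "lower (y t0) = 0"
    proof -
      have "lower (y t0) $ i = 0" for i
      proof (rule DERIV_unique)
        show "((\<lambda>t. upper (y t) $ i) has_field_derivative lower (y t0) $ i) (at t0)"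
          using hom(1)[of z t0] by (simp add: has_vderiv_def y_def)
        show "((\<lambda>t. upper (y t) $ i) has_field_derivative 0) (at t0)"
          by (rule has_field_derivative_transform_within_open[OF DERIV_const U(1) t0, of 0]) (simp add: up)
      qed
      then show ?thesis by (simp add: vec_eq_iff)
    qed
    have "y t0 = 0" using up[OF t0] low by (intro vec_sum_eqI) (simp_all add: upper_linear lower_linear)
    then have z: "z = 0" by (simp add: y_def)
    have "pullback A \<Gamma> d t0 *v x = 0" for x
      using zero(2)[OF t0, of x] zero(2)[OF t0, of 0] by simp
    then have m0: "pullback A \<Gamma> d t0 = 0" by (metis matrix_eq matrix_vector_mult_0)
    have "\<Gamma> = 0"
    proof -
      let ?E = "mexp (msmult (1/2) A)"
      have "?E t0 ** \<Gamma> ** ?E (- t0) = 0" using m0 by (simp add: pullback_def cd msmult_distribs)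
      then have "?E (- t0) ** (?E t0 ** \<Gamma> ** ?E (- t0)) ** ?E t0 = 0" by (simp add: matrix_distribs)
      moreover have "?E (- t0) ** (?E t0 ** \<Gamma> ** ?E (- t0)) ** ?E t0
          = (?E (- t0) ** ?E t0) ** \<Gamma> ** (?E (- t0) ** ?E t0)" by (simp only: matrix_mul_assoc)
      ultimately show ?thesis by (simp add: mexp_minus)
    qed
    then have "W (\<chi> i. q $ Inr (Inl i)) = 0" using cd by (simp add: \<Gamma>_def d_def prod_eq_iff)
    then have k: "(\<chi> i. q $ Inr (Inl i)) = 0" using W by blast
    show "q = 0"
      unfolding vec_eq_iff
    proof
      fix i show "q $ i = 0 $ i"
      proof (cases i)
        case (Inl j) then show ?thesis using cd by (simp add: c_def)
      next
        case (Inr j)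
        show ?thesis
        proof (cases j)
          case (Inl l) then show ?thesis using Inr k by (simp add: vec_eq_iff)
        next
          case (Inr l) then show ?thesis using \<open>i = Inr j\<close> z by (simp add: z_def vec_eq_iff)
        qed
      qed
    qed
  qed
  then show ?thesis by (simp add: add.assoc mult_2)
qed

text \<open>For \<open>A = 0\<close> and \<open>p = 0\<close> the exponential disappears from the family, and its members are the fields
  that \<open>nonscalar_symmetries\<close> describes. A solution of $\ddot h = Dh$ on the connected domain is determined by
  its initial values.\<close>

theorem vf_dim_upper_bound:
  fixes D :: "complex^'n^'n::finite" and W :: "complex^'k::finite \<Rightarrow> (complex^'n^'n) \<times> complex"
  assumes U: "open U" "U \<noteq> {}" "connected U" and nonscalar: "\<And>c. D \<noteq> mat c"
    and W: "weight_embedding D W"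
    and surj: "\<And>\<Gamma> d. \<Gamma> ** D - D ** \<Gamma> = msmult (2 * d) D \<Longrightarrow> \<exists>\<kappa>. W \<kappa> = (\<Gamma>, d)"
  shows "vf_dim (max_lie_invariance_algebra U (\<lambda>t x v. D *v x)) \<le> enat (1 + CARD('k) + 2 * CARD('n))"
proof -
  note W = W[unfolded weight_embedding_def]
  obtain t0 where t0: "t0 \<in> U" using U(2) by blast
  define L where "L = symmetry_family U 0 D (\<lambda>_. 0) (\<lambda>_. 0) t0 W"
  have ns: "\<not> scalar_matrix D"
    using nonscalar by (auto simp: scalar_matrix_def vec_eq_iff Finite_Cartesian_Product.mat_def)
  have "vf_dim (max_lie_invariance_algebra U (\<lambda>t x v. D *v x)) \<le> enat CARD(unit + ('k + ('n + 'n)))"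
  proof (rule vf_dim_upper[where L = L])
    show "L (q + q') = L q + L q'" "L (c *s q) = vf_scale c (L q)" for q q' c
      unfolding L_def by (rule symmetry_family_linear; use W in blast)+
    show "max_lie_invariance_algebra U (\<lambda>t x v. D *v x) \<subseteq> range L"
    proof
      fix Q assume "Q \<in> max_lie_invariance_algebra U (\<lambda>t x v. D *v x)"
      then have Qh: "Q \<in> holomorphic_vfields U" and Qs: "lie_symmetry U (\<lambda>t x v. D *v x) Q"
        by (auto simp: max_lie_invariance_algebra_def)
      from nonscalar_symmetries[OF U(1,3) ns Qh Qs] obtain c d \<Gamma> h where
        h: "\<And>b. (\<lambda>t. h t $ b) holomorphic_on U"
        and h2: "\<And>t b. t \<in> U \<Longrightarrow> deriv (deriv (\<lambda>t. h t $ b)) t = (D *v h t) $ b"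
        and \<Gamma>: "\<And>i j. (\<Gamma> ** D) $ i $ j - (D ** \<Gamma>) $ i $ j = 2 * d * D $ i $ j"
        and Q: "\<And>t x. t \<in> U \<Longrightarrow> Q (t, x) = (c + d * t, \<Gamma> *v x + h t)" by blast
      have "\<Gamma> ** D - D ** \<Gamma> = msmult (2 * d) D" using \<Gamma> by (simp add: vec_eq_iff)
      then obtain \<kappa> where \<kappa>: "W \<kappa> = (\<Gamma>, d)" using surj by blast
      define h1 where "h1 t = (\<chi> b. deriv (\<lambda>t. h t $ b) t)" for t
      have hd: "has_vderiv h (h1 t) t" if "t \<in> U" for t
        using holomorphic_derivI[OF h U(1) that] by (simp add: has_vderiv_def h1_def)
      have h1d: "has_vderiv h1 (0 *v h1 t + D *v h t) t" if t: "t \<in> U" for t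
        using holomorphic_derivI[OF holomorphic_deriv[OF h U(1)] U(1) t] h2[OF t]
        by (simp add: has_vderiv_def h1_def)
      define z where "z = stack (h t0) (h1 t0)"
      have heq: "h t = upper (mexp (companion 0 D) (t - t0) *v z)" if "t \<in> U" for t
        unfolding z_def by (rule second_order_unique[OF U(1,3) t0 that hd h1d])
      define q :: "complex^(unit + ('k + ('n + 'n)))" where
        "q = (\<chi> i. case i of Inl _ \<Rightarrow> c | Inr (Inl j) \<Rightarrow> \<kappa> $ j | Inr (Inr j) \<Rightarrow> z $ j)"
      have q: "q $ Inl () = c" "(\<chi> i. q $ Inr (Inl i)) = \<kappa>" "(\<chi> i. q $ Inr (Inr i)) = z"
        by (simp_all add: q_def vec_eq_iff)
      have mov: "pullback 0 \<Gamma> d t = \<Gamma>" for t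
        by (simp add: pullback_def msmult_distribs mexp_zero_matrix)
      have "Q p = L q p" for p
      proof (cases p)
        case (Pair t x)
        show ?thesis
        proof (cases "t \<in> U")
          case True
          then show ?thesis
            by (simp add: Pair Q L_def symmetry_family_def q \<kappa> affine_field_def mov heq)
        next
          case False
          then have "Q p = 0" using Qh Pair by (auto simp: holomorphic_vfields_def)
          with False show ?thesis
            by (simp add: Pair L_def symmetry_family_def q \<kappa> affine_field_def)
        qed
      qed
      then have "Q = L q" by (intro ext)
      then show "Q \<in> range L" by simp
    qed
  qed
  then show ?thesis by (simp add: add.assoc mult_2)
qed

section \<open>The minimal dimension\<close>

theorem corollary2:
  fixes D :: "complex^'n^'n::finite" and U :: "complex set"
  assumes "CARD('n) \<ge> 2"
    and "open U" and "U \<noteq> {}" and "simply_connected U"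
  shows "(is_arg_min (\<lambda>F. vf_dim (max_lie_invariance_algebra U F))
             (\<lambda>F. F \<in> commuting_systems U) (\<lambda>t x v. D *v x)
          \<and> vf_dim (max_lie_invariance_algebra U (\<lambda>t x v. D *v x)) = enat (3 * CARD('n) + 1))
         \<longleftrightarrow> (\<not> nilpotent_matrix D \<and> pairwise_coprime (elementary_divisors D))"
proof -
  let ?dim = "\<lambda>F. vf_dim (max_lie_invariance_algebra U F)"
  let ?F = "\<lambda>t x v. D *v x"
  have conn: "connected U" by (rule simply_connected_imp_connected) (rule assms(4))
  have F: "?F = (\<lambda>t x v. 0 *v v + D *v x + (\<lambda>_. 0) t)" by simp
  have F_in: "?F \<in> commuting_systems U"
    unfolding commuting_systems_def
    by (subst F, intro CollectI exI[of _ "0 :: complex^'n^'n"] exI[of _ D] exI[of _ "\<lambda>_. 0"])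
      (simp add: matrix_distribs)
  have lower: "enat (3 * CARD('n) + 1) \<le> ?dim F" if F: "F \<in> commuting_systems U" for F :: "'n ode2"
  proof -
    from F obtain A B :: "complex^'n^'n" and C :: "complex \<Rightarrow> complex^'n" where F: "F = (\<lambda>t x v. A *v v + B *v x + C t)"
      and AB: "A ** B = B ** A" and C: "\<And>b. (\<lambda>t. C t $ b) holomorphic_on U"
      unfolding commuting_systems_def by blast
    obtain W :: "complex^'n \<Rightarrow> _" where "weight_embedding (B + msmult (1/4) (A ** A)) W"
      using centralizer_embedding by blast
    from vf_dim_lower_bound[OF assms(2-4) AB C this]
    show ?thesis by (simp add: F algebra_simps)
  qed
  have strict: "enat (3 * CARD('n) + 2) \<le> ?dim ?F"
    if bad: "nilpotent_matrix D \<or> \<not> pairwise_coprime (elementary_divisors D)"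
  proof -
    obtain W :: "complex^('n + unit) \<Rightarrow> _" where W: "weight_embedding D W"
      using extra_weight[OF bad] by blast
    have "weight_embedding (D + msmult (1/4) ((0 :: complex^'n^'n) ** 0)) W"
      using W by (simp add: matrix_distribs msmult_distribs)
    from vf_dim_lower_bound[OF assms(2-4) _ _ this, of "\<lambda>_. 0"]
    have "enat (1 + CARD('n + unit) + 2 * CARD('n)) \<le> ?dim (\<lambda>t x v. 0 *v v + D *v x + 0)"
      by (simp add: matrix_distribs)
    then show ?thesis by (simp add: algebra_simps)
  qed
  have upper: "?dim ?F \<le> enat (3 * CARD('n) + 1)"
    if good: "\<not> nilpotent_matrix D" "pairwise_coprime (elementary_divisors D)"
  proof -
    obtain W :: "complex^'n \<Rightarrow> _" where W: "weight_embedding D W"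
      and surj: "\<And>\<Gamma> d. \<Gamma> ** D - D ** \<Gamma> = msmult (2 * d) D \<Longrightarrow> d = 0 \<and> (\<exists>x. W x = (\<Gamma>, 0))"
      using all_weights[OF good] by blast
    from vf_dim_upper_bound[OF assms(2,3) conn nonscalar_if_coprime[OF assms(1) good(2)] W] surj
    show ?thesis by (fastforce simp: algebra_simps)
  qed
  show ?thesis
  proof
    assume "is_arg_min ?dim (\<lambda>F. F \<in> commuting_systems U) ?F \<and> ?dim ?F = enat (3 * CARD('n) + 1)"
    then show "\<not> nilpotent_matrix D \<and> pairwise_coprime (elementary_divisors D)"
      using strict by auto
  next
    assume "\<not> nilpotent_matrix D \<and> pairwise_coprime (elementary_divisors D)"
    then have dim: "?dim ?F = enat (3 * CARD('n) + 1)"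
      using upper lower[OF F_in] by (intro antisym) auto
    moreover have "is_arg_min ?dim (\<lambda>F. F \<in> commuting_systems U) ?F"
      unfolding is_arg_min_def dim using F_in lower by (auto simp: not_less)
    ultimately show "is_arg_min ?dim (\<lambda>F. F \<in> commuting_systems U) ?F \<and> ?dim ?F = enat (3 * CARD('n) + 1)"
      by blast
  qed
qed

end
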